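(* Let $k>l\ge 0$ be integers with $k+l\ge 3$, let $\Delta=k-l$, let $\theta\in\mathbb{R}$ and $\xi=e^{i\theta}$, let $f:\mathbb{N}\to[0,\infty)$, and let $A=A_{k,l}(f)=\xi(a^\dagger)^ka^l+\xi^*(a^\dagger)^la^k+f(a^\dagger a)$ with domain $\mathcal{D}_0$. Assume that $f(n)/\beta^{kl}_n$ admits an asymptotic expansion in powers of $n^{-1/2}$, $$\frac{f(n)}{\beta^{kl}_n}\sim \kappa+\frac{L_1}{n^{1/2}}+\frac{L_2}{n}+\cdots$$ with $\kappa<2$. Then $A$ is not essentially self-adjoint and has deficiency indices $n_+=n_-=\Delta$, where $n_\pm=\dim K_\pm$ and $K_\pm=\operatorname{Ran}(A\pm i)^\perp$. Moreover, for each $n_0$ with $l\le n_0<k$, let $(d^{(n_0)}_r)_{r\in\mathbb{N}}$ be a nonzero solution of $$\beta^{kl}_{n_0+r\Delta}\,d^{(n_0)}_{r+1}-\bigl(1+i f(n_0+r\Delta)\bigr)d^{(n_0)}_r-\beta^{lk}_{n_0+r\Delta}\,d^{(n_0)}_{r-1}=0\qquad(r\in\mathbb{N}),$$ (for $r=0$ the term with $d^{(n_0)}_{-1}$ is absent, its coefficient $\beta^{lk}_{n_0}$ being $0$), put $d^{(n_0,+)}_r=d^{(n_0)}_r$, $d^{(n_0,-)}_r=\overline{d^{(n_0)}_r}$, and $$\varphi^\pm_{n_0}=\sum_{r=0}^\infty(\pm i)^r e^{ir\theta}d^{(n_0,\pm)}_r\,\phi_{n_0+r\Delta}.$$ Then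 $K_\pm=\operatorname{span}(\varphi^\pm_{n_0})_{l\le n_0<k}$. The self-adjoint extensions of $A$ are parametrized by $\Delta\times\Delta$ unitary matrices $U=(U_{ij})_{i,j=0}^{\Delta-1}\in\mathrm{U}(\Delta)$ via $U\mapsto A^U$, where $$\mathcal{D}(A^U)=\{\psi+\varphi_U:\ \psi\in\mathcal{D}(\overline{A}),\ \varphi_U\in\mathcal{D}_U\},$$ $$\mathcal{D}_U=\Bigl\{\sum_{i=0}^{\Delta-1}a_i\varphi^+_{l+i}-\sum_{i,j=0}^{\Delta-1}a_iU_{ij}\frac{\|\varphi^+_{l+i}\|}{\|\varphi^+_{l+j}\|}\varphi^-_{l+j}:\ (a_i)_{i=0}^{\Delta-1}\in\mathbb{C}^\Delta\Bigr\},$$ $\overline{A}$ is the closure of $A$, and $A^U\psi=A^*\psi$ for $\psi\in\mathcal{D}(A^U)$. Furthermore, $\{\psi_0+\varphi_U:\ \psi_0\in\mathcal{D}_0,\ \varphi_U\in\mathcal{D}_U\}$ is a core of $A^U$.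
   Context: $\mathbb{N}=\{0,1,2,\dots\}$. $\mathcal{H}$ is a separable complex Hilbert space with orthonormal basis $(\phi_n)_{n\in\mathbb{N}}$ (Fock states); $\mathcal{D}_0$ is the set of finite linear combinations of the $\phi_n$. The operators $a,a^\dagger$ have domain $\mathcal{D}_0$ and act by $a\phi_n=\sqrt{n}\,\phi_{n-1}$ (so $a\phi_0=0$), $a^\dagger\phi_n=\sqrt{n+1}\,\phi_{n+1}$, extended linearly. For $f:\mathbb{N}\to[0,\infty)$, $f(a^\dagger a)$ has domain $\mathcal{D}_0$ and $f(a^\dagger a)\phi_n=f(n)\phi_n$. For integers $x$ and $s\ge0$ the Pochhammer symbol is $(x,s)=x(x+1)\cdots(x+s-1)$ (equal to $1$ if $s=0$), with the convention $(x,s)=0$ whenever $x$ is a negative integer; for integers $n,k,l$ with $k,l\ge0$, $\beta^{kl}_n=\sqrt{(n-l+1,l)(n-l+1,k)}$. A function $g:\mathbb{N}\to\mathbb{C}$ admits the asymptotic expansion $g(n)\sim\sum_{s\ge0}\lambda_s n^{-s/2}$ if for every $S\in\mathbb{N}$ there are $C,N$ with $|g(n)-\sum_{s=0}^S\lambda_s n^{-s/2}|\le C n^{-(S+1)/2}$ for all $n\ge N$ (the series need not converge). *)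

theory Defs
  imports Complex_Main "HOL-Library.Function_Algebras"
begin

text \<open>The Hilbert space H is realised as l2(N) (coefficients w.r.t. the Fock basis phi_n).
  Vectors are coefficient sequences nat => complex; phi_n is the n-th unit sequence.\<close>

type_synonym vec = "nat \<Rightarrow> complex"

definition l2 :: "vec set" where
  "l2 = {x. summable (\<lambda>n. (cmod (x n))\<^sup>2)}"

definition linner :: "vec \<Rightarrow> vec \<Rightarrow> complex" where
  "linner x y = (\<Sum>n. cnj (x n) * y n)"

definition lnorm :: "vec \<Rightarrow> real" where
  "lnorm x = sqrt (\<Sum>n. (cmod (x n))\<^sup>2)"

definition cscale :: "complex \<Rightarrow> vec \<Rightarrow> vec" where
  "cscale c x = (\<lambda>n. c * x n)"

definition fock :: "nat \<Rightarrow> vec" where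
  "fock m = (\<lambda>n. if n = m then 1 else 0)"

text \<open>D0: finite linear combinations of Fock states = finitely supported sequences.\<close>
definition D0 :: "vec set" where
  "D0 = {x. finite {n. x n \<noteq> 0}}"

text \<open>Annihilation and creation operators (coefficient form of a phi_n = sqrt n phi_(n-1),
  a^dagger phi_n = sqrt(n+1) phi_(n+1)); only applied to elements of D0.\<close>
definition ann :: "vec \<Rightarrow> vec" where
  "ann x = (\<lambda>n. complex_of_real (sqrt (real (n + 1))) * x (n + 1))"

definition cre :: "vec \<Rightarrow> vec" where
  "cre x = (\<lambda>n. if n = 0 then 0 else complex_of_real (sqrt (real n)) * x (n - 1))"

definition Aop :: "nat \<Rightarrow> nat \<Rightarrow> real \<Rightarrow> (nat \<Rightarrow> real) \<Rightarrow> vec \<Rightarrow> vec" where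
  "Aop k l \<theta> f x = (\<lambda>n.
      exp (\<i> * complex_of_real \<theta>) * (cre ^^ k) ((ann ^^ l) x) n
    + cnj (exp (\<i> * complex_of_real \<theta>)) * (cre ^^ l) ((ann ^^ k) x) n
    + complex_of_real (f n) * x n)"

text \<open>Operators are identified with their graphs (relations on vectors).\<close>
definition graph_A :: "nat \<Rightarrow> nat \<Rightarrow> real \<Rightarrow> (nat \<Rightarrow> real) \<Rightarrow> (vec \<times> vec) set" where
  "graph_A k l \<theta> f = {(x, Aop k l \<theta> f x) | x. x \<in> D0}"

definition gadjoint :: "(vec \<times> vec) set \<Rightarrow> (vec \<times> vec) set" where
  "gadjoint G = {(y, z). y \<in> l2 \<and> z \<in> l2 \<and> (\<forall>(x, w) \<in> G. linner y w = linner z x)}"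

definition gclosure :: "(vec \<times> vec) set \<Rightarrow> (vec \<times> vec) set" where
  "gclosure G = {(x, y). x \<in> l2 \<and> y \<in> l2 \<and>
     (\<exists>s. (\<forall>n. s n \<in> G) \<and> (\<lambda>n. lnorm (fst (s n) - x)) \<longlonglongrightarrow> 0
                          \<and> (\<lambda>n. lnorm (snd (s n) - y)) \<longlonglongrightarrow> 0)}"

definition dense_l2 :: "vec set \<Rightarrow> bool" where
  "dense_l2 D \<longleftrightarrow> D \<subseteq> l2 \<and> (\<forall>x \<in> l2. \<forall>e > 0. \<exists>y \<in> D. lnorm (x - y) < e)"

definition is_operator :: "(vec \<times> vec) set \<Rightarrow> bool" where
  "is_operator G \<longleftrightarrow> G \<subseteq> l2 \<times> l2 \<and> (\<forall>x y z. (x, y) \<in> G \<longrightarrow> (x, z) \<in> G \<longrightarrow> y = z)"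

definition self_adjoint :: "(vec \<times> vec) set \<Rightarrow> bool" where
  "self_adjoint G \<longleftrightarrow> is_operator G \<and> dense_l2 (Domain G) \<and> gadjoint G = G"

definition ess_self_adjoint :: "(vec \<times> vec) set \<Rightarrow> bool" where
  "ess_self_adjoint G \<longleftrightarrow> self_adjoint (gclosure G)"

definition is_core :: "vec set \<Rightarrow> (vec \<times> vec) set \<Rightarrow> bool" where
  "is_core D T \<longleftrightarrow> D \<subseteq> Domain T \<and> gclosure {(x, y) \<in> T. x \<in> D} = T"

definition Kplus :: "nat \<Rightarrow> nat \<Rightarrow> real \<Rightarrow> (nat \<Rightarrow> real) \<Rightarrow> vec set" where
  "Kplus k l \<theta> f = {y \<in> l2. \<forall>x \<in> D0. linner (Aop k l \<theta> f x + cscale \<i> x) y = 0}"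

definition Kminus :: "nat \<Rightarrow> nat \<Rightarrow> real \<Rightarrow> (nat \<Rightarrow> real) \<Rightarrow> vec set" where
  "Kminus k l \<theta> f = {y \<in> l2. \<forall>x \<in> D0. linner (Aop k l \<theta> f x - cscale \<i> x) y = 0}"

abbreviation cdim :: "vec set \<Rightarrow> nat" where
  "cdim \<equiv> vector_space.dim cscale"

abbreviation cspan :: "vec set \<Rightarrow> vec set" where
  "cspan \<equiv> module.span cscale"

definition poch :: "int \<Rightarrow> nat \<Rightarrow> int" where
  "poch x s = (if x < 0 then 0 else pochhammer x s)"

definition beta :: "nat \<Rightarrow> nat \<Rightarrow> nat \<Rightarrow> real" where
  "beta k l n = sqrt (real_of_int (poch (int n - int l + 1) l * poch (int n - int l + 1) k))"

definition asymp_exp :: "(nat \<Rightarrow> complex) \<Rightarrow> (nat \<Rightarrow> complex) \<Rightarrow> bool" where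
  "asymp_exp g lam \<longleftrightarrow> (\<forall>S::nat. \<exists>C N. \<forall>n \<ge> N.
     cmod (g n - (\<Sum>s\<le>S. lam s * complex_of_real (real n powr (- real s / 2))))
       \<le> C * real n powr (- (real S + 1) / 2))"

text \<open>The vector sum_r c_r phi_(n0 + r Delta) (as a coefficient sequence).\<close>
definition lattice_vec :: "nat \<Rightarrow> nat \<Rightarrow> (nat \<Rightarrow> complex) \<Rightarrow> vec" where
  "lattice_vec \<Delta> n0 c = (\<lambda>m. if n0 \<le> m \<and> \<Delta> dvd (m - n0) then c ((m - n0) div \<Delta>) else 0)"

definition phi_plus :: "nat \<Rightarrow> real \<Rightarrow> nat \<Rightarrow> (nat \<Rightarrow> complex) \<Rightarrow> vec" where
  "phi_plus \<Delta> \<theta> n0 d = lattice_vec \<Delta> n0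
     (\<lambda>r. \<i> ^ r * exp (\<i> * of_nat r * complex_of_real \<theta>) * d r)"

definition phi_minus :: "nat \<Rightarrow> real \<Rightarrow> nat \<Rightarrow> (nat \<Rightarrow> complex) \<Rightarrow> vec" where
  "phi_minus \<Delta> \<theta> n0 d = lattice_vec \<Delta> n0
     (\<lambda>r. (- \<i>) ^ r * exp (\<i> * of_nat r * complex_of_real \<theta>) * cnj (d r))"

definition solves_rec :: "nat \<Rightarrow> nat \<Rightarrow> (nat \<Rightarrow> real) \<Rightarrow> nat \<Rightarrow> (nat \<Rightarrow> complex) \<Rightarrow> bool" where
  "solves_rec k l f n0 d \<longleftrightarrow> (\<forall>r::nat.
     complex_of_real (beta k l (n0 + r * (k - l))) * d (r + 1)
     - (1 + \<i> * complex_of_real (f (n0 + r * (k - l)))) * d r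
     - (if r = 0 then 0 else complex_of_real (beta l k (n0 + r * (k - l))) * d (r - 1)) = 0)"

definition unitary_mats :: "nat \<Rightarrow> (nat \<Rightarrow> nat \<Rightarrow> complex) set" where
  "unitary_mats \<Delta> = {U. (\<forall>i j. (\<Delta> \<le> i \<or> \<Delta> \<le> j) \<longrightarrow> U i j = 0) \<and>
     (\<forall>i<\<Delta>. \<forall>j<\<Delta>. (\<Sum>m<\<Delta>. cnj (U m i) * U m j) = (if i = j then 1 else 0)) \<and>
     (\<forall>i<\<Delta>. \<forall>j<\<Delta>. (\<Sum>m<\<Delta>. U i m * cnj (U j m)) = (if i = j then 1 else 0))}"

definition DU :: "nat \<Rightarrow> nat \<Rightarrow> (nat \<Rightarrow> vec) \<Rightarrow> (nat \<Rightarrow> vec) \<Rightarrow> (nat \<Rightarrow> nat \<Rightarrow> complex) \<Rightarrow> vec set" where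
  "DU \<Delta> l phip phim U = {(\<lambda>n. (\<Sum>i<\<Delta>. a i * phip (l + i) n)
        - (\<Sum>i<\<Delta>. \<Sum>j<\<Delta>. a i * U i j
             * complex_of_real (lnorm (phip (l + i)) / lnorm (phip (l + j))) * phim (l + j) n))
     | a. True}"

definition AU :: "(vec \<times> vec) set \<Rightarrow> vec set \<Rightarrow> (vec \<times> vec) set" where
  "AU G DUset = {(x, y) \<in> gadjoint G.
      \<exists>\<psi> \<phi>. \<psi> \<in> Domain (gclosure G) \<and> \<phi> \<in> DUset \<and> x = \<psi> + \<phi>}"

end

theory Submission
  imports Defs "HOL-Analysis.Summation_Tests" "HOL-Library.Product_Plus"
begin

text \<open>On each lattice \<open>n0 + r * (k - l)\<close> the equation \<open>A* y = \<plusminus>i y\<close> is a three-term recurrence with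
  off-diagonal weights \<open>b r\<close> of order \<open>r powr ((k + l) / 2)\<close>. An energy argument, using only that
  \<open>f / b\<close> tends to \<open>\<kappa> < 2\<close> with bounded variation and that \<open>1 / b\<close> is summable, shows
  \<open>|d r|^2 = O(1 / b r)\<close>, so all solutions are square-summable and each lattice contributes one
  dimension to both deficiency spaces.

  The extensions are described by von Neumann's theory on graphs. The complement of \<open>A\<close> in its
  adjoint with respect to the graph inner product is invariant under \<open>(y, z) \<mapsto> (z, -y)\<close>, hence
  splits into eigenvectors for \<open>i\<close> and \<open>-i\<close>. In orthonormal bases of the deficiency spaces the
  boundary form is \<open>diag(1, -1)\<close> up to a factor, and its maximal isotropic subspaces are the graphs
  of unitary matrices.\<close>

section \<open>Square-summable sequences\<close>

text \<open>Multiplying a solution by \<open>\<i> ^ r\<close> makes the recurrence real apart from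
  the term \<open>\<i> / b r\<close>. Its limit has characteristic polynomial x^2 + \<kappa> x + 1,
  whose roots are nonreal, and then on the unit circle, exactly when |\<kappa>| < 2; the same
  condition makes the energy form positive definite. Nonnegativity of \<open>f\<close> forces
  \<kappa> \<ge> 0, so \<kappa> < 2 is enough. Summability of \<open>1 / b\<close> comes from k + l
  \<ge> 3, and bounded variation of \<open>f / b\<close> from the expansion up to 1/n, whose
  remainder n^(-3/2) is summable.

  The adjoint of A is the same three-term expression on all square-summable sequences with
  square-summable image. No weight connects a site below l to another site, so an eigenvector for a
  nonreal eigenvalue vanishes there and is determined by its values at l, ..., k - 1. These sites
  are the starting points of the \<Delta> lattices, and on each of them the recurrence leaves one
  free constant because its first equation has no preceding term.\<close>

lemma sq_norm_add_le: "(cmod (a + b))\<^sup>2 \<le> 2 * (cmod a)\<^sup>2 + 2 * (cmod b)\<^sup>2"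
proof -
  have "(cmod (a + b))\<^sup>2 \<le> (cmod a + cmod b)\<^sup>2"
    by (rule power_mono[OF norm_triangle_ineq]) simp
  also have "\<dots> \<le> 2 * (cmod a)\<^sup>2 + 2 * (cmod b)\<^sup>2"
    using sum_squares_bound[of "cmod a" "cmod b"] by (simp add: power2_sum)
  finally show ?thesis .
qed

lemma l2_add [simp, intro]:
  assumes "x \<in> l2" "y \<in> l2" shows "x + y \<in> l2"
proof -
  have "summable (\<lambda>n. 2 * (cmod (x n))\<^sup>2 + 2 * (cmod (y n))\<^sup>2)"
    using assms by (simp add: l2_def summable_add summable_mult)
  then have "summable (\<lambda>n. (cmod ((x + y) n))\<^sup>2)"
    by (rule summable_comparison_test'[where N = 0]) (simp add: sq_norm_add_le)
  then show ?thesis by (simp add: l2_def)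
qed

lemma l2_cscale [simp, intro]: "x \<in> l2 \<Longrightarrow> cscale c x \<in> l2"
  unfolding l2_def cscale_def by (auto simp: norm_mult power_mult_distrib intro!: summable_mult)

lemma cscale_uminus_one [simp]: "cscale (-1) x = - x"
  by (auto simp: cscale_def fun_eq_iff)

lemma l2_uminus [simp, intro]: "x \<in> l2 \<Longrightarrow> - x \<in> l2"
  using l2_cscale[of x "-1"] by simp

lemma l2_diff [simp, intro]: "x \<in> l2 \<Longrightarrow> y \<in> l2 \<Longrightarrow> x - y \<in> l2"
  using l2_add[of x "- y"] by simp

lemma l2_zero [simp, intro]: "0 \<in> l2"
  by (simp add: l2_def)

lemma summable_linner [intro]:
  assumes "x \<in> l2" "y \<in> l2" shows "summable (\<lambda>n. cnj (x n) * y n)"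
proof -
  have "summable (\<lambda>n. (cmod (x n))\<^sup>2 + (cmod (y n))\<^sup>2)"
    using assms by (simp add: l2_def summable_add)
  moreover have "norm (cnj (x n) * y n) \<le> (cmod (x n))\<^sup>2 + (cmod (y n))\<^sup>2" for n
  proof -
    have "0 \<le> cmod (x n) * cmod (y n)" by simp
    moreover have "2 * cmod (x n) * cmod (y n) \<le> (cmod (x n))\<^sup>2 + (cmod (y n))\<^sup>2"
      by (rule sum_squares_bound)
    ultimately show ?thesis unfolding norm_mult complex_mod_cnj by linarith
  qed
  ultimately show ?thesis by (rule summable_comparison_test'[where N = 0])
qed

lemma linner_add_right:
  "x \<in> l2 \<Longrightarrow> y \<in> l2 \<Longrightarrow> z \<in> l2 \<Longrightarrow> linner x (y + z) = linner x y + linner x z"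
  unfolding linner_def
  using suminf_add[OF summable_linner summable_linner, of x y x z] by (simp add: algebra_simps)

lemma linner_cscale_right:
  "x \<in> l2 \<Longrightarrow> y \<in> l2 \<Longrightarrow> linner x (cscale c y) = c * linner x y"
  unfolding linner_def cscale_def
  using suminf_mult[OF summable_linner, of x y c] by (simp add: algebra_simps)

lemma linner_commute:
  "x \<in> l2 \<Longrightarrow> y \<in> l2 \<Longrightarrow> linner y x = cnj (linner x y)"
  unfolding linner_def
  using bounded_linear.suminf[OF bounded_linear_cnj summable_linner, of x y] by (simp add: mult.commute)

lemma linner_add_left:
  "x \<in> l2 \<Longrightarrow> y \<in> l2 \<Longrightarrow> z \<in> l2 \<Longrightarrow> linner (x + y) z = linner x z + linner y z"
  by (metis complex_cnj_add l2_add linner_add_right linner_commute)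

lemma linner_cscale_left:
  "x \<in> l2 \<Longrightarrow> y \<in> l2 \<Longrightarrow> linner (cscale c x) y = cnj c * linner x y"
  by (metis complex_cnj_mult l2_cscale linner_cscale_right linner_commute)

lemma linner_uminus_right: "x \<in> l2 \<Longrightarrow> y \<in> l2 \<Longrightarrow> linner x (- y) = - linner x y"
  using linner_cscale_right[of x y "-1"] by simp

lemma linner_uminus_left: "x \<in> l2 \<Longrightarrow> y \<in> l2 \<Longrightarrow> linner (- x) y = - linner x y"
  using linner_cscale_left[of x y "-1"] by simp

lemma linner_diff_right:
  "x \<in> l2 \<Longrightarrow> y \<in> l2 \<Longrightarrow> z \<in> l2 \<Longrightarrow> linner x (y - z) = linner x y - linner x z"
  using linner_add_right[of x y "- z"] by (simp add: linner_uminus_right)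

lemma linner_diff_left:
  "x \<in> l2 \<Longrightarrow> y \<in> l2 \<Longrightarrow> z \<in> l2 \<Longrightarrow> linner (x - y) z = linner x z - linner y z"
  using linner_add_left[of x "- y" z] by (simp add: linner_uminus_left)

lemma linner_zero [simp]: "linner x 0 = 0" "linner 0 x = 0"
  by (simp_all add: linner_def)

lemmas linner_simps =
  linner_add_left linner_add_right linner_diff_left linner_diff_right linner_uminus_left
  linner_uminus_right linner_cscale_left linner_cscale_right

lemma linner_self:
  assumes "x \<in> l2" shows "linner x x = complex_of_real ((lnorm x)\<^sup>2)"
proof -
  have "linner x x = (\<Sum>n. complex_of_real ((cmod (x n))\<^sup>2))"
    unfolding linner_def by (intro suminf_cong) (simp only: complex_norm_square mult.commute)
  also have "\<dots> = complex_of_real (\<Sum>n. (cmod (x n))\<^sup>2)"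
    using assms by (intro suminf_of_real[symmetric]) (simp add: l2_def)
  also have "(\<Sum>n. (cmod (x n))\<^sup>2) = (lnorm x)\<^sup>2"
    using assms by (simp add: l2_def lnorm_def suminf_nonneg)
  finally show ?thesis .
qed

lemma lnorm_sq: "x \<in> l2 \<Longrightarrow> (lnorm x)\<^sup>2 = (\<Sum>n. (cmod (x n))\<^sup>2)"
  by (simp add: l2_def lnorm_def suminf_nonneg)

lemma norm_le_lnorm:
  assumes "x \<in> l2" shows "cmod (x n) \<le> lnorm x"
proof -
  have "(cmod (x n))\<^sup>2 \<le> (\<Sum>n. (cmod (x n))\<^sup>2)"
    using sum_le_suminf[of "\<lambda>n. (cmod (x n))\<^sup>2" "{n}"] assms by (auto simp: l2_def)
  then show ?thesis
    unfolding lnorm_def by (rule real_le_rsqrt)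
qed

lemma lnorm_nonneg: "x \<in> l2 \<Longrightarrow> 0 \<le> lnorm x"
  using norm_le_lnorm[of x 0] norm_ge_zero order_trans by blast

lemma lnorm_zero_iff: "x \<in> l2 \<Longrightarrow> lnorm x = 0 \<longleftrightarrow> x = 0"
  using norm_le_lnorm[of x] by (auto simp: fun_eq_iff lnorm_def)

text \<open>Squared norms, to fit the \<open>complete\<close> assumption of
  \<open>hilbert_space\<close>. The limit is taken coordinatewise; the bound on
  \<open>X n - X m\<close> survives the limit in m on every finite partial sum, hence on the series,
  and this also puts the limit into \<open>l2\<close>.\<close>

lemma l2_complete:
  assumes X: "\<And>n. X n \<in> l2"
    and Cauchy: "\<And>e. e > 0 \<Longrightarrow> \<exists>N. \<forall>m\<ge>N. \<forall>n\<ge>N. (lnorm (X m - X n))\<^sup>2 < e"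
  shows "\<exists>L\<in>l2. (\<lambda>n. (lnorm (X n - L))\<^sup>2) \<longlonglongrightarrow> 0"
proof -
  have "Cauchy (\<lambda>n. X n k)" for k
  proof (rule metric_CauchyI)
    fix e :: real assume "e > 0"
    then obtain N where N: "\<And>m n. m \<ge> N \<Longrightarrow> n \<ge> N \<Longrightarrow> (lnorm (X m - X n))\<^sup>2 < e\<^sup>2"
      using Cauchy[of "e\<^sup>2"] by auto
    have "dist (X m k) (X n k) < e" if "m \<ge> N" "n \<ge> N" for m n
    proof -
      have "lnorm (X m - X n) < e"
        using N[OF that] \<open>e > 0\<close> by (simp add: power2_less_imp_less)
      then show ?thesis
        using norm_le_lnorm[of "X m - X n" k] X by (simp add: dist_norm)
    qed
    then show "\<exists>N. \<forall>m\<ge>N. \<forall>n\<ge>N. dist (X m k) (X n k) < e" by blast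
  qed
  then obtain L where L: "\<And>k. (\<lambda>n. X n k) \<longlonglongrightarrow> L k"
    unfolding Cauchy_convergent_iff convergent_def by metis
  have tail: "summable (\<lambda>k. (cmod (X n k - L k))\<^sup>2) \<and> (\<Sum>k. (cmod (X n k - L k))\<^sup>2) \<le> e"
    if N: "\<And>m n. m \<ge> N \<Longrightarrow> n \<ge> N \<Longrightarrow> (lnorm (X m - X n))\<^sup>2 < e" and "n \<ge> N" for N n e
  proof -
    have part: "(\<Sum>k<K. (cmod (X n k - L k))\<^sup>2) \<le> e" for K
    proof (rule LIMSEQ_le_const2)
      show "(\<lambda>m. \<Sum>k<K. (cmod (X n k - X m k))\<^sup>2) \<longlonglongrightarrow> (\<Sum>k<K. (cmod (X n k - L k))\<^sup>2)"
        by (intro tendsto_intros L)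
      have "(\<Sum>k<K. (cmod (X n k - X m k))\<^sup>2) \<le> e" if "m \<ge> N" for m
      proof -
        have "(\<Sum>k<K. (cmod ((X n - X m) k))\<^sup>2) \<le> (lnorm (X n - X m))\<^sup>2"
          using X l2_diff[of "X n" "X m"]
          by (subst lnorm_sq) (auto intro!: sum_le_suminf simp: l2_def)
        then show ?thesis using N[OF \<open>n \<ge> N\<close> that] by simp
      qed
      then show "\<exists>M. \<forall>m\<ge>M. (\<Sum>k<K. (cmod (X n k - X m k))\<^sup>2) \<le> e" by blast
    qed
    have "summable (\<lambda>k. (cmod (X n k - L k))\<^sup>2)"
      using part by (intro summableI_nonneg_bounded) auto
    then show ?thesis using part suminf_le_const by blast
  qed
  have "L \<in> l2"
  proof -
    obtain N where "\<And>m n. m \<ge> N \<Longrightarrow> n \<ge> N \<Longrightarrow> (lnorm (X m - X n))\<^sup>2 < 1"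
      using Cauchy[of 1] by auto
    from tail[OF this order_refl] have "X N - L \<in> l2" by (simp add: l2_def)
    then have "X N - (X N - L) \<in> l2" using X by blast
    then show ?thesis by simp
  qed
  moreover have "(\<lambda>n. (lnorm (X n - L))\<^sup>2) \<longlonglongrightarrow> 0"
  proof (rule LIMSEQ_I)
    fix e :: real assume "e > 0"
    then obtain N where N: "\<And>m n. m \<ge> N \<Longrightarrow> n \<ge> N \<Longrightarrow> (lnorm (X m - X n))\<^sup>2 < e / 2"
      using Cauchy[of "e / 2"] by auto
    have "norm ((lnorm (X n - L))\<^sup>2 - 0) < e" if "n \<ge> N" for n
    proof -
      have "(lnorm (X n - L))\<^sup>2 \<le> e / 2"
        using tail[OF N that] lnorm_sq[of "X n - L"] X \<open>L \<in> l2\<close> by simp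
      moreover have "e / 2 < e" using \<open>e > 0\<close> by simp
      ultimately have "(lnorm (X n - L))\<^sup>2 < e" by (rule order_le_less_trans)
      then show ?thesis by simp
    qed
    then show "\<exists>N. \<forall>n\<ge>N. norm ((lnorm (X n - L))\<^sup>2 - 0) < e" by blast
  qed
  ultimately show ?thesis by blast
qed

section \<open>Orthogonal projection\<close>

text \<open>Formulated on a carrier set, because the space needed later is the set
  \<open>l2 \<times> l2\<close> and not a type. Completeness is stated through
  \<open>Re (ip x x)\<close>, so that no metric has to be set up.\<close>

locale hilbert_space =
  fixes H :: "'a::ab_group_add set" and sc :: "complex \<Rightarrow> 'a \<Rightarrow> 'a" and ip :: "'a \<Rightarrow> 'a \<Rightarrow> complex"
  assumes add_mem: "x \<in> H \<Longrightarrow> y \<in> H \<Longrightarrow> x + y \<in> H"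
    and sc_mem: "x \<in> H \<Longrightarrow> sc c x \<in> H"
    and sc_minus_one: "sc (-1) x = - x"
    and ip_add_right: "x \<in> H \<Longrightarrow> y \<in> H \<Longrightarrow> z \<in> H \<Longrightarrow> ip x (y + z) = ip x y + ip x z"
    and ip_sc_right: "x \<in> H \<Longrightarrow> y \<in> H \<Longrightarrow> ip x (sc c y) = c * ip x y"
    and ip_commute: "x \<in> H \<Longrightarrow> y \<in> H \<Longrightarrow> ip y x = cnj (ip x y)"
    and ip_self_nonneg: "x \<in> H \<Longrightarrow> 0 \<le> Re (ip x x)"
    and complete: "(\<And>n. X n \<in> H) \<Longrightarrow>
        (\<And>e. e > 0 \<Longrightarrow> \<exists>N. \<forall>m\<ge>N. \<forall>n\<ge>N. Re (ip (X m - X n) (X m - X n)) < e) \<Longrightarrow>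
        \<exists>L\<in>H. (\<lambda>n. Re (ip (X n - L) (X n - L))) \<longlonglongrightarrow> 0"
begin

definition nsq :: "'a \<Rightarrow> real" where "nsq x = Re (ip x x)"

definition clo :: "'a set \<Rightarrow> 'a set" where
  "clo V = {x \<in> H. \<forall>e>0. \<exists>v\<in>V. nsq (v - x) < e}"

lemma uminus_mem: "x \<in> H \<Longrightarrow> - x \<in> H"
  using sc_mem[of x "-1"] by (simp add: sc_minus_one)

lemma diff_mem: "x \<in> H \<Longrightarrow> y \<in> H \<Longrightarrow> x - y \<in> H"
  using add_mem[of x "- y"] by (simp add: uminus_mem)

lemma ip_add_left: "x \<in> H \<Longrightarrow> y \<in> H \<Longrightarrow> z \<in> H \<Longrightarrow> ip (x + y) z = ip x z + ip y z"
  by (metis complex_cnj_add add_mem ip_add_right ip_commute)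

lemma ip_sc_left: "x \<in> H \<Longrightarrow> y \<in> H \<Longrightarrow> ip (sc c x) y = cnj c * ip x y"
  by (metis complex_cnj_mult sc_mem ip_sc_right ip_commute)

lemma ip_diff_right: "x \<in> H \<Longrightarrow> y \<in> H \<Longrightarrow> z \<in> H \<Longrightarrow> ip x (y - z) = ip x y - ip x z"
  using ip_add_right[of x y "- z"] ip_sc_right[of x z "-1"]
  by (simp add: uminus_mem sc_minus_one)

lemma ip_diff_left: "x \<in> H \<Longrightarrow> y \<in> H \<Longrightarrow> z \<in> H \<Longrightarrow> ip (x - y) z = ip x z - ip y z"
  using ip_add_left[of x "- y" z] ip_sc_left[of y z "-1"]
  by (simp add: uminus_mem sc_minus_one)

lemmas ip_simps = ip_add_left ip_add_right ip_diff_left ip_diff_right ip_sc_left ip_sc_right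
  add_mem diff_mem sc_mem

lemma nsq_nonneg: "x \<in> H \<Longrightarrow> 0 \<le> nsq x"
  by (simp add: nsq_def ip_self_nonneg)

lemma nsq_diff_sc:
  assumes "v \<in> H" "y \<in> H"
  shows "nsq (y - sc (complex_of_real s * ip v y) v)
    = nsq y - 2 * s * (cmod (ip v y))\<^sup>2 + s\<^sup>2 * (cmod (ip v y))\<^sup>2 * nsq v"
proof -
  have "Im (ip v v) = 0"
    using ip_commute[of v v] assms by (metis add.inverse_inverse cnj.simps(2) equal_neg_zero)
  then show ?thesis
    using assms ip_commute[of v y] unfolding cmod_power2
    by (simp add: nsq_def ip_simps power2_eq_square algebra_simps)
qed

text \<open>If moving \<open>y\<close> along \<open>v\<close> can lower its squared norm by at most
  \<open>e\<close>, then \<open>y\<close> is nearly orthogonal to \<open>v\<close>: the best step is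
  \<open>s * ip v y\<close> with \<open>s = 1 / nsq v\<close>. With \<open>e = nsq y\<close> this is
  Cauchy-Schwarz; with \<open>e = 1 / (n + 1)\<close> it is applied along a minimising
  sequence.\<close>

lemma sq_ip_le:
  assumes "v \<in> H" "y \<in> H" and le: "\<And>t. nsq y \<le> nsq (y - sc t v) + e"
  shows "(cmod (ip v y))\<^sup>2 \<le> e * nsq v"
proof -
  let ?P = "(cmod (ip v y))\<^sup>2" and ?N = "nsq v"
  have *: "2 * s * ?P \<le> e + s\<^sup>2 * ?P * ?N" for s
    using le[of "complex_of_real s * ip v y"] nsq_diff_sc[OF assms(1,2), of s] by simp
  have N: "?N \<ge> 0" using assms by (simp add: nsq_nonneg)
  show ?thesis
  proof (cases "?N = 0")
    case True
    have "?P = 0"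
    proof (rule ccontr)
      assume "?P \<noteq> 0"
      then have "2 * (e / ?P) * ?P = 2 * e" "2 * (1 / ?P) * ?P = 2" "?P > 0" by auto
      \<comment> \<open>For \<open>nsq v = 0\<close> the right side of \<open>*\<close> is just e,
        and this s lifts the left side to 2|e| + 2.\<close>
      moreover have "2 * ((\<bar>e\<bar> + 1) / ?P) * ?P = 2 * \<bar>e\<bar> + 2" using \<open>?P \<noteq> 0\<close> by simp
      ultimately show False using *[of "(\<bar>e\<bar> + 1) / ?P"] True by simp
    qed
    then show ?thesis using True by simp
  next
    case False
    then have "?P / ?N \<le> e"
      using *[of "1 / ?N"] by (simp add: power2_eq_square)
    then show ?thesis using False N by (simp add: divide_le_eq)
  qed
qed

lemma Cauchy_Schwarz:
  assumes "v \<in> H" "y \<in> H" shows "(cmod (ip v y))\<^sup>2 \<le> nsq y * nsq v"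
proof (rule sq_ip_le[OF assms])
  show "nsq y \<le> nsq (y - sc t v) + nsq y" for t
    using assms by (simp add: nsq_nonneg diff_mem sc_mem)
qed

lemma ip_eq_zero_clo:
  assumes "V \<subseteq> H" "x \<in> clo V" "y \<in> H" "\<And>v. v \<in> V \<Longrightarrow> ip v y = 0"
  shows "ip x y = 0"
proof (rule ccontr)
  assume "ip x y \<noteq> 0"
  have xH: "x \<in> H" using assms by (simp add: clo_def)
  let ?P = "(cmod (ip x y))\<^sup>2"
  \<comment> \<open>The summand 1 keeps the quotient below meaningful when
    \<open>nsq y = 0\<close>.\<close>
  have "?P > 0" "nsq y + 1 > 0"
    using \<open>ip x y \<noteq> 0\<close> nsq_nonneg[of y] assms by auto
  then have "?P / (nsq y + 1) > 0" by simp
  then obtain v where v: "v \<in> V" "nsq (v - x) < ?P / (nsq y + 1)"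
    using assms(2) unfolding clo_def by blast
  have vH: "v \<in> H" using v assms by blast
  have "?P = (cmod (ip (v - x) y))\<^sup>2"
    using assms v xH vH by (simp add: ip_diff_left)
  also have "\<dots> \<le> nsq y * nsq (v - x)"
    using Cauchy_Schwarz[of "v - x" y] assms xH vH by (simp add: diff_mem)
  also have "\<dots> \<le> (nsq y + 1) * nsq (v - x)"
    using nsq_nonneg[of "v - x"] xH vH by (simp add: diff_mem mult_right_mono)
  also have "\<dots> < (nsq y + 1) * (?P / (nsq y + 1))"
    using v \<open>nsq y + 1 > 0\<close> by (intro mult_strict_left_mono) auto
  finally show False using \<open>nsq y + 1 > 0\<close> by simp
qed

text \<open>\<open>V\<close> is not assumed closed, so the minimiser is the limit of a minimising
  sequence in \<open>V\<close> and lies in \<open>clo V\<close>. Orthogonality is obtained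
  approximately for the members of the sequence and then passed to the limit.\<close>

lemma projection:
  assumes V: "V \<subseteq> H" "V \<noteq> {}" "\<And>x y. x \<in> V \<Longrightarrow> y \<in> V \<Longrightarrow> x + y \<in> V" "\<And>c x. x \<in> V \<Longrightarrow> sc c x \<in> V"
    and x: "x \<in> H"
  shows "\<exists>p\<in>clo V. \<forall>v\<in>V. ip v (x - p) = 0"
proof -
  define d where "d = (INF v\<in>V. nsq (x - v))"
  have bdd: "bdd_below ((\<lambda>v. nsq (x - v)) ` V)"
    using V x by (intro bdd_belowI[of _ 0]) (auto intro!: nsq_nonneg diff_mem)
  have d_le: "d \<le> nsq (x - v)" if "v \<in> V" for v
    unfolding d_def using bdd that by (rule cINF_lower)
  have "\<exists>v\<in>V. nsq (x - v) < d + 1 / (real n + 1)" for n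
    using cINF_less_iff[OF V(2) bdd, of "d + 1 / (real n + 1)"] by (simp add: d_def[symmetric])
  then obtain X where X: "\<And>n. X n \<in> V" "\<And>n. nsq (x - X n) < d + 1 / (real n + 1)"
    by metis
  have XH: "X n \<in> H" for n using X V by blast
  have half: "nsq (sc (1/2) z) = nsq z / 4" if "z \<in> H" for z
    using that by (simp add: nsq_def ip_simps)
  have X_Cauchy: "nsq (X m - X n) < 2 / (real m + 1) + 2 / (real n + 1)" for m n
  proof -
    \<comment> \<open>Parallelogram law: the midpoint is again in \<open>V\<close>, so it cannot be
      closer than \<open>d\<close>.\<close>
    have "d \<le> nsq (x - sc (1/2) (X m + X n))" by (intro d_le V X)
    then have "4 * d \<le> 4 * nsq (x - sc (1/2) (X m + X n))" by simp
    also have "\<dots> = 2 * nsq (x - X m) + 2 * nsq (x - X n) - nsq (X m - X n)"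
      using x XH by (simp add: nsq_def ip_simps algebra_simps)
    finally show ?thesis using X(2)[of m] X(2)[of n] by simp
  qed
  obtain p where p: "p \<in> H" "(\<lambda>n. nsq (X n - p)) \<longlonglongrightarrow> 0"
  proof -
    have "\<exists>N. \<forall>m\<ge>N. \<forall>n\<ge>N. Re (ip (X m - X n) (X m - X n)) < e" if "e > 0" for e :: real
    proof -
      obtain N where N: "inverse (real (Suc N)) < e / 4"
        using reals_Archimedean[of "e / 4"] \<open>e > 0\<close> by auto
      have "nsq (X m - X n) < e" if "m \<ge> N" "n \<ge> N" for m n
      proof -
        have "1 / (real m + 1) \<le> inverse (real (Suc N))" "1 / (real n + 1) \<le> inverse (real (Suc N))"
          using that by (auto simp: field_simps)
        then show ?thesis using X_Cauchy[of m n] N by simp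
      qed
      then show ?thesis unfolding nsq_def by blast
    qed
    from complete[OF XH this] show ?thesis using that unfolding nsq_def by blast
  qed
  have "p \<in> clo V"
    unfolding clo_def
  proof (intro CollectI conjI allI impI)
    fix e :: real assume "e > 0"
    then obtain n where "norm (nsq (X n - p) - 0) < e"
      using LIMSEQ_D[OF p(2), of e] by blast
    then have "nsq (X n - p) < e" by simp
    then show "\<exists>v\<in>V. nsq (v - p) < e" using X(1)[of n] by blast
  qed (rule p)
  moreover have "ip v (x - p) = 0" if "v \<in> V" for v
  proof -
    have vH: "v \<in> H" using V that by blast
    have b1: "(cmod (ip v (x - X n)))\<^sup>2 \<le> 1 / (real n + 1) * nsq v" for n
    proof (rule sq_ip_le)
      show "nsq (x - X n) \<le> nsq (x - X n - sc t v) + 1 / (real n + 1)" for t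
        using d_le[OF V(3)[OF X(1)[of n] V(4)[OF that]], of t] X(2)[of n] by (simp add: diff_diff_eq)
    qed (use vH x XH in \<open>auto intro: diff_mem\<close>)
    have b2: "(cmod (ip v (X n - p)))\<^sup>2 \<le> nsq (X n - p) * nsq v" for n
      using Cauchy_Schwarz[of v "X n - p"] vH XH p by (simp add: diff_mem)
    have "(cmod (ip v (x - p)))\<^sup>2 \<le> 2 * (1 / (real n + 1) * nsq v) + 2 * (nsq (X n - p) * nsq v)" for n
    proof -
      have "ip v (x - p) = ip v (x - X n) + ip v (X n - p)"
        using vH x XH p by (simp add: ip_simps)
      then show ?thesis
        using sq_norm_add_le[of "ip v (x - X n)" "ip v (X n - p)"] b1[of n] b2[of n] by simp
    qed
    moreover have "(\<lambda>n. 2 * (1 / (real n + 1) * nsq v) + 2 * (nsq (X n - p) * nsq v)) \<longlonglongrightarrow> 2 * (0 * nsq v) + 2 * (0 * nsq v)"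
    proof (intro tendsto_intros p)
      show "(\<lambda>n. 1 / (real n + 1)) \<longlonglongrightarrow> 0"
        using LIMSEQ_inverse_real_of_nat by (simp add: inverse_eq_divide add.commute)
    qed
    ultimately have "(cmod (ip v (x - p)))\<^sup>2 \<le> 2 * (0 * nsq v) + 2 * (0 * nsq v)"
      by (intro LIMSEQ_le_const) auto
    then show ?thesis by simp
  qed
  ultimately show ?thesis by blast
qed

end

section \<open>Graphs of operators and their adjoints\<close>

definition sc2 :: "complex \<Rightarrow> (nat \<Rightarrow> complex) \<times> (nat \<Rightarrow> complex) \<Rightarrow> (nat \<Rightarrow> complex) \<times> (nat \<Rightarrow> complex)" where
  "sc2 c p = (cscale c (fst p), cscale c (snd p))"

definition ip2 :: "(nat \<Rightarrow> complex) \<times> (nat \<Rightarrow> complex) \<Rightarrow> (nat \<Rightarrow> complex) \<times> (nat \<Rightarrow> complex) \<Rightarrow> complex" where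
  "ip2 p q = linner (fst p) (fst q) + linner (snd p) (snd q)"

text \<open>A unitary with square -1 on \<open>l2 \<times> l2\<close>, mapping the orthogonal
  complement of a graph onto the graph of the adjoint.\<close>

definition rot :: "(nat \<Rightarrow> complex) \<times> (nat \<Rightarrow> complex) \<Rightarrow> (nat \<Rightarrow> complex) \<times> (nat \<Rightarrow> complex)" where
  "rot p = (snd p, - fst p)"

text \<open>The boundary (Lagrange) form. Adjoints are annihilators of graphs under it, and a
  self-adjoint graph is its own annihilator, so extension theory becomes a question about isotropic
  subspaces.\<close>

definition bdform :: "(nat \<Rightarrow> complex) \<times> (nat \<Rightarrow> complex) \<Rightarrow> (nat \<Rightarrow> complex) \<times> (nat \<Rightarrow> complex) \<Rightarrow> complex" where
  "bdform p q = linner (fst p) (snd q) - linner (snd p) (fst q)"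

lemma ip2_self: "p \<in> l2 \<times> l2 \<Longrightarrow> ip2 p p = complex_of_real ((lnorm (fst p))\<^sup>2 + (lnorm (snd p))\<^sup>2)"
  by (auto simp: ip2_def linner_self)

lemma graph_complete:
  assumes X: "\<And>n. X n \<in> l2 \<times> l2"
    and Cauchy: "\<And>e. e > 0 \<Longrightarrow> \<exists>N. \<forall>m\<ge>N. \<forall>n\<ge>N. Re (ip2 (X m - X n) (X m - X n)) < e"
  shows "\<exists>L\<in>l2 \<times> l2. (\<lambda>n. Re (ip2 (X n - L) (X n - L))) \<longlonglongrightarrow> 0"
proof -
  have X1: "fst (X n) \<in> l2" and X2: "snd (X n) \<in> l2" for n
    using X[of n] by (auto simp: mem_Times_iff)
  have sq: "Re (ip2 (X n - L) (X n - L)) = (lnorm (fst (X n) - fst L))\<^sup>2 + (lnorm (snd (X n) - snd L))\<^sup>2"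
    if "L \<in> l2 \<times> l2" for n L
    using that X[of n] by (subst ip2_self) (auto simp: mem_Times_iff)
  have "\<exists>L\<in>l2. (\<lambda>n. (lnorm (fst (X n) - L))\<^sup>2) \<longlonglongrightarrow> 0"
    using X1
  proof (rule l2_complete)
    show "\<exists>N. \<forall>m\<ge>N. \<forall>n\<ge>N. (lnorm (fst (X m) - fst (X n)))\<^sup>2 < e" if "e > 0" for e
      using Cauchy[OF that] sq[OF X] by (smt (verit) zero_le_power2)
  qed
  then obtain L1 where L1: "L1 \<in> l2" "(\<lambda>n. (lnorm (fst (X n) - L1))\<^sup>2) \<longlonglongrightarrow> 0" by blast
  have "\<exists>L\<in>l2. (\<lambda>n. (lnorm (snd (X n) - L))\<^sup>2) \<longlonglongrightarrow> 0"
    using X2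
  proof (rule l2_complete)
    show "\<exists>N. \<forall>m\<ge>N. \<forall>n\<ge>N. (lnorm (snd (X m) - snd (X n)))\<^sup>2 < e" if "e > 0" for e
      using Cauchy[OF that] sq[OF X] by (smt (verit) zero_le_power2)
  qed
  then obtain L2 where L2: "L2 \<in> l2" "(\<lambda>n. (lnorm (snd (X n) - L2))\<^sup>2) \<longlonglongrightarrow> 0" by blast
  have "(\<lambda>n. Re (ip2 (X n - (L1, L2)) (X n - (L1, L2)))) \<longlonglongrightarrow> 0"
    using tendsto_add[OF L1(2) L2(2)] sq[of "(L1, L2)"] L1(1) L2(1) by simp
  then show ?thesis using L1(1) L2(1) by blast
qed

interpretation gr: hilbert_space "l2 \<times> l2" sc2 ip2
proof
  show "ip2 y x = cnj (ip2 x y)" if "x \<in> l2 \<times> l2" "y \<in> l2 \<times> l2" for x y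
    using that linner_commute[of "fst x" "fst y"] linner_commute[of "snd x" "snd y"]
    by (auto simp: ip2_def)
  show "\<exists>L\<in>l2 \<times> l2. (\<lambda>n. Re (ip2 (X n - L) (X n - L))) \<longlonglongrightarrow> 0"
    if "\<And>n. X n \<in> l2 \<times> l2"
      "\<And>e. e > 0 \<Longrightarrow> \<exists>N. \<forall>m\<ge>N. \<forall>n\<ge>N. Re (ip2 (X m - X n) (X m - X n)) < e" for X
    using that by (rule graph_complete)
qed (auto simp: sc2_def ip2_def linner_simps linner_self algebra_simps)

lemma nsq_eq: "p \<in> l2 \<times> l2 \<Longrightarrow> gr.nsq p = (lnorm (fst p))\<^sup>2 + (lnorm (snd p))\<^sup>2"
  by (simp add: gr.nsq_def ip2_self)

text \<open>Connects the sequential closure of the theorem with the closure in which the projection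
  theorem finds its points.\<close>

lemma gclosure_eq_clo:
  assumes S: "S \<subseteq> l2 \<times> l2" shows "gclosure S = gr.clo S"
proof (intro set_eqI iffI)
  fix p assume "p \<in> gclosure S"
  then have p: "p \<in> l2 \<times> l2" and "\<exists>s. (\<forall>n. s n \<in> S) \<and> (\<lambda>n. lnorm (fst (s n) - fst p)) \<longlonglongrightarrow> 0 \<and>
      (\<lambda>n. lnorm (snd (s n) - snd p)) \<longlonglongrightarrow> 0"
    unfolding gclosure_def by auto
  then obtain s where s: "\<And>n. s n \<in> S"
    "(\<lambda>n. lnorm (fst (s n) - fst p)) \<longlonglongrightarrow> 0" "(\<lambda>n. lnorm (snd (s n) - snd p)) \<longlonglongrightarrow> 0"
    by blast
  have "(\<lambda>n. (lnorm (fst (s n) - fst p))\<^sup>2 + (lnorm (snd (s n) - snd p))\<^sup>2) \<longlonglongrightarrow> 0\<^sup>2 + 0\<^sup>2"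
    by (intro tendsto_intros s)
  moreover have "(lnorm (fst (s n) - fst p))\<^sup>2 + (lnorm (snd (s n) - snd p))\<^sup>2 = gr.nsq (s n - p)" for n
    using nsq_eq[of "s n - p"] gr.diff_mem[of "s n" p] p s(1)[of n] S by auto
  ultimately have lim: "(\<lambda>n. gr.nsq (s n - p)) \<longlonglongrightarrow> 0" by simp
  have "\<exists>v\<in>S. gr.nsq (v - p) < e" if e: "e > 0" for e
  proof -
    obtain n where "norm (gr.nsq (s n - p) - 0) < e"
      using LIMSEQ_D[OF lim e] by blast
    then have "gr.nsq (s n - p) < e" by simp
    then show ?thesis using s(1)[of n] by blast
  qed
  then show "p \<in> gr.clo S" using p by (simp add: gr.clo_def)
next
  fix p assume "p \<in> gr.clo S"
  then have p: "p \<in> l2 \<times> l2" and *: "\<And>e. e > 0 \<Longrightarrow> \<exists>v\<in>S. gr.nsq (v - p) < e"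
    by (auto simp: gr.clo_def)
  have "\<exists>v\<in>S. gr.nsq (v - p) < 1 / (real n + 1)" for n
    by (rule *) simp
  then obtain s where s: "\<And>n. s n \<in> S" "\<And>n. gr.nsq (s n - p) < 1 / (real n + 1)" by metis
  have eq: "gr.nsq (s n - p) = (lnorm (fst (s n) - fst p))\<^sup>2 + (lnorm (snd (s n) - snd p))\<^sup>2" for n
    using nsq_eq[of "s n - p"] gr.diff_mem[of "s n" p] p s(1)[of n] S by auto
  have lim: "(\<lambda>n. 1 / (real n + 1)) \<longlonglongrightarrow> 0"
    using LIMSEQ_inverse_real_of_nat by (simp add: inverse_eq_divide add.commute)
  have 1: "(lnorm (fst (s n) - fst p))\<^sup>2 \<le> 1 / (real n + 1)" for n
    using s(2)[of n] zero_le_power2[of "lnorm (snd (s n) - snd p)"] unfolding eq by linarith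
  have 2: "(lnorm (snd (s n) - snd p))\<^sup>2 \<le> 1 / (real n + 1)" for n
    using s(2)[of n] zero_le_power2[of "lnorm (fst (s n) - fst p)"] unfolding eq by linarith
  have "(\<lambda>n. (lnorm (fst (s n) - fst p))\<^sup>2) \<longlonglongrightarrow> 0" "(\<lambda>n. (lnorm (snd (s n) - snd p))\<^sup>2) \<longlonglongrightarrow> 0"
    by (rule real_tendsto_sandwich[OF _ _ tendsto_const lim]; use 1 2 in simp)+
  then show "p \<in> gclosure S"
    using p s(1) by (cases p) (auto simp: gclosure_def intro!: exI[of _ s])
qed

section \<open>The boundary form and the calculus of adjoints and closures\<close>

lemma bdform_eq_ip2: "p \<in> l2 \<times> l2 \<Longrightarrow> q \<in> l2 \<times> l2 \<Longrightarrow> bdform p q = ip2 p (rot q)"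
  by (auto simp: bdform_def ip2_def rot_def linner_simps)

lemma bdform_rot_left: "p \<in> l2 \<times> l2 \<Longrightarrow> q \<in> l2 \<times> l2 \<Longrightarrow> bdform (rot p) q = ip2 p q"
  by (auto simp: bdform_def ip2_def rot_def linner_simps)

lemma rot_mem: "q \<in> l2 \<times> l2 \<Longrightarrow> rot q \<in> l2 \<times> l2"
  by (auto simp: rot_def)

lemma bdform_commute: "p \<in> l2 \<times> l2 \<Longrightarrow> q \<in> l2 \<times> l2 \<Longrightarrow> bdform q p = - cnj (bdform p q)"
  using linner_commute[of "fst p" "snd q"] linner_commute[of "snd p" "fst q"]
  by (auto simp: bdform_def)

lemma bdform_add_left:
  "p \<in> l2 \<times> l2 \<Longrightarrow> p' \<in> l2 \<times> l2 \<Longrightarrow> q \<in> l2 \<times> l2 \<Longrightarrow> bdform (p + p') q = bdform p q + bdform p' q"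
  by (auto simp: bdform_def linner_simps)

lemma bdform_add_right:
  "p \<in> l2 \<times> l2 \<Longrightarrow> q \<in> l2 \<times> l2 \<Longrightarrow> q' \<in> l2 \<times> l2 \<Longrightarrow> bdform p (q + q') = bdform p q + bdform p q'"
  by (auto simp: bdform_def linner_simps)

lemma bdform_sc2_left:
  "p \<in> l2 \<times> l2 \<Longrightarrow> q \<in> l2 \<times> l2 \<Longrightarrow> bdform (sc2 c p) q = cnj c * bdform p q"
  by (auto simp: bdform_def sc2_def linner_simps algebra_simps)

text \<open>Continuity of the boundary form in the graph norm: it is an inner product with the fixed
  vector \<open>rot q\<close>.\<close>

lemma bdform_gclosure:
  assumes "S \<subseteq> l2 \<times> l2" "p \<in> gclosure S" "q \<in> l2 \<times> l2" "\<And>s. s \<in> S \<Longrightarrow> bdform s q = 0"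
  shows "bdform p q = 0"
proof -
  have "p \<in> gr.clo S" using assms gclosure_eq_clo by simp
  moreover have "p \<in> l2 \<times> l2" using calculation by (simp add: gr.clo_def)
  moreover have "ip2 s (rot q) = 0" if "s \<in> S" for s
    using assms(1,3) assms(4)[OF that] bdform_eq_ip2[of s q] that by auto
  ultimately show ?thesis
    using gr.ip_eq_zero_clo[OF assms(1), of p "rot q"] rot_mem assms(3) bdform_eq_ip2 by simp
qed

lemma mem_gadjoint_iff: "p \<in> gadjoint S \<longleftrightarrow> p \<in> l2 \<times> l2 \<and> (\<forall>q\<in>S. bdform p q = 0)"
  by (cases p) (auto simp: gadjoint_def bdform_def)

lemma gadjoint_subset: "gadjoint S \<subseteq> l2 \<times> l2"
  by (auto simp: mem_gadjoint_iff)

lemma gadjoint_antimono: "S \<subseteq> T \<Longrightarrow> gadjoint T \<subseteq> gadjoint S"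
  unfolding subset_iff mem_gadjoint_iff by blast

lemma gadjoint_add:
  assumes "S \<subseteq> l2 \<times> l2" "p \<in> gadjoint S" "q \<in> gadjoint S" shows "p + q \<in> gadjoint S"
  using assms gr.add_mem[of p q] bdform_add_left[of p q] unfolding mem_gadjoint_iff
  by (metis add_0 subsetD)

lemma gadjoint_sc2:
  assumes "S \<subseteq> l2 \<times> l2" "p \<in> gadjoint S" shows "sc2 c p \<in> gadjoint S"
  using assms gr.sc_mem[of p c] bdform_sc2_left[of p _ c] unfolding mem_gadjoint_iff
  by (metis mult_zero_right subsetD)

lemma sc2_minus_one: "sc2 (-1) p = - p"
  by (rule gr.sc_minus_one)

lemma gadjoint_diff:
  assumes "S \<subseteq> l2 \<times> l2" "p \<in> gadjoint S" "q \<in> gadjoint S" shows "p - q \<in> gadjoint S"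
  using gadjoint_add[OF assms(1,2) gadjoint_sc2[OF assms(1,3), of "-1"]] by (simp add: sc2_minus_one)

lemma gclosure_subset: "gclosure S \<subseteq> l2 \<times> l2"
  by (auto simp: gclosure_def)

lemma subset_gclosure:
  assumes "S \<subseteq> l2 \<times> l2" shows "S \<subseteq> gclosure S"
proof
  fix p assume p: "p \<in> S"
  have "gr.nsq (p - p) = 0" by (simp add: gr.nsq_def ip2_def)
  then have "\<forall>e>0. \<exists>v\<in>S. gr.nsq (v - p) < e" using p by metis
  then show "p \<in> gclosure S"
    unfolding gclosure_eq_clo[OF assms] gr.clo_def using p assms by blast
qed

text \<open>Prepares the core claim, where approximants from the graph of A are all shifted by one
  fixed defect vector.\<close>

lemma gclosure_translate:
  assumes "e \<in> l2 \<times> l2" "p \<in> gclosure S" shows "p + e \<in> gclosure ((\<lambda>s. s + e) ` S)"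
proof -
  obtain s where s: "\<And>n. s n \<in> S" "(\<lambda>n. lnorm (fst (s n) - fst p)) \<longlonglongrightarrow> 0"
    "(\<lambda>n. lnorm (snd (s n) - snd p)) \<longlonglongrightarrow> 0"
    using assms(2) unfolding gclosure_def by force
  have "p + e \<in> l2 \<times> l2" using assms gclosure_subset gr.add_mem by blast
  moreover have "(\<lambda>n. lnorm (fst (s n + e) - fst (p + e))) \<longlonglongrightarrow> 0"
    "(\<lambda>n. lnorm (snd (s n + e) - snd (p + e))) \<longlonglongrightarrow> 0"
    using s by simp_all
  ultimately show ?thesis
    using s(1) unfolding gclosure_def case_prod_unfold mem_Times_iff
    by (intro CollectI conjI exI[of _ "\<lambda>n. s n + e"]) auto
qed

lemma gclosure_mono: "S \<subseteq> T \<Longrightarrow> gclosure S \<subseteq> gclosure T"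
  unfolding gclosure_def by blast

lemma gclosure_gadjoint:
  assumes "S \<subseteq> l2 \<times> l2" shows "gclosure (gadjoint S) = gadjoint S"
proof
  show "gclosure (gadjoint S) \<subseteq> gadjoint S"
  proof
    fix p assume p: "p \<in> gclosure (gadjoint S)"
    have "bdform p q = 0" if "q \<in> S" for q
      by (rule bdform_gclosure[OF gadjoint_subset p]) (use that assms mem_gadjoint_iff in blast)+
    then show "p \<in> gadjoint S"
      using p gclosure_subset unfolding mem_gadjoint_iff by blast
  qed
qed (rule subset_gclosure[OF gadjoint_subset])

lemma gadjoint_gclosure:
  assumes "S \<subseteq> l2 \<times> l2" shows "gadjoint (gclosure S) = gadjoint S"
proof
  show "gadjoint (gclosure S) \<subseteq> gadjoint S"
    by (intro gadjoint_antimono subset_gclosure assms)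
  show "gadjoint S \<subseteq> gadjoint (gclosure S)"
  proof
    fix p assume p: "p \<in> gadjoint S"
    then have pH: "p \<in> l2 \<times> l2" by (simp add: mem_gadjoint_iff)
    have "bdform p q = 0" if q: "q \<in> gclosure S" for q
    proof -
      have qH: "q \<in> l2 \<times> l2" using q gclosure_subset by blast
      have "bdform q p = 0"
      proof (rule bdform_gclosure[OF assms q pH])
        fix s assume s: "s \<in> S"
        then have "bdform p s = 0" using p by (simp add: mem_gadjoint_iff)
        then show "bdform s p = 0"
          using bdform_commute[OF pH, of s] s assms by auto
      qed
      then show ?thesis using bdform_commute[OF qH pH] by simp
    qed
    then show "p \<in> gadjoint (gclosure S)"
      using pH unfolding mem_gadjoint_iff by blast
  qed
qed

text \<open>Project \<open>p\<close> onto the closure of \<open>S\<close>; the remainder is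
  orthogonal to \<open>S\<close>, and \<open>rot\<close> converts orthogonality into membership in
  the adjoint. Applied to the graph of A it gives the von Neumann decomposition, applied to a
  self-adjoint extension it gives the partner of a deficiency vector.\<close>

lemma graph_decomposition:
  assumes S: "S \<subseteq> l2 \<times> l2" "S \<noteq> {}" "\<And>p q. p \<in> S \<Longrightarrow> q \<in> S \<Longrightarrow> p + q \<in> S" "\<And>c p. p \<in> S \<Longrightarrow> sc2 c p \<in> S"
    and p: "p \<in> l2 \<times> l2"
  obtains q where "q \<in> gclosure S" "rot (p - q) \<in> gadjoint S"
proof -
  obtain q where q: "q \<in> gclosure S" "\<And>s. s \<in> S \<Longrightarrow> ip2 s (p - q) = 0"
    using gr.projection[OF S p] gclosure_eq_clo[OF S(1)] by auto
  have H: "p - q \<in> l2 \<times> l2"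
    using p q(1) gclosure_subset by (intro gr.diff_mem) auto
  have "bdform (rot (p - q)) s = 0" if "s \<in> S" for s
  proof -
    have "bdform (rot (p - q)) s = ip2 (p - q) s"
      using H S(1) that by (intro bdform_rot_left) auto
    also have "\<dots> = 0"
      using gr.ip_commute[of s "p - q"] H S(1) that q(2) by auto
    finally show ?thesis .
  qed
  then have "rot (p - q) \<in> gadjoint S" using rot_mem[OF H] unfolding mem_gadjoint_iff by blast
  with q(1) show ?thesis by (rule that)
qed

text \<open>By Pythagoras no element of \<open>D\<close> is closer to \<open>y\<close> than 0
  is.\<close>

lemma linner_zero_dense:
  assumes D: "dense_l2 D" and y: "y \<in> l2" "\<And>x. x \<in> D \<Longrightarrow> linner y x = 0"
  shows "y = 0"
proof (rule ccontr)
  assume "y \<noteq> 0"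
  then have pos: "lnorm y > 0" using y(1) lnorm_zero_iff lnorm_nonneg[OF y(1)] by auto
  then obtain x where x: "x \<in> D" "lnorm (y - x) < lnorm y"
    using D y(1) unfolding dense_l2_def by blast
  have xl: "x \<in> l2" using D x(1) by (auto simp: dense_l2_def)
  have "(lnorm (y - x))\<^sup>2 = (lnorm y)\<^sup>2 + (lnorm x)\<^sup>2"
  proof -
    have "linner x y = 0" using linner_commute[OF y(1) xl] y(2)[OF x(1)] by simp
    then have "linner (y - x) (y - x) = linner y y + linner x x"
      using y(1) y(2)[OF x(1)] xl by (simp add: linner_simps)
    then have "complex_of_real ((lnorm (y - x))\<^sup>2) = complex_of_real ((lnorm y)\<^sup>2 + (lnorm x)\<^sup>2)"
      unfolding linner_self[OF y(1)] linner_self[OF xl] linner_self[OF l2_diff[OF y(1) xl]] by simp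
    then show ?thesis using of_real_eq_iff by blast
  qed
  then have "(lnorm y)\<^sup>2 \<le> (lnorm (y - x))\<^sup>2" by simp
  then have "lnorm y \<le> lnorm (y - x)"
    using lnorm_nonneg[OF l2_diff[OF y(1) xl]] by (rule power2_le_imp_le)
  then show False using x(2) by simp
qed

lemma is_operator_gadjoint:
  assumes "S \<subseteq> l2 \<times> l2" "dense_l2 (Domain S)" shows "is_operator (gadjoint S)"
  unfolding is_operator_def
proof (intro conjI allI impI gadjoint_subset)
  fix x y z assume "(x, y) \<in> gadjoint S" "(x, z) \<in> gadjoint S"
  then have "(0, y - z) \<in> gadjoint S"
    using gadjoint_diff[OF assms(1), of "(x, y)" "(x, z)"] by (simp add: zero_prod_def)
  then have yz: "y - z \<in> l2" "\<And>q. q \<in> S \<Longrightarrow> linner (y - z) (fst q) = 0"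
    by (auto simp: mem_gadjoint_iff bdform_def)
  have "y - z = 0"
    using yz(2) by (intro linner_zero_dense[OF assms(2) yz(1)]) force
  then show "y = z" by simp
qed

section \<open>Self-adjoint extensions\<close>

lemma is_operator_subset:
  assumes "is_operator T" "S \<subseteq> T" shows "is_operator S"
  unfolding is_operator_def
proof (intro conjI allI impI)
  show "S \<subseteq> l2 \<times> l2" using assms unfolding is_operator_def by (metis order_trans)
  fix x y z assume "(x, y) \<in> S" "(x, z) \<in> S"
  then have "(x, y) \<in> T" "(x, z) \<in> T" using assms(2) by auto
  then show "y = z" using assms(1) by (simp add: is_operator_def)
qed

lemma dense_l2_superset: "dense_l2 D \<Longrightarrow> D \<subseteq> E \<Longrightarrow> E \<subseteq> l2 \<Longrightarrow> dense_l2 E"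
  unfolding dense_l2_def by (metis subsetD)

locale symmetric_operator =
  fixes G :: "((nat \<Rightarrow> complex) \<times> (nat \<Rightarrow> complex)) set"
  assumes graph_l2: "G \<subseteq> l2 \<times> l2"
    and add: "p \<in> G \<Longrightarrow> q \<in> G \<Longrightarrow> p + q \<in> G"
    and scale: "p \<in> G \<Longrightarrow> sc2 c p \<in> G"
    and symmetric: "G \<subseteq> gadjoint G"
    and dense: "dense_l2 (Domain G)"
begin

definition eigenspace :: "complex \<Rightarrow> (nat \<Rightarrow> complex) set" where
  "eigenspace c = {u. (u, cscale c u) \<in> gadjoint G}"

lemma nonempty: "G \<noteq> {}"
  using dense l2_zero unfolding dense_l2_def by (metis Domain_empty empty_iff zero_less_one)

lemma gclosure_le_adjoint: "gclosure G \<subseteq> gadjoint G"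
  using gclosure_mono[OF symmetric] gclosure_gadjoint[OF graph_l2] by simp

lemma bdform_closure_left: "p \<in> gclosure G \<Longrightarrow> q \<in> gadjoint G \<Longrightarrow> bdform p q = 0"
  using gadjoint_gclosure[OF graph_l2] bdform_commute[of q p]
  by (metis complex_cnj_zero gclosure_subset mem_gadjoint_iff minus_zero subsetD)

lemma bdform_closure_right: "p \<in> gclosure G \<Longrightarrow> q \<in> gadjoint G \<Longrightarrow> bdform q p = 0"
  using gadjoint_gclosure[OF graph_l2] by (metis mem_gadjoint_iff)

lemma self_adjoint_extension:
  assumes "G \<subseteq> T" "self_adjoint T"
  shows "T \<subseteq> l2 \<times> l2" "gadjoint T = T" "T \<subseteq> gadjoint G" "gclosure G \<subseteq> T"
    "p \<in> T \<Longrightarrow> q \<in> T \<Longrightarrow> p + q \<in> T" "p \<in> T \<Longrightarrow> sc2 c p \<in> T"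
proof -
  show T: "T \<subseteq> l2 \<times> l2" and T': "gadjoint T = T"
    using assms(2) by (simp_all add: self_adjoint_def is_operator_def)
  show "T \<subseteq> gadjoint G" using gadjoint_antimono[OF assms(1)] T' by simp
  show "gclosure G \<subseteq> T" using gclosure_mono[OF assms(1)] gclosure_gadjoint[OF T] T' by simp
  show "p \<in> T \<Longrightarrow> q \<in> T \<Longrightarrow> p + q \<in> T" using gadjoint_add[OF T] T' by simp
  show "p \<in> T \<Longrightarrow> sc2 c p \<in> T" using gadjoint_sc2[OF T] T' by simp
qed

lemma decomposition:
  assumes p: "p \<in> gadjoint G"
  obtains q u v where "q \<in> gclosure G" "u \<in> eigenspace \<i>" "v \<in> eigenspace (- \<i>)"
    "p = q + (u, cscale \<i> u) + (v, cscale (- \<i>) v)"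
proof -
  have pH: "p \<in> l2 \<times> l2" using p gadjoint_subset by blast
  obtain q where q: "q \<in> gclosure G" "rot (p - q) \<in> gadjoint G"
    using graph_decomposition[OF graph_l2 nonempty add scale pH] by blast
  obtain y z where pq: "p - q = (y, z)" by (cases "p - q")
  have yz: "(y, z) \<in> gadjoint G" "(z, - y) \<in> gadjoint G"
  proof -
    have "p - q \<in> gadjoint G"
      using p q(1) gclosure_le_adjoint by (intro gadjoint_diff graph_l2) auto
    then show "(y, z) \<in> gadjoint G" "(z, - y) \<in> gadjoint G" using q(2) by (simp_all add: pq rot_def)
  qed
  \<comment> \<open>With A* y = z and A* z = - y, these are the components of y for the eigenvalues
    \<open>\<i>\<close> and \<open>- \<i>\<close>.\<close>
  define u v where "u = cscale (1/2) (y + cscale (- \<i>) z)" and "v = cscale (1/2) (y + cscale \<i> z)"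
  have "sc2 (1/2) ((y, z) + sc2 (- \<i>) (z, - y)) \<in> gadjoint G"
    "sc2 (1/2) ((y, z) + sc2 \<i> (z, - y)) \<in> gadjoint G"
    by (intro gadjoint_sc2 gadjoint_add graph_l2 yz)+
  moreover have "sc2 (1/2) ((y, z) + sc2 (- \<i>) (z, - y)) = (u, cscale \<i> u)"
    "sc2 (1/2) ((y, z) + sc2 \<i> (z, - y)) = (v, cscale (- \<i>) v)"
    by (auto simp: sc2_def u_def v_def cscale_def fun_eq_iff algebra_simps)
  ultimately have uv: "u \<in> eigenspace \<i>" "v \<in> eigenspace (- \<i>)"
    by (auto simp: eigenspace_def)
  have "(u, cscale \<i> u) + (v, cscale (- \<i>) v) = (y, z)"
    by (auto simp: u_def v_def cscale_def fun_eq_iff algebra_simps)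
  moreover have "p = q + (p - q)" by simp
  ultimately have "p = q + (u, cscale \<i> u) + (v, cscale (- \<i>) v)"
    unfolding pq by (simp only: add.assoc)
  with q(1) uv show ?thesis by (rule that)
qed

text \<open>If \<open>r\<close> is the component of \<open>(u, c u)\<close> orthogonal to the graph \<open>T\<close>, then \<open>rot r\<close> lies in
  \<open>T\<close>, and \<open>r + c \<cdot> rot r\<close> is an eigenvector for \<open>- c\<close>.\<close>

lemma eigenspace_partner:
  assumes T: "G \<subseteq> T" "self_adjoint T" and c: "c * c = -1" and u: "u \<in> eigenspace c"
  obtains v where "v \<in> eigenspace (- c)" "(u + v, cscale c u - cscale c v) \<in> T"
proof -
  note T' = self_adjoint_extension[OF T]
  have uG: "(u, cscale c u) \<in> gadjoint G" using u by (simp add: eigenspace_def)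
  then have uH: "(u, cscale c u) \<in> l2 \<times> l2" using gadjoint_subset by blast
  have "T \<noteq> {}" using nonempty T(1) by blast
  obtain q where "q \<in> gclosure T" "rot ((u, cscale c u) - q) \<in> gadjoint T"
    using graph_decomposition[OF T'(1) \<open>T \<noteq> {}\<close> T'(5,6) uH] by blast
  then have q: "q \<in> T" "rot ((u, cscale c u) - q) \<in> T"
    using T'(1,2) gclosure_gadjoint[OF T'(1)] by simp_all
  define y z where "y = u - fst q" and "z = cscale c u - snd q"
  have r: "(y, z) = (u, cscale c u) - q" by (cases q) (simp add: y_def z_def)
  have zy: "(z, - y) \<in> T" using q(2) unfolding r[symmetric] by (simp add: rot_def)
  have "(y, z) \<in> gadjoint G"
    using gadjoint_diff[OF graph_l2 uG, of q] q(1) T'(3) r by auto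
  then have "(y, z) + sc2 c (z, - y) \<in> gadjoint G"
    using zy T'(3) by (intro gadjoint_add gadjoint_sc2 graph_l2) auto
  then have "sc2 (-1) ((y, z) + sc2 c (z, - y)) \<in> gadjoint G"
    by (intro gadjoint_sc2 graph_l2)
  moreover define v where "v = - y - cscale c z"
  have "z n = - (c * c) * z n" for n using c by simp
  then have "sc2 (-1) ((y, z) + sc2 c (z, - y)) = (v, cscale (- c) v)"
    by (auto simp: v_def sc2_def cscale_def fun_eq_iff algebra_simps)
  ultimately have v: "v \<in> eigenspace (- c)" by (simp add: eigenspace_def)
  \<comment> \<open>With r = (y, z) this element is (u, c u) - (r + c * rot r), and the bracket is
    the negative of (v, - c v).\<close>
  have "q + sc2 (- c) (z, - y) \<in> T"
    using q(1) zy T'(5,6) by blast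
  moreover have "q + sc2 (- c) (z, - y) = (u + v, cscale c u - cscale c v)"
  proof (rule prod_eqI)
    show "snd (q + sc2 (- c) (z, - y)) = snd (u + v, cscale c u - cscale c v)"
    proof
      fix n
      have "c * (c * z n) = - z n" using c by (metis mult.assoc mult_minus1)
      then show "snd (q + sc2 (- c) (z, - y)) n = snd (u + v, cscale c u - cscale c v) n"
        by (simp add: v_def sc2_def cscale_def algebra_simps) (simp add: z_def cscale_def algebra_simps)
    qed
  qed (auto simp: v_def y_def sc2_def cscale_def fun_eq_iff algebra_simps)
  ultimately show ?thesis using that v by simp
qed

end

text \<open>The coefficients form a total function of which only the values below \<open>m\<close>
  count. Equality of coefficients is therefore only ever claimed below \<open>m\<close>.\<close>

definition lincomb :: "nat \<Rightarrow> (nat \<Rightarrow> complex) \<Rightarrow> (nat \<Rightarrow> nat \<Rightarrow> complex) \<Rightarrow> nat \<Rightarrow> complex" where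
  "lincomb m a e = (\<lambda>n. \<Sum>i<m. a i * e i n)"

lemma lincomb_l2: "(\<And>i. i < m \<Longrightarrow> e i \<in> l2) \<Longrightarrow> lincomb m a e \<in> l2"
proof (induction m)
  case 0
  have "lincomb 0 a e = 0" by (auto simp: lincomb_def)
  then show ?case by (simp only: l2_zero linner_zero lessThan_0 sum.empty)
next
  case (Suc m)
  have "lincomb (Suc m) a e = lincomb m a e + cscale (a m) (e m)"
    by (auto simp: lincomb_def cscale_def)
  moreover have "lincomb m a e + cscale (a m) (e m) \<in> l2"
    using Suc by (intro l2_add l2_cscale) auto
  ultimately show ?case by (simp only:)
qed

lemma linner_lincomb_right:
  "(\<And>i. i < m \<Longrightarrow> e i \<in> l2) \<Longrightarrow> y \<in> l2 \<Longrightarrow> linner y (lincomb m a e) = (\<Sum>i<m. a i * linner y (e i))"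
proof (induction m)
  case 0
  have "lincomb 0 a e = 0" by (auto simp: lincomb_def)
  then show ?case by (simp only: l2_zero linner_zero lessThan_0 sum.empty)
next
  case (Suc m)
  have "lincomb (Suc m) a e = lincomb m a e + cscale (a m) (e m)"
    by (auto simp: lincomb_def cscale_def)
  moreover have "linner y (lincomb m a e + cscale (a m) (e m)) = (\<Sum>i<Suc m. a i * linner y (e i))"
    using Suc by (simp add: linner_simps lincomb_l2)
  ultimately show ?case by (simp only:)
qed

lemma lincomb_add: "lincomb m a e + lincomb m b e = lincomb m (\<lambda>i. a i + b i) e"
  by (auto simp: lincomb_def fun_eq_iff sum.distrib algebra_simps)

lemma cscale_lincomb: "cscale c (lincomb m a e) = lincomb m (\<lambda>i. c * a i) e"
  by (auto simp: lincomb_def cscale_def fun_eq_iff sum_distrib_left mult.assoc)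

lemma lincomb_cong: "(\<And>i. i < m \<Longrightarrow> a i = b i) \<Longrightarrow> lincomb m a e = lincomb m b e"
  by (auto simp: lincomb_def)

lemma linner_lincomb_orthonormal:
  assumes e: "\<And>i. i < m \<Longrightarrow> e i \<in> l2"
    and orth: "\<And>i j. i < m \<Longrightarrow> j < m \<Longrightarrow> linner (e i) (e j) = (if i = j then 1 else 0)"
  shows "linner (lincomb m a e) (lincomb m b e) = (\<Sum>i<m. cnj (a i) * b i)"
proof -
  have *: "linner (lincomb m a e) (e j) = cnj (a j)" if "j < m" for j
  proof -
    have "linner (e j) (lincomb m a e) = (\<Sum>i<m. a i * (if j = i then 1 else 0))"
      using e that orth by (subst linner_lincomb_right) auto
    also have "\<dots> = a j" using that by (simp add: if_distrib cong: if_cong)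
    finally show ?thesis
      using linner_commute[of "e j" "lincomb m a e"] e that by (simp add: lincomb_l2)
  qed
  show ?thesis
    using e by (subst linner_lincomb_right) (auto simp: lincomb_l2 * mult.commute intro!: sum.cong)
qed

section \<open>Extension theory for equal finite deficiency indices\<close>

locale deficiency_basis = symmetric_operator +
  fixes m :: nat and ep em :: "nat \<Rightarrow> nat \<Rightarrow> complex"
  assumes eigenspace_plus: "eigenspace \<i> = range (\<lambda>a. lincomb m a ep)"
    and eigenspace_minus: "eigenspace (- \<i>) = range (\<lambda>a. lincomb m a em)"
    and ep_l2: "i < m \<Longrightarrow> ep i \<in> l2" and em_l2: "i < m \<Longrightarrow> em i \<in> l2"
    and ep_orth: "i < m \<Longrightarrow> j < m \<Longrightarrow> linner (ep i) (ep j) = (if i = j then 1 else 0)"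
    and em_orth: "i < m \<Longrightarrow> j < m \<Longrightarrow> linner (em i) (em j) = (if i = j then 1 else 0)"
begin

text \<open>The pairs (a, b) are coordinates on the adjoint graph modulo
  \<open>gclosure G\<close>.\<close>

definition pt :: "(nat \<Rightarrow> complex) \<Rightarrow> (nat \<Rightarrow> complex) \<Rightarrow> (nat \<Rightarrow> complex) \<times> (nat \<Rightarrow> complex)" where
  "pt a b = (lincomb m a ep + lincomb m b em,
     cscale \<i> (lincomb m a ep) + cscale (- \<i>) (lincomb m b em))"

text \<open>The row vector \<open>a\<close> is sent to \<open>- a U\<close>; the sign is the convention of \<open>DU\<close>.\<close>

definition act :: "(nat \<Rightarrow> nat \<Rightarrow> complex) \<Rightarrow> (nat \<Rightarrow> complex) \<Rightarrow> nat \<Rightarrow> complex" where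
  "act U a = (\<lambda>j. - (\<Sum>i<m. a i * U i j))"

text \<open>The graph behind \<open>AU\<close>; the identification is
  \<open>AU_eq_ext\<close>.\<close>

definition ext :: "(nat \<Rightarrow> nat \<Rightarrow> complex) \<Rightarrow> ((nat \<Rightarrow> complex) \<times> (nat \<Rightarrow> complex)) set" where
  "ext U = {q + pt a (act U a) | q a. q \<in> gclosure G}"

lemma pt_cong: "(\<And>i. i < m \<Longrightarrow> a i = a' i) \<Longrightarrow> (\<And>i. i < m \<Longrightarrow> b i = b' i) \<Longrightarrow> pt a b = pt a' b'"
  unfolding pt_def using lincomb_cong[of m a a' ep] lincomb_cong[of m b b' em] by simp

lemma pt_add: "pt a b + pt a' b' = pt (\<lambda>i. a i + a' i) (\<lambda>i. b i + b' i)"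
  by (simp add: pt_def lincomb_add[symmetric] cscale_def fun_eq_iff algebra_simps)

lemma pt_sc2: "sc2 c (pt a b) = pt (\<lambda>i. c * a i) (\<lambda>i. c * b i)"
  by (simp add: pt_def sc2_def cscale_lincomb[symmetric]) (simp add: cscale_def fun_eq_iff algebra_simps)

lemma pt_diff: "pt a b - pt a' b' = pt (\<lambda>i. a i - a' i) (\<lambda>i. b i - b' i)"
  using pt_add[of a b "\<lambda>i. -1 * a' i" "\<lambda>i. -1 * b' i"] unfolding pt_sc2[symmetric] sc2_minus_one by simp

lemma pt_adjoint: "pt a b \<in> gadjoint G"
proof -
  have "lincomb m a ep \<in> eigenspace \<i>" "lincomb m b em \<in> eigenspace (- \<i>)"
    using eigenspace_plus eigenspace_minus by auto
  then show ?thesis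
    using gadjoint_add[OF graph_l2, of "(lincomb m a ep, cscale \<i> (lincomb m a ep))"
        "(lincomb m b em, cscale (- \<i>) (lincomb m b em))"]
    by (simp add: eigenspace_def pt_def)
qed

lemma pt_l2: "pt a b \<in> l2 \<times> l2"
  using pt_adjoint gadjoint_subset by blast

lemma bdform_pt:
  "bdform (pt a b) (pt a' b') = 2 * \<i> * ((\<Sum>i<m. cnj (a i) * a' i) - (\<Sum>i<m. cnj (b i) * b' i))"
proof -
  have *: "bdform (u + v, cscale \<i> u + cscale (- \<i>) v) (u' + v', cscale \<i> u' + cscale (- \<i>) v')
      = 2 * \<i> * (linner u u' - linner v v')"
    if "u \<in> l2" "v \<in> l2" "u' \<in> l2" "v' \<in> l2" for u v u' v'
    using that by (simp add: bdform_def linner_simps algebra_simps)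
  show ?thesis
    unfolding pt_def
    by (subst *) (simp_all add: lincomb_l2 ep_l2 em_l2 linner_lincomb_orthonormal ep_orth em_orth)
qed

lemma adjoint_decomposition:
  assumes "p \<in> gadjoint G" obtains q a b where "q \<in> gclosure G" "p = q + pt a b"
proof -
  obtain q u v where q: "q \<in> gclosure G" "u \<in> eigenspace \<i>" "v \<in> eigenspace (- \<i>)"
    "p = q + (u, cscale \<i> u) + (v, cscale (- \<i>) v)"
    using decomposition[OF assms] by blast
  then obtain a b where "u = lincomb m a ep" "v = lincomb m b em"
    using eigenspace_plus eigenspace_minus by auto
  then have "p = q + pt a b" using q(4) by (simp add: pt_def add.assoc)
  then show ?thesis using that q(1) by blast
qed

text \<open>The closure of \<open>G\<close> lies in the radical of the boundary form on the adjoint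
  graph, so only coordinates matter.\<close>

lemma bdform_decomposed:
  assumes "q \<in> gclosure G" "q' \<in> gclosure G"
  shows "bdform (q + pt a b) (q' + pt a' b') = bdform (pt a b) (pt a' b')"
proof -
  have H: "q \<in> l2 \<times> l2" "q' \<in> l2 \<times> l2" and A: "q' \<in> gadjoint G"
    using assms gclosure_subset gclosure_le_adjoint by blast+
  have "bdform (q + pt a b) (q' + pt a' b') =
      bdform q q' + bdform q (pt a' b') + bdform (pt a b) q' + bdform (pt a b) (pt a' b')"
    using H pt_l2 by (simp only: bdform_add_left bdform_add_right gr.add_mem) (simp add: add_ac)
  then show ?thesis
    using bdform_closure_left[OF assms(1) A] bdform_closure_left[OF assms(1) pt_adjoint]
      bdform_closure_right[OF assms(2) pt_adjoint] by simp
qed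

text \<open>Nondegeneracy of the boundary form on the defect part; the test vectors are the
  coordinate unit vectors.\<close>

lemma pt_eq_zero:
  assumes "\<And>a' b'. bdform (pt a b) (pt a' b') = 0" "i < m" shows "a i = 0" "b i = 0"
proof -
  have *: "(\<Sum>i<m. cnj (a i) * a' i) = (\<Sum>i<m. cnj (b i) * b' i)" for a' b'
    using assms(1)[of a' b'] by (simp add: bdform_pt)
  have "cnj (a i) = 0"
    using *[of "\<lambda>j. if j = i then 1 else 0" "\<lambda>_. 0"] assms(2)
    by (simp add: if_distrib cong: if_cong)
  then show "a i = 0" by simp
  have "cnj (b i) = 0"
    using *[of "\<lambda>_. 0" "\<lambda>j. if j = i then 1 else 0"] assms(2)
    by (simp add: if_distrib cong: if_cong)
  then show "b i = 0" by simp
qed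

lemma pt_zero: "pt (\<lambda>_. 0) (\<lambda>_. 0) = 0"
  by (simp add: pt_def lincomb_def cscale_def zero_prod_def zero_fun_def fun_eq_iff)

text \<open>A point of the double adjoint lies in the adjoint by symmetry of \<open>G\<close>, and
  its defect part annihilates every defect vector, so nondegeneracy kills it. As an adjoint, the
  closure inherits its linear structure without any argument on sequences.\<close>

lemma gclosure_eq_double_adjoint: "gclosure G = gadjoint (gadjoint G)"
proof
  show "gclosure G \<subseteq> gadjoint (gadjoint G)"
  proof
    fix p assume p: "p \<in> gclosure G"
    then have "p \<in> l2 \<times> l2" using gclosure_subset by (rule rev_subsetD)
    then show "p \<in> gadjoint (gadjoint G)"
      using bdform_closure_left[OF p] by (simp only: mem_gadjoint_iff[of p]) blast
  qed
  show "gadjoint (gadjoint G) \<subseteq> gclosure G"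
  proof
    fix p assume p: "p \<in> gadjoint (gadjoint G)"
    then have "p \<in> gadjoint G" using gadjoint_antimono[OF symmetric] by blast
    then obtain q a b where q: "q \<in> gclosure G" "p = q + pt a b"
      using adjoint_decomposition by blast
    have "bdform (pt a b) (pt a' b') = 0" for a' b'
    proof -
      have "0 \<in> gclosure G"
        using subset_gclosure[OF graph_l2] scale[of _ 0] nonempty
        by (auto simp: sc2_def cscale_def zero_prod_def zero_fun_def)
      then have "bdform (pt a b) (pt a' b') = bdform p (0 + pt a' b')"
        unfolding q(2) by (rule bdform_decomposed[OF q(1), symmetric])
      then show ?thesis using p pt_adjoint[of a' b'] by (simp add: mem_gadjoint_iff)
    qed
    from pt_eq_zero[OF this] have "pt a b = pt (\<lambda>_. 0) (\<lambda>_. 0)" by (rule pt_cong)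
    then show "p \<in> gclosure G" using q by (simp add: pt_zero)
  qed
qed

lemma zero_mem_gclosure: "0 \<in> gclosure G"
  unfolding gclosure_eq_double_adjoint
  by (simp add: mem_gadjoint_iff bdform_def zero_prod_def)

lemma gclosure_diff: "p \<in> gclosure G \<Longrightarrow> q \<in> gclosure G \<Longrightarrow> p - q \<in> gclosure G"
  unfolding gclosure_eq_double_adjoint by (rule gadjoint_diff[OF gadjoint_subset])

lemma pt_unique:
  assumes "q \<in> gclosure G" "q' \<in> gclosure G" "q + pt a b = q' + pt a' b'" "i < m"
  shows "a i = a' i" "b i = b' i"
proof -
  have "q + pt a b - (q + pt a' b') = q' + pt a' b' - (q + pt a' b')" using assms(3) by simp
  then have "pt a b - pt a' b' = q' - q" by (simp only: add_diff_cancel_left add_diff_cancel_right)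
  then have "pt (\<lambda>i. a i - a' i) (\<lambda>i. b i - b' i) \<in> gclosure G"
    using gclosure_diff assms(1,2) by (simp add: pt_diff)
  then have "bdform (pt (\<lambda>i. a i - a' i) (\<lambda>i. b i - b' i)) (pt c d) = 0" for c d
    by (intro bdform_closure_left pt_adjoint)
  from pt_eq_zero[OF this assms(4)] show "a i = a' i" "b i = b' i" by simp_all
qed

section \<open>The extension defined by a unitary matrix, and its converse\<close>

definition unit :: "nat \<Rightarrow> nat \<Rightarrow> complex" where
  "unit i = (\<lambda>j. if j = i then 1 else 0)"

lemma sum_unit [simp]:
  "i < m \<Longrightarrow> (\<Sum>j<m. unit i j * x j) = x i" "i < m \<Longrightarrow> (\<Sum>j<m. x j * unit i j) = x i"
  "i < m \<Longrightarrow> (\<Sum>j<m. cnj (unit i j) * x j) = x i"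
  by (simp_all add: unit_def if_distrib[of cnj] if_distrib[of "\<lambda>x. x * _"] if_distrib[of "\<lambda>x. _ * x"] cong: if_cong)

lemma act_unit: "i < m \<Longrightarrow> act U (unit i) j = - U i j"
  by (simp add: act_def)

text \<open>Row vectors are multiplied from the right, so it is orthonormality of the rows of
  \<open>U\<close> that counts here; \<open>act_surj\<close> draws on the columns.\<close>

lemma act_isometry:
  assumes "U \<in> unitary_mats m"
  shows "(\<Sum>j<m. cnj (act U a j) * act U b j) = (\<Sum>i<m. cnj (a i) * b i)"
proof -
  have row: "(\<Sum>j<m. U k j * cnj (U i j)) = (if k = i then 1 else 0)" if "k < m" "i < m" for i k
    using assms that by (simp add: unitary_mats_def)
  have "cnj (act U a j) * act U b j = (\<Sum>i<m. \<Sum>k<m. cnj (a i) * b k * (U k j * cnj (U i j)))" for j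
  proof -
    have "cnj (act U a j) * act U b j = (\<Sum>i<m. cnj (a i) * cnj (U i j)) * (\<Sum>k<m. b k * U k j)"
      by (simp add: act_def)
    then show ?thesis unfolding sum_product by (simp add: mult_ac)
  qed
  then have "(\<Sum>j<m. cnj (act U a j) * act U b j) = (\<Sum>j<m. \<Sum>i<m. \<Sum>k<m. cnj (a i) * b k * (U k j * cnj (U i j)))"
    by simp
  also have "\<dots> = (\<Sum>i<m. \<Sum>k<m. cnj (a i) * b k * (\<Sum>j<m. U k j * cnj (U i j)))"
  proof -
    have "(\<Sum>j<m. \<Sum>i<m. \<Sum>k<m. cnj (a i) * b k * (U k j * cnj (U i j)))
        = (\<Sum>i<m. \<Sum>j<m. \<Sum>k<m. cnj (a i) * b k * (U k j * cnj (U i j)))" by (rule sum.swap)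
    also have "\<dots> = (\<Sum>i<m. \<Sum>k<m. \<Sum>j<m. cnj (a i) * b k * (U k j * cnj (U i j)))"
      by (intro sum.cong refl sum.swap)
    finally show ?thesis by (simp only: sum_distrib_left)
  qed
  also have "\<dots> = (\<Sum>i<m. \<Sum>k<m. cnj (a i) * b k * (if k = i then 1 else 0))"
    by (intro sum.cong refl) (simp add: row)
  finally show ?thesis by (simp add: if_distrib cong: if_cong)
qed

lemma act_surj:
  assumes "U \<in> unitary_mats m" obtains a where "\<And>j. j < m \<Longrightarrow> act U a j = c j"
proof (rule that)
  fix j assume j: "j < m"
  have col: "(\<Sum>i<m. cnj (U i k) * U i j) = (if k = j then 1 else 0)" if "k < m" for k
    using assms that j by (simp add: unitary_mats_def)
  \<comment> \<open>The preimage of c is - c U*, the sign cancelling the one in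
    \<open>act\<close>.\<close>
  have "act U (\<lambda>i. - (\<Sum>k<m. c k * cnj (U i k))) j = (\<Sum>i<m. \<Sum>k<m. c k * (cnj (U i k) * U i j))"
    by (simp add: act_def sum_distrib_right sum_negf mult.assoc)
  also have "\<dots> = (\<Sum>k<m. c k * (\<Sum>i<m. cnj (U i k) * U i j))"
    by (subst sum.swap) (simp add: sum_distrib_left)
  also have "\<dots> = (\<Sum>k<m. c k * (if k = j then 1 else 0))"
    by (intro sum.cong refl) (simp add: col)
  also have "\<dots> = c j" using j by (simp add: if_distrib cong: if_cong)
  finally show "act U (\<lambda>i. - (\<Sum>k<m. c k * cnj (U i k))) j = c j" .
qed

lemma ext_memI: "q \<in> gclosure G \<Longrightarrow> q + pt a (act U a) \<in> ext U"
  unfolding ext_def by blast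

lemma pt_mem_ext: "pt a (act U a) \<in> ext U"
  unfolding ext_def by (intro CollectI exI[of _ 0] exI[of _ a] conjI zero_mem_gclosure) simp

lemma gclosure_subset_ext: "gclosure G \<subseteq> ext U"
proof
  fix q assume "q \<in> gclosure G"
  moreover have "act U (\<lambda>_. 0) = (\<lambda>_. 0)" by (simp add: act_def)
  ultimately show "q \<in> ext U"
    unfolding ext_def using pt_zero by (intro CollectI exI[of _ q] exI[of _ "\<lambda>_. 0"]) simp
qed

lemma subset_ext: "G \<subseteq> ext U"
  using gclosure_subset_ext subset_gclosure[OF graph_l2] by blast

lemma ext_subset: "ext U \<subseteq> gadjoint G"
  unfolding ext_def using gclosure_le_adjoint pt_adjoint gadjoint_add[OF graph_l2] by blast

lemma self_adjoint_ext:
  assumes U: "U \<in> unitary_mats m" shows "self_adjoint (ext U)"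
  unfolding self_adjoint_def
proof (intro conjI)
  show "is_operator (ext U)"
    by (rule is_operator_subset[OF is_operator_gadjoint[OF graph_l2 dense] ext_subset])
  have "Domain (ext U) \<subseteq> Domain (l2 \<times> l2)"
    by (intro Domain_mono order_trans[OF ext_subset gadjoint_subset])
  then show "dense_l2 (Domain (ext U))"
    by (intro dense_l2_superset[OF dense] Domain_mono subset_ext) auto
  show "gadjoint (ext U) = ext U"
  proof
    show "ext U \<subseteq> gadjoint (ext U)"
    proof
      fix p assume p: "p \<in> ext U"
      have "bdform p p' = 0" if "p' \<in> ext U" for p'
        using p that unfolding ext_def by (auto simp: bdform_decomposed bdform_pt act_isometry[OF U])
      then show "p \<in> gadjoint (ext U)"
        using p ext_subset gadjoint_subset[of G] unfolding mem_gadjoint_iff by blast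
    qed
    show "gadjoint (ext U) \<subseteq> ext U"
    proof
      fix p assume p: "p \<in> gadjoint (ext U)"
      then have "p \<in> gadjoint G" using gadjoint_antimono[OF subset_ext] by blast
      then obtain q a b where q: "q \<in> gclosure G" "p = q + pt a b"
        using adjoint_decomposition by blast
      \<comment> \<open>This choice turns the annihilation condition into the vanishing of the
        squared norm of \<open>b - act U a\<close>, which is the distance of (a, b) from the graph
        of \<open>act U\<close>.\<close>
      obtain a' where a': "\<And>j. j < m \<Longrightarrow> act U a' j = b j - act U a j"
        using act_surj[OF U, of "\<lambda>j. b j - act U a j"] by blast
      have "bdform p (0 + pt a' (act U a')) = 0"
        using p pt_mem_ext[of a' U] by (simp add: mem_gadjoint_iff)
      then have "bdform (pt a b) (pt a' (act U a')) = 0"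
        unfolding q(2) using bdform_decomposed[OF q(1) zero_mem_gclosure] by simp
      then have "(\<Sum>i<m. cnj (a i) * a' i) = (\<Sum>i<m. cnj (b i) * act U a' i)"
        by (simp add: bdform_pt)
      then have "(\<Sum>i<m. cnj (b i) * act U a' i) - (\<Sum>i<m. cnj (act U a i) * act U a' i) = 0"
        by (simp add: act_isometry[OF U])
      then have "(\<Sum>i<m. cnj (b i - act U a i) * act U a' i) = 0"
        by (simp add: sum_subtractf[symmetric] algebra_simps)
      then have "(\<Sum>i<m. cnj (b i - act U a i) * (b i - act U a i)) = 0"
        by (simp add: a' cong: sum.cong_simp)
      then have "complex_of_real (\<Sum>i<m. (cmod (b i - act U a i))\<^sup>2) = 0"
        by (simp add: complex_norm_square mult.commute del: of_real_power)
      then have "(\<Sum>i<m. (cmod (b i - act U a i))\<^sup>2) = 0"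
        by (simp only: of_real_eq_0_iff)
      then have "b i = act U a i" if "i < m" for i
        using that by (subst (asm) sum_nonneg_eq_0_iff) auto
      then have "pt a b = pt a (act U a)" by (intro pt_cong) auto
      then show "p \<in> ext U" using ext_memI[OF q(1)] q(2) by simp
    qed
  qed
qed

lemma ext_inj:
  assumes "U \<in> unitary_mats m" "U' \<in> unitary_mats m" "ext U = ext U'" shows "U = U'"
proof (intro ext)
  fix i j
  show "U i j = U' i j"
  proof (cases "i < m \<and> j < m")
    case True
    have "pt (unit i) (act U (unit i)) \<in> ext U'" using pt_mem_ext assms(3) by blast
    then obtain q a where q: "q \<in> gclosure G" "0 + pt (unit i) (act U (unit i)) = q + pt a (act U' a)"
      unfolding ext_def by auto
    have "unit i n = a n" if "n < m" for n
      using pt_unique(1)[OF zero_mem_gclosure q that] .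
    then have "act U' a j = act U' (unit i) j" by (simp add: act_def)
    moreover have "act U (unit i) j = act U' a j"
      using pt_unique(2)[OF zero_mem_gclosure q] True by blast
    ultimately show ?thesis using True by (simp add: act_unit)
  next
    case False
    then show ?thesis using assms(1,2) by (auto simp: unitary_mats_def)
  qed
qed

text \<open>Every basis vector of either deficiency space has a partner in the other. Isotropy of
  \<open>T\<close> makes the rows of the partner matrix \<open>B\<close> orthonormal, does the same
  for the matrix \<open>A\<close> built from the other side, and shows that \<open>A\<close> is the
  conjugate transpose of \<open>B\<close>. Thus both unitarity conditions appear without inverting a
  matrix.\<close>

lemma self_adjoint_eq_ext:
  assumes T: "G \<subseteq> T" "self_adjoint T" obtains U where "U \<in> unitary_mats m" "T = ext U"
proof -
  note T' = self_adjoint_extension[OF T]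
  have bd: "bdform p q = 0" if "p \<in> T" "q \<in> T" for p q
    using that T'(2) mem_gadjoint_iff by blast
  have "\<exists>b. pt (unit i) b \<in> T" if "i < m" for i
  proof -
    have "lincomb m (unit i) ep \<in> eigenspace \<i>" using eigenspace_plus by blast
    then obtain v where v: "v \<in> eigenspace (- \<i>)"
      "(lincomb m (unit i) ep + v, cscale \<i> (lincomb m (unit i) ep) - cscale \<i> v) \<in> T"
      by (rule eigenspace_partner[OF T, rotated]) auto
    then obtain b where "v = lincomb m b em" using eigenspace_minus by blast
    then have "pt (unit i) b \<in> T"
      using v(2) by (simp add: pt_def cscale_def fun_diff_def plus_fun_def)
    then show ?thesis by blast
  qed
  then obtain B where B: "\<And>i. i < m \<Longrightarrow> pt (unit i) (B i) \<in> T" by metis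
  have "\<exists>a. pt a (unit i) \<in> T" if "i < m" for i
  proof -
    have "lincomb m (unit i) em \<in> eigenspace (- \<i>)" using eigenspace_minus by blast
    then obtain v where v: "v \<in> eigenspace (- (- \<i>))"
      "(lincomb m (unit i) em + v, cscale (- \<i>) (lincomb m (unit i) em) - cscale (- \<i>) v) \<in> T"
      by (rule eigenspace_partner[OF T, rotated]) auto
    then obtain a where "v = lincomb m a ep" using eigenspace_plus by auto
    then have "pt a (unit i) \<in> T"
      using v(2) by (simp add: pt_def cscale_def fun_diff_def plus_fun_def add.commute)
    then show ?thesis by blast
  qed
  then obtain A where A: "\<And>i. i < m \<Longrightarrow> pt (A i) (unit i) \<in> T" by metis
  \<comment> \<open>The sign undoes the one in \<open>act\<close>, so that
    \<open>act U (unit i)\<close> is \<open>B i\<close> below \<open>m\<close>; the zeros outside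
    are the convention of \<open>unitary_mats\<close>.\<close>
  define U where "U = (\<lambda>i j. if i < m \<and> j < m then - B i j else 0)"
  have BB: "(\<Sum>j<m. cnj (B i j) * B k j) = (if i = k then 1 else 0)" if "i < m" "k < m" for i k
    using bd[OF B B, of i k] that by (simp add: bdform_pt) (auto simp: unit_def)
  have AB: "A j i = cnj (B i j)" if "i < m" "j < m" for i j
    using bd[OF B A, of i j] that by (simp add: bdform_pt)
  have AA: "(\<Sum>i<m. cnj (A j i) * A k i) = (if j = k then 1 else 0)" if "j < m" "k < m" for j k
    using bd[OF A A, of j k] that by (simp add: bdform_pt) (auto simp: unit_def)
  have U: "U \<in> unitary_mats m"
    unfolding unitary_mats_def
  proof (intro CollectI conjI allI impI)
    fix i j assume ij: "i < m" "j < m"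
    have "(\<Sum>n<m. cnj (U n i) * U n j) = (\<Sum>n<m. cnj (A j n) * A i n)"
      using ij by (intro sum.cong refl) (simp add: U_def AB mult.commute)
    then show "(\<Sum>n<m. cnj (U n i) * U n j) = (if i = j then 1 else 0)"
      using AA[of j i] ij by auto
    have "(\<Sum>n<m. U i n * cnj (U j n)) = (\<Sum>n<m. cnj (B j n) * B i n)"
      using ij by (intro sum.cong refl) (simp add: U_def mult.commute)
    then show "(\<Sum>n<m. U i n * cnj (U j n)) = (if i = j then 1 else 0)"
      using BB[of j i] ij by auto
  qed (auto simp: U_def)
  have "ext U \<subseteq> T"
  proof
    fix p assume "p \<in> ext U"
    then obtain q a where p: "q \<in> gclosure G" "p = q + pt a (act U a)" by (auto simp: ext_def)
    have "bdform p t = 0" if "t \<in> T" for t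
    proof -
      obtain q' a' b' where t: "q' \<in> gclosure G" "t = q' + pt a' b'"
        using adjoint_decomposition T'(3) \<open>t \<in> T\<close> by blast
      \<comment> \<open>Orthogonality of \<open>t\<close> to the point with coordinates (unit i, B
        i) expresses the plus coordinates of \<open>t\<close> through its minus coordinates.\<close>
      have a': "a' i = (\<Sum>j<m. cnj (B i j) * b' j)" if "i < m" for i
      proof -
        have "bdform (0 + pt (unit i) (B i)) t = 0" using bd[OF B \<open>t \<in> T\<close>] that by simp
        then show ?thesis
          unfolding t(2) bdform_decomposed[OF zero_mem_gclosure t(1)] using that by (simp add: bdform_pt)
      qed
      have "(\<Sum>j<m. cnj (act U a j) * b' j) = (\<Sum>j<m. \<Sum>i<m. cnj (a i) * (cnj (B i j) * b' j))"
        by (simp add: act_def U_def sum_distrib_right sum_negf mult.assoc)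
      also have "\<dots> = (\<Sum>i<m. cnj (a i) * a' i)"
        by (subst sum.swap) (simp add: a' sum_distrib_left)
      finally show ?thesis
        unfolding p t bdform_decomposed[OF p(1) t(1)] by (simp add: bdform_pt)
    qed
    moreover have "p \<in> l2 \<times> l2"
      using \<open>p \<in> ext U\<close> ext_subset gadjoint_subset[of G] by blast
    ultimately have "p \<in> gadjoint T" by (simp add: mem_gadjoint_iff)
    then show "p \<in> T" using T'(2) by simp
  qed
  \<comment> \<open>Taking adjoints reverses the inclusion, and both sides are self-adjoint.\<close>
  moreover from this have "T \<subseteq> ext U"
    using gadjoint_antimono[of "ext U" T] T'(2) self_adjoint_ext[OF U] by (simp add: self_adjoint_def)
  ultimately show ?thesis using that U by blast
qed

text \<open>The set \<open>DU\<close> in orthonormal bases, where the quotients of norms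
  disappear.\<close>

definition defect_domain :: "(nat \<Rightarrow> nat \<Rightarrow> complex) \<Rightarrow> (nat \<Rightarrow> complex) set" where
  "defect_domain U = {lincomb m a ep + lincomb m (act U a) em | a. True}"

text \<open>\<open>AU\<close> prescribes a domain, \<open>ext\<close> a graph. They agree because
  the adjoint of a densely defined operator is single-valued: within it the first component
  determines the second.\<close>

lemma AU_eq_ext: "AU G (defect_domain U) = ext U"
proof (intro set_eqI iffI)
  fix p assume p: "p \<in> AU G (defect_domain U)"
  then obtain \<psi> \<psi>' a where *: "p \<in> gadjoint G" "(\<psi>, \<psi>') \<in> gclosure G"
    "fst p = \<psi> + fst (pt a (act U a))"
    unfolding AU_def defect_domain_def pt_def by auto
  have "(\<psi>, \<psi>') + pt a (act U a) \<in> ext U"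
    using *(2) by (rule ext_memI)
  moreover have "fst ((\<psi>, \<psi>') + pt a (act U a)) = fst p" using *(3) by simp
  ultimately have "p = (\<psi>, \<psi>') + pt a (act U a)"
    using *(1) ext_subset is_operator_gadjoint[OF graph_l2 dense] unfolding is_operator_def
    by (metis prod.collapse subsetD)
  then show "p \<in> ext U" using ext_memI[OF *(2)] by simp
next
  fix p assume p: "p \<in> ext U"
  then obtain q a where q: "q \<in> gclosure G" "p = q + pt a (act U a)" by (auto simp: ext_def)
  have "fst q \<in> Domain (gclosure G)" using q(1) by (metis Domain.DomainI prod.collapse)
  moreover have "fst (pt a (act U a)) \<in> defect_domain U" by (auto simp: defect_domain_def pt_def)
  ultimately show "p \<in> AU G (defect_domain U)"
    using p q(2) ext_subset unfolding AU_def by (cases p) (fastforce simp: plus_prod_def)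
qed

theorem bij_betw_self_adjoint_extensions:
  "bij_betw (\<lambda>U. AU G (defect_domain U)) (unitary_mats m) {T. G \<subseteq> T \<and> self_adjoint T}"
  unfolding AU_eq_ext bij_betw_def
proof
  show "inj_on ext (unitary_mats m)" using ext_inj by (auto intro!: inj_onI)
  show "ext ` unitary_mats m = {T. G \<subseteq> T \<and> self_adjoint T}"
  proof (intro set_eqI iffI)
    fix T assume "T \<in> {T. G \<subseteq> T \<and> self_adjoint T}"
    then have "G \<subseteq> T" "self_adjoint T" by auto
    then show "T \<in> ext ` unitary_mats m" by (rule self_adjoint_eq_ext) blast
  qed (use subset_ext self_adjoint_ext in auto)
qed

text \<open>To approximate a point of the extension keep its defect vector fixed and approximate
  only its closure part from \<open>G\<close>.\<close>

theorem core_extension: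
  assumes U: "U \<in> unitary_mats m"
  shows "is_core {\<psi> + \<phi> | \<psi> \<phi>. \<psi> \<in> Domain G \<and> \<phi> \<in> defect_domain U} (AU G (defect_domain U))"
proof -
  define D where "D = {\<psi> + \<phi> | \<psi> \<phi>. \<psi> \<in> Domain G \<and> \<phi> \<in> defect_domain U}"
  let ?S = "{(x, y) \<in> ext U. x \<in> D}"
  have mem: "v + pt a (act U a) \<in> ?S" if "v \<in> G" for v a
  proof -
    have "v + pt a (act U a) \<in> ext U"
      using that subset_gclosure[OF graph_l2] unfolding ext_def by blast
    moreover have "fst (v + pt a (act U a)) \<in> D"
    proof -
      have "fst v \<in> Domain G" using that by (metis Domain.DomainI prod.collapse)
      moreover have "lincomb m a ep + lincomb m (act U a) em \<in> defect_domain U"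
        unfolding defect_domain_def by blast
      ultimately show ?thesis unfolding D_def pt_def by auto
    qed
    ultimately show ?thesis by (auto simp: case_prod_unfold)
  qed
  have "D \<subseteq> Domain (ext U)"
  proof
    fix x assume "x \<in> D"
    then obtain v a where v: "v \<in> G" "x = fst v + (lincomb m a ep + lincomb m (act U a) em)"
      unfolding D_def defect_domain_def by auto
    have "(x, snd (v + pt a (act U a))) \<in> ext U"
      using mem[OF v(1), of a] v(2) by (simp add: pt_def plus_prod_def)
    then show "x \<in> Domain (ext U)" by (rule Domain.DomainI)
  qed
  moreover have "gclosure ?S = ext U"
  proof
    have "gadjoint (ext U) = ext U" using self_adjoint_ext[OF U] by (simp add: self_adjoint_def)
    then have "gclosure (ext U) = ext U"
      using gclosure_gadjoint[of "ext U"] ext_subset gadjoint_subset[of G] by (metis order_trans)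
    then show "gclosure ?S \<subseteq> ext U" using gclosure_mono[of ?S "ext U"] by auto
    show "ext U \<subseteq> gclosure ?S"
    proof
      fix p assume "p \<in> ext U"
      then obtain q a where q: "q \<in> gclosure G" "p = q + pt a (act U a)" by (auto simp: ext_def)
      have "p \<in> gclosure ((\<lambda>v. v + pt a (act U a)) ` G)"
        unfolding q(2) by (rule gclosure_translate[OF pt_l2 q(1)])
      moreover have "(\<lambda>v. v + pt a (act U a)) ` G \<subseteq> ?S" by (rule image_subsetI) (rule mem)
      ultimately show "p \<in> gclosure ?S" using gclosure_mono by blast
    qed
  qed
  ultimately show ?thesis
    unfolding is_core_def AU_eq_ext D_def by simp
qed

theorem not_ess_self_adjoint:
  assumes "m > 0" shows "\<not> ess_self_adjoint G"
proof
  assume "ess_self_adjoint G"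
  then have "gadjoint G = gclosure G"
    using gadjoint_gclosure[OF graph_l2] by (simp add: ess_self_adjoint_def self_adjoint_def)
  \<comment> \<open>If the adjoint were the closure, this point would have coordinates (unit 0, 0)
    and also (0, 0).\<close>
  then have "0 + pt (unit 0) (\<lambda>_. 0) = pt (unit 0) (\<lambda>_. 0) + pt (\<lambda>_. 0) (\<lambda>_. 0)" "pt (unit 0) (\<lambda>_. 0) \<in> gclosure G"
    using pt_adjoint by (auto simp: pt_zero)
  from pt_unique(1)[OF zero_mem_gclosure this(2,1) assms] show False
    by (simp add: unit_def)
qed

end

section \<open>Square-summability of the recurrence solutions\<close>

text \<open>A discrete Gronwall inequality, from 1 + t \<le> exp t.\<close>

lemma bounded_of_growth:
  fixes x e :: "nat \<Rightarrow> real"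
  assumes x: "\<And>n. 0 \<le> x n" and e: "\<And>n. 0 \<le> e n" "summable e"
    and step: "\<And>n. x (Suc n) \<le> x n * (1 + e n)"
  shows "x n \<le> x 0 * exp (suminf e)"
proof -
  have "x n \<le> x 0 * exp (\<Sum>k<n. e k)"
  proof (induction n)
    case (Suc n)
    have "x (Suc n) \<le> x n * (1 + e n)" by (rule step)
    also have "\<dots> \<le> x n * exp (e n)"
      by (intro mult_left_mono exp_ge_add_one_self x)
    also have "\<dots> \<le> x 0 * exp (\<Sum>k<n. e k) * exp (e n)"
      by (intro mult_right_mono Suc.IH) simp
    finally show ?case by (simp add: exp_add mult.assoc)
  qed simp
  also have "\<dots> \<le> x 0 * exp (suminf e)"
    using sum_le_suminf[OF e(2), of "{..<n}"] e(1) x by (intro mult_left_mono) auto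
  finally show ?thesis .
qed

text \<open>\<open>B\<close> is the new weight, \<open>\<rho>' * B\<close> the old one and
  \<open>w\<close> the next term of the recurrence. The right side lists exactly the energy errors:
  the changes of the coefficients, and the two terms caused by \<open>\<i> / B\<close>.\<close>

lemma energy_step:
  fixes u v :: complex and B \<rho> \<rho>' q q' :: real
  assumes B: "B > 0"
  defines "w \<equiv> (\<i> / complex_of_real B - complex_of_real q') * v - complex_of_real \<rho>' * u"
  shows "B * (\<rho>' * (cmod v)\<^sup>2 + q' * Re (v * cnj w) + (cmod w)\<^sup>2)
      - \<rho>' * B * (\<rho> * (cmod u)\<^sup>2 + q * Re (u * cnj v) + (cmod v)\<^sup>2)
    = \<rho>' * B * ((\<rho>' - \<rho>) * (cmod u)\<^sup>2 + (q' - q) * Re (u * cnj v))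
      + (cmod v)\<^sup>2 / B + 2 * \<rho>' * Im (v * cnj u)"
proof -
  \<comment> \<open>Replacing 1 / B by a variable with \<open>B * t = 1\<close> makes the identity
    polynomial.\<close>
  define t where "t = 1 / B"
  have Bt: "B * t = 1" using B by (simp add: t_def)
  have "\<i> / complex_of_real B = \<i> * complex_of_real t" by (simp add: t_def)
  then have w: "Re w = - t * Im v - q' * Re v - \<rho>' * Re u" "Im w = t * Re v - q' * Im v - \<rho>' * Im u"
    unfolding w_def by (simp_all add: algebra_simps)
  have div: "(cmod v)\<^sup>2 / B = t * (cmod v)\<^sup>2" by (simp add: t_def)
  show ?thesis
    unfolding div unfolding cmod_power2 using Bt
    by (simp add: w power2_eq_square) algebra
qed

lemma abs_Re_mult_cnj_le: "2 * \<bar>Re (u * cnj v)\<bar> \<le> (cmod u)\<^sup>2 + (cmod v)\<^sup>2"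
proof -
  have "\<bar>Re (u * cnj v)\<bar> \<le> cmod u * cmod v"
    using abs_Re_le_cmod[of "u * cnj v"] by (simp only: norm_mult complex_mod_cnj)
  then have "2 * \<bar>Re (u * cnj v)\<bar> \<le> 2 * cmod u * cmod v" by simp
  also have "\<dots> \<le> (cmod u)\<^sup>2 + (cmod v)\<^sup>2" by (rule sum_squares_bound)
  finally show ?thesis .
qed

lemma abs_Im_mult_cnj_le: "2 * \<bar>Im (u * cnj v)\<bar> \<le> (cmod u)\<^sup>2 + (cmod v)\<^sup>2"
proof -
  have "\<bar>Im (u * cnj v)\<bar> \<le> cmod u * cmod v"
    using abs_Im_le_cmod[of "u * cnj v"] by (simp only: norm_mult complex_mod_cnj)
  then have "2 * \<bar>Im (u * cnj v)\<bar> \<le> 2 * cmod u * cmod v" by simp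
  also have "\<dots> \<le> (cmod u)\<^sup>2 + (cmod v)\<^sup>2" by (rule sum_squares_bound)
  finally show ?thesis .
qed

text \<open>The energy
  \<open>b r * (\<rho> r * |u r|^2 + q r * Re (u r * cnj (u (r + 1))) + |u (r + 1)|^2)\<close> would be conserved if \<open>\<rho>\<close>
  and \<open>q\<close> were constant and the spectral parameter were \<open>0\<close>. It dominates \<open>b r * |u r|^2\<close> because
  \<open>|q r| < 2\<close> in the limit, and its relative variation is summable.\<close>

lemma recurrence_square_summable:
  fixes b \<rho> q :: "nat \<Rightarrow> real" and u :: "nat \<Rightarrow> complex"
  assumes b_pos: "\<And>r. b r > 0" and b_sum: "summable (\<lambda>r. 1 / b r)"
    and \<rho>: "\<And>r. b r = \<rho> (Suc r) * b (Suc r)" "\<rho> \<longlonglongrightarrow> 1" "summable (\<lambda>r. \<bar>\<rho> (Suc r) - \<rho> r\<bar>)"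
    and q: "q \<longlonglongrightarrow> \<kappa>" "\<bar>\<kappa>\<bar> < 2" "summable (\<lambda>r. \<bar>q (Suc r) - q r\<bar>)"
    and rec: "\<And>r. u (Suc (Suc r)) = (\<i> / complex_of_real (b (Suc r)) - complex_of_real (q (Suc r))) * u (Suc r)
      - complex_of_real (\<rho> (Suc r)) * u r"
  shows "summable (\<lambda>r. (cmod (u r))\<^sup>2)"
proof -
  define H where "H r = \<rho> r * (cmod (u r))\<^sup>2 + q r * Re (u r * cnj (u (Suc r))) + (cmod (u (Suc r)))\<^sup>2" for r
  define N where "N r = (cmod (u r))\<^sup>2 + (cmod (u (Suc r)))\<^sup>2" for r
  define S where "S = (\<Sum>r. 1 / b r)"
  \<comment> \<open>Besides the two variations, \<open>S / b (Suc r)\<close> covers the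
    squared-modulus error because \<open>1 \<le> b r * S\<close>, and \<open>1 / b (Suc r)\<close>
    covers the Im error because \<open>\<rho> (Suc r) = b r / b (Suc r)\<close>.\<close>
  define \<epsilon> where "\<epsilon> r = \<bar>\<rho> (Suc r) - \<rho> r\<bar> + \<bar>q (Suc r) - q r\<bar> + (S + 1) * (1 / b (Suc r))" for r
  \<comment> \<open>Now |\<kappa>| = 2 - 4c. With |q r| < |\<kappa>| + c the mixed term costs at
    most (1 - 3c/2) * N r, and with \<rho> r > 1 - c/2 the coefficient left for the squared modulus
    of \<open>u r\<close> is (1 - c/2) - (1 - 3c/2) = c.\<close>
  define c where "c = (2 - \<bar>\<kappa>\<bar>) / 4"
  have c: "c > 0" using q(2) by (simp add: c_def)
  have N0: "N r \<ge> 0" for r by (simp add: N_def)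
  have S: "1 / b r \<le> S" for r
    using sum_le_suminf[OF b_sum, of "{r}"] b_pos by (simp add: S_def less_imp_le)
  have S0: "S \<ge> 0" using S[of 0] b_pos[of 0] by (meson divide_nonneg_pos order_trans zero_le_one)
  have \<epsilon>0: "\<epsilon> r \<ge> 0" for r using S0 b_pos[of "Suc r"] by (simp add: \<epsilon>_def)
  have \<epsilon>_sum: "summable \<epsilon>"
    unfolding \<epsilon>_def using b_sum
    by (intro summable_add summable_mult \<rho> q) (subst summable_Suc_iff)
  have step: "\<bar>b (Suc r) * H (Suc r) - b r * H r\<bar> \<le> b r * N r * \<epsilon> r" for r
  proof -
    let ?B = "b (Suc r)" and ?R = "Re (u r * cnj (u (Suc r)))" and ?I = "Im (u (Suc r) * cnj (u r))"
    have R: "\<bar>?R\<bar> \<le> N r"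
    proof -
      have "\<bar>?R\<bar> \<le> 2 * \<bar>?R\<bar>" by (rule order_trans[OF _ mult_right_mono[of 1]]) auto
      also have "\<dots> \<le> N r" unfolding N_def by (rule abs_Re_mult_cnj_le)
      finally show ?thesis .
    qed
    have I: "2 * \<bar>?I\<bar> \<le> N r"
      using abs_Im_mult_cnj_le[of "u (Suc r)" "u r"] by (simp only: N_def add.commute)
    have eq: "?B * H (Suc r) - b r * H r
      = b r * ((\<rho> (Suc r) - \<rho> r) * (cmod (u r))\<^sup>2 + (q (Suc r) - q r) * ?R)
        + (cmod (u (Suc r)))\<^sup>2 / ?B + 2 * \<rho> (Suc r) * ?I"
      using energy_step[OF b_pos[of "Suc r"], of "\<rho> (Suc r)" "u (Suc r)" "q (Suc r)" "u r" "\<rho> r" "q r"]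
      unfolding H_def rec[of r] \<rho>(1)[of r] by simp
    have 1: "\<bar>b r * ((\<rho> (Suc r) - \<rho> r) * (cmod (u r))\<^sup>2 + (q (Suc r) - q r) * ?R)\<bar>
        \<le> b r * N r * (\<bar>\<rho> (Suc r) - \<rho> r\<bar> + \<bar>q (Suc r) - q r\<bar>)"
    proof -
      have "\<bar>(\<rho> (Suc r) - \<rho> r) * (cmod (u r))\<^sup>2 + (q (Suc r) - q r) * ?R\<bar>
          \<le> \<bar>\<rho> (Suc r) - \<rho> r\<bar> * (cmod (u r))\<^sup>2 + \<bar>q (Suc r) - q r\<bar> * \<bar>?R\<bar>"
        using abs_triangle_ineq[of "(\<rho> (Suc r) - \<rho> r) * (cmod (u r))\<^sup>2" "(q (Suc r) - q r) * ?R"]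
        by (simp add: abs_mult)
      also have "\<dots> \<le> \<bar>\<rho> (Suc r) - \<rho> r\<bar> * N r + \<bar>q (Suc r) - q r\<bar> * N r"
        using R by (intro add_mono mult_left_mono) (auto simp: N_def)
      finally have "b r * \<bar>(\<rho> (Suc r) - \<rho> r) * (cmod (u r))\<^sup>2 + (q (Suc r) - q r) * ?R\<bar>
          \<le> b r * (\<bar>\<rho> (Suc r) - \<rho> r\<bar> * N r + \<bar>q (Suc r) - q r\<bar> * N r)"
        using b_pos[of r] by (intro mult_left_mono) auto
      also have "\<dots> = b r * N r * (\<bar>\<rho> (Suc r) - \<rho> r\<bar> + \<bar>q (Suc r) - q r\<bar>)"
        by (simp only: ring_distribs mult_ac)
      finally show ?thesis
        using b_pos[of r] by (simp only: abs_mult abs_of_pos)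
    qed
    have 2: "\<bar>(cmod (u (Suc r)))\<^sup>2 / ?B\<bar> \<le> b r * N r * (S * (1 / ?B))"
    proof -
      have "1 \<le> b r * S" using S[of r] b_pos[of r] by (simp add: field_simps)
      then have "N r * 1 \<le> N r * (b r * S)" by (intro mult_left_mono N0)
      moreover have "(cmod (u (Suc r)))\<^sup>2 \<le> N r" by (simp add: N_def)
      ultimately have "(cmod (u (Suc r)))\<^sup>2 \<le> b r * N r * S" by (simp add: mult_ac)
      then show ?thesis
        using b_pos[of "Suc r"] by (simp add: divide_right_mono)
    qed
    have 3: "\<bar>2 * \<rho> (Suc r) * ?I\<bar> \<le> b r * N r * (1 / ?B)"
    proof -
      have "\<rho> (Suc r) = b r * (1 / ?B)" using \<rho>(1)[of r] b_pos[of "Suc r"] by simp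
      moreover have "b r * (1 / ?B) \<ge> 0" using b_pos[of r] b_pos[of "Suc r"] by simp
      ultimately have "\<bar>2 * \<rho> (Suc r) * ?I\<bar> = b r * (1 / ?B) * (2 * \<bar>?I\<bar>)"
        using b_pos[of r] b_pos[of "Suc r"] by (simp only: abs_mult) simp
      also have "\<dots> \<le> b r * (1 / ?B) * N r"
        by (intro mult_left_mono I) fact
      finally show ?thesis by (simp add: mult_ac)
    qed
    have "b r * N r * \<epsilon> r = b r * N r * (\<bar>\<rho> (Suc r) - \<rho> r\<bar> + \<bar>q (Suc r) - q r\<bar>)
        + b r * N r * (S * (1 / ?B)) + b r * N r * (1 / ?B)"
      unfolding \<epsilon>_def by (simp only: distrib_left distrib_right mult_1)
    then show ?thesis using 1 2 3 unfolding eq by linarith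
  qed
  have "eventually (\<lambda>r. \<bar>q r\<bar> < \<bar>\<kappa>\<bar> + c) sequentially"
    using tendsto_rabs[OF q(1)] c by (intro order_tendstoD(2)) auto
  moreover have "eventually (\<lambda>r. \<rho> r > 1 - c / 2) sequentially"
    using \<rho>(2) c by (intro order_tendstoD(1)) auto
  ultimately have "eventually (\<lambda>r. \<bar>q r\<bar> < \<bar>\<kappa>\<bar> + c \<and> \<rho> r > 1 - c / 2) sequentially"
    by (rule eventually_conj)
  then obtain R where R: "\<And>r. r \<ge> R \<Longrightarrow> \<bar>q r\<bar> < \<bar>\<kappa>\<bar> + c" "\<And>r. r \<ge> R \<Longrightarrow> \<rho> r > 1 - c / 2"
    unfolding eventually_sequentially by blast
  have HN: "c * N r \<le> H r" if "r \<ge> R" for r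
  proof -
    have "\<bar>q r * Re (u r * cnj (u (Suc r)))\<bar> \<le> (\<bar>\<kappa>\<bar> + c) * (N r / 2)"
    proof -
      have "\<bar>Re (u r * cnj (u (Suc r)))\<bar> \<le> N r / 2"
        using abs_Re_mult_cnj_le[of "u r" "u (Suc r)"] unfolding N_def by (simp only: pos_le_divide_eq zero_less_numeral mult.commute)
      then show ?thesis
        unfolding abs_mult using R(1)[OF that] by (intro mult_mono) auto
    qed
    moreover have "(1 - c / 2) * (cmod (u r))\<^sup>2 \<le> \<rho> r * (cmod (u r))\<^sup>2"
      using R(2)[OF that] by (intro mult_right_mono) auto
    moreover have "(\<bar>\<kappa>\<bar> + c) * (N r / 2) = (1 - 3 / 2 * c) * N r"
      by (simp add: c_def field_simps)
    moreover have "c / 2 * (cmod (u (Suc r)))\<^sup>2 \<ge> 0" using c by simp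
    moreover have "c * (A + B) \<le> P + Z + B"
      if "\<bar>Z\<bar> \<le> (1 - 3 / 2 * c) * (A + B)" "(1 - c / 2) * A \<le> P" "c / 2 * B \<ge> 0" for A B P Z :: real
      using that by (auto simp: ring_distribs abs_le_iff)
    ultimately show ?thesis unfolding H_def N_def by metis
  qed
  have H0: "H r \<ge> 0" if "r \<ge> R" for r
    using HN[OF that] N0[of r] c by (meson mult_nonneg_nonneg order_trans less_imp_le)
  \<comment> \<open>From \<open>R\<close> on the energy dominates \<open>c * b * N\<close>, so the
    absolute error in \<open>step\<close> becomes a relative error
    \<open>\<epsilon> / c\<close>.\<close>
  define x where "x n = b (n + R) * H (n + R)" for n
  have x0: "x n \<ge> 0" for n using b_pos[of "n + R"] H0[of "n + R"] by (simp add: x_def)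
  have "x (Suc n) \<le> x n * (1 + \<epsilon> (n + R) / c)" for n
  proof -
    have "b (n + R) * N (n + R) * \<epsilon> (n + R) \<le> b (n + R) * (H (n + R) / c) * \<epsilon> (n + R)"
      using HN[of "n + R"] c b_pos[of "n + R"] \<epsilon>0
      by (intro mult_right_mono mult_left_mono) (auto simp: field_simps)
    then show ?thesis
      using step[of "n + R"] by (simp add: x_def algebra_simps)
  qed
  moreover have "summable (\<lambda>n. \<epsilon> (n + R) / c)"
    using \<epsilon>_sum by (intro summable_divide) (simp add: summable_iff_shift)
  ultimately obtain M where M: "\<And>n. x n \<le> M"
    using bounded_of_growth[of x "\<lambda>n. \<epsilon> (n + R) / c"] x0 \<epsilon>0 c by (meson divide_nonneg_pos)
  have "summable (\<lambda>n. (cmod (u (n + R)))\<^sup>2)"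
  proof (rule summable_comparison_test'[where N = 0])
    show "summable (\<lambda>n. M / c * (1 / b (n + R)))"
      using b_sum by (intro summable_mult) (subst summable_iff_shift)
    fix n
    have "b (n + R) * (c * (cmod (u (n + R)))\<^sup>2) \<le> b (n + R) * H (n + R)"
      using HN[of "n + R"] c b_pos[of "n + R"]
      by (intro mult_left_mono) (auto simp: N_def distrib_left intro: order_trans[rotated])
    also have "\<dots> \<le> M" using M[of n] by (simp add: x_def)
    finally show "norm ((cmod (u (n + R)))\<^sup>2) \<le> M / c * (1 / b (n + R))"
      using c b_pos[of "n + R"] by (simp add: field_simps)
  qed
  then show ?thesis by (subst (asm) summable_iff_shift)
qed

text \<open>Along a lattice the powers n^(-1/2) and n^(-1) decrease to 0, so their variation
  telescopes. The expansion is used at order 2 because its remainder n^(-3/2) is summable, while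
  order 1 would leave n^(-1).\<close>

lemma asymptotic_bounded_variation:
  assumes g: "asymp_exp g lam" and D: "D > 0"
  shows "(\<lambda>r. g (n0 + r * D)) \<longlonglongrightarrow> lam 0"
    "summable (\<lambda>r. cmod (g (n0 + Suc r * D) - g (n0 + r * D)))"
proof -
  define x where "x r = real (n0 + r * D)" for r
  have x_ge: "real r \<le> x r" for r
  proof -
    have "r \<le> r * D" using D by (cases D) auto
    then have "r \<le> n0 + r * D" by (rule trans_le_add2)
    then show ?thesis unfolding x_def by (simp only: of_nat_le_iff)
  qed
  have x_mono: "x r \<le> x (Suc r)" for r by (simp add: x_def)
  have x_lim: "filterlim x at_top sequentially"
    by (rule filterlim_at_top_mono[OF filterlim_real_sequentially]) (use x_ge in auto)
  have pow: "(\<lambda>r. x r powr (- a)) \<longlonglongrightarrow> 0" if "a > 0" for a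
    using that by (intro tendsto_neg_powr x_lim) auto
  have tele: "summable (\<lambda>r. x r powr (- a) - x (Suc r) powr (- a))" if "a > 0" for a
    using telescope_summable'[OF pow[OF that]] .
  obtain C0 N0 where 0: "\<And>n. n \<ge> N0 \<Longrightarrow> cmod (g n - lam 0 * complex_of_real (real n powr 0)) \<le> C0 * real n powr (- (1/2))"
    using g[unfolded asymp_exp_def, rule_format, of 0] by auto
  show "(\<lambda>r. g (n0 + r * D)) \<longlonglongrightarrow> lam 0"
  proof (rule Lim_null_comparison[where g = "\<lambda>r. C0 * x r powr (- (1/2))", THEN LIM_zero_cancel])
    show "\<forall>\<^sub>F r in sequentially. cmod (g (n0 + r * D) - lam 0) \<le> C0 * x r powr - (1 / 2)"
    proof (rule eventually_sequentiallyI[of "max N0 1"])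
      fix r assume r: "max N0 1 \<le> r"
      have "real (n0 + r * D) > 0" using x_ge[of r] r by (simp add: x_def)
      moreover have "n0 + r * D \<ge> N0" using x_ge[of r] r unfolding x_def of_nat_le_iff by simp
      ultimately show "cmod (g (n0 + r * D) - lam 0) \<le> C0 * x r powr - (1 / 2)"
        using 0[of "n0 + r * D"] by (simp add: x_def)
    qed
    show "(\<lambda>r. C0 * x r powr - (1 / 2)) \<longlonglongrightarrow> 0"
      using tendsto_mult_right_zero[OF pow[of "1/2"]] by simp
  qed
  obtain C N where CN: "\<And>n. n \<ge> N \<Longrightarrow> cmod (g n - (lam 0 * complex_of_real (real n powr 0)
      + lam 1 * complex_of_real (real n powr (- (1/2))) + lam 2 * complex_of_real (real n powr (- 1)))) \<le> C * real n powr (- (3/2))"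
    using g[unfolded asymp_exp_def, rule_format, of 2] by (auto simp: numeral_2_eq_2 eval_nat_numeral)
  \<comment> \<open>The factor 2 accounts for the remainders at both ends of a step; both are
    estimated at \<open>real r\<close>, which is at most \<open>x r\<close>.\<close>
  define E where "E r = cmod (lam 1) * (x r powr (- (1/2)) - x (Suc r) powr (- (1/2)))
      + cmod (lam 2) * (x r powr (- 1) - x (Suc r) powr (- 1)) + 2 * \<bar>C\<bar> * real r powr (- (3/2))" for r
  have "summable E"
    unfolding E_def by (intro summable_add summable_mult tele) (simp_all add: summable_real_powr_iff)
  moreover have "norm (cmod (g (n0 + Suc r * D) - g (n0 + r * D))) \<le> E r" if r: "r \<ge> max N 1" for r
  proof -
    define h where "h n = lam 0 * complex_of_real (real n powr 0)
      + lam 1 * complex_of_real (real n powr (- (1/2))) + lam 2 * complex_of_real (real n powr (- 1))" for n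
    have ge: "N \<le> n0 + r * D" using x_ge[of r] r unfolding x_def of_nat_le_iff by simp
    have pos: "x r > 0" "x (Suc r) > 0" using x_ge[of r] x_mono[of r] r by auto
    have err: "cmod (g (n0 + s * D) - h (n0 + s * D)) \<le> \<bar>C\<bar> * real r powr (- (3/2))" if "s = r \<or> s = Suc r" for s
    proof -
      have s: "x s \<ge> real r" "n0 + s * D \<ge> N" using that x_ge[of r] x_mono[of r] ge by auto
      have "cmod (g (n0 + s * D) - h (n0 + s * D)) \<le> C * x s powr (- (3/2))"
        using CN[OF s(2)] by (simp add: h_def x_def)
      also have "\<dots> \<le> \<bar>C\<bar> * real r powr (- (3/2))"
        using s(1) r by (intro mult_mono powr_mono2') auto
      finally show ?thesis .
    qed
    have hd: "cmod (h (n0 + Suc r * D) - h (n0 + r * D)) \<le> cmod (lam 1) * (x r powr (- (1/2)) - x (Suc r) powr (- (1/2)))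
      + cmod (lam 2) * (x r powr (- 1) - x (Suc r) powr (- 1))"
    proof -
      have le: "x (Suc r) powr (- a) \<le> x r powr (- a)" if "a > 0" for a
        using pos x_mono[of r] that by (intro powr_mono2') auto
      have h: "h (n0 + s * D) = lam 0 + lam 1 * complex_of_real (x s powr (- (1/2))) + lam 2 * complex_of_real (x s powr (- 1))"
        if "x s > 0" for s
        unfolding h_def x_def[symmetric] using that by simp
      have "h (n0 + Suc r * D) - h (n0 + r * D) = lam 1 * complex_of_real (x (Suc r) powr (- (1/2)) - x r powr (- (1/2)))
          + lam 2 * complex_of_real (x (Suc r) powr (- 1) - x r powr (- 1))"
        unfolding h[OF pos(1)] h[OF pos(2)] by (simp only: of_real_diff right_diff_distrib) simp
      also have "cmod \<dots> \<le> cmod (lam 1) * \<bar>x (Suc r) powr (- (1/2)) - x r powr (- (1/2))\<bar>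
          + cmod (lam 2) * \<bar>x (Suc r) powr (- 1) - x r powr (- 1)\<bar>"
        by (rule order_trans[OF norm_triangle_ineq]) (simp only: norm_mult norm_of_real order_refl)
      finally show ?thesis using le[of "1/2"] le[of 1] by simp
    qed
    have "cmod (a - c) \<le> cmod (a - a') + cmod (a' - c') + cmod (c - c')" for a a' c c' :: complex
    proof -
      have "a - c = (a - a') + (a' - c') - (c - c')" by simp
      also have "cmod \<dots> \<le> cmod ((a - a') + (a' - c')) + cmod (c - c')" by (rule norm_triangle_ineq4)
      also have "\<dots> \<le> cmod (a - a') + cmod (a' - c') + cmod (c - c')"
        by (intro add_right_mono norm_triangle_ineq)
      finally show ?thesis .
    qed
    from this[of "g (n0 + Suc r * D)" "g (n0 + r * D)" "h (n0 + Suc r * D)" "h (n0 + r * D)"]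
    show ?thesis using hd err[of r] err[of "Suc r"] by (simp add: E_def)
  qed
  ultimately show "summable (\<lambda>r. cmod (g (n0 + Suc r * D) - g (n0 + r * D)))"
    by (rule summable_comparison_test')
qed

section \<open>Growth and ratios of the weights \<open>beta\<close>\<close>

lemma beta_eq_0: "n < l \<Longrightarrow> beta k l n = 0"
proof -
  assume n: "n < l"
  have "poch (int n - int l + 1) l = 0"
  proof (cases "int n - int l + 1 < 0")
    case False
    then have "int n - int l + 1 = 0" using n by simp
    then show ?thesis using n by (simp add: poch_def pochhammer_0_left)
  qed (simp add: poch_def)
  then show ?thesis by (simp add: beta_def)
qed

lemma beta_eq:
  assumes "l \<le> n"
  shows "beta k l n = sqrt (pochhammer (real (n - l + 1)) l * pochhammer (real (n - l + 1)) k)"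
proof -
  define x where "x = n - l + 1"
  have "int n - int l + 1 = int x" using assms by (simp add: x_def of_nat_diff)
  then have "beta k l n = sqrt (real_of_int (pochhammer (int x) l * pochhammer (int x) k))"
    unfolding beta_def poch_def by simp
  then show ?thesis unfolding pochhammer_of_nat x_def[symmetric] by simp
qed

lemma beta_pos: "l \<le> n \<Longrightarrow> beta k l n > 0"
  by (subst beta_eq) (auto intro!: mult_pos_pos pochhammer_pos)

text \<open>Hermiticity of the matrix of A: the lower weight at a lattice site is the upper weight
  at the preceding one.\<close>

lemma beta_swap: "l \<le> k \<Longrightarrow> beta l k (n + (k - l)) = beta k l n"
  by (simp add: beta_def of_nat_diff mult.commute)

lemma power_le_pochhammer: "x > 0 \<Longrightarrow> x ^ s \<le> pochhammer (x::real) s"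
proof (induction s)
  case (Suc s)
  then have "x ^ s * x \<le> pochhammer x s * (x + real s)"
    by (intro mult_mono pochhammer_nonneg) auto
  then show ?case by (simp add: pochhammer_Suc mult.commute)
qed simp

text \<open>The two Pochhammer products have k + l \<ge> 3 factors in all, each at least r, so the
  weight is at least r^(3/2).\<close>

lemma summable_inverse_beta:
  assumes kl: "k > l" "k + l \<ge> 3" and n0: "l \<le> n0"
  shows "summable (\<lambda>r. 1 / beta k l (n0 + r * (k - l)))"
proof (rule summable_comparison_test'[where N = 1])
  show "summable (\<lambda>r. real r powr (- (3/2)))" by (simp add: summable_real_powr_iff)
  fix r :: nat assume r: "1 \<le> r"
  let ?n = "n0 + r * (k - l)" let ?x = "real (?n - l + 1)"
  have "r \<le> r * (k - l)" using kl by (cases "k - l") auto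
  then have "r \<le> ?n - l + 1" using n0 by linarith
  then have x: "real r \<le> ?x" by (simp only: of_nat_le_iff)
  have "real r ^ 3 \<le> real r ^ (l + k)" using kl r by (intro power_increasing) auto
  also have "\<dots> \<le> ?x ^ (l + k)" using x by (intro power_mono) auto
  also have "\<dots> \<le> pochhammer ?x l * pochhammer ?x k"
    unfolding power_add by (intro mult_mono power_le_pochhammer) (auto intro: pochhammer_nonneg)
  finally have "sqrt (real r ^ 3) \<le> beta k l ?n"
    using n0 by (subst beta_eq) (auto intro: real_sqrt_le_mono)
  moreover have "sqrt (real r ^ 3) = real r powr (3/2)"
  proof -
    have "sqrt (real r ^ 3) = (real r powr 3) powr (1/2)"
      using r powr_numeral[of "real r" "num.Bit1 num.One"] powr_half_sqrt[of "real r ^ 3"] by simp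
    then show ?thesis unfolding powr_powr by simp
  qed
  ultimately have "real r powr (3/2) \<le> beta k l ?n" by simp
  moreover have "real r powr (3/2) > 0" using r by simp
  ultimately have "1 / beta k l ?n \<le> 1 / real r powr (3/2)" by (intro frac_le) auto
  moreover have "beta k l ?n > 0" using n0 by (intro beta_pos) simp
  ultimately show "norm (1 / beta k l ?n) \<le> real r powr (- (3/2))"
    by (simp add: powr_minus_divide)
qed

lemma beta_ratio:
  assumes "l \<le> n"
  shows "beta k l n / beta k l (n + D) = sqrt ((\<Prod>j<l. (real (n - l + 1) + real j) / (real (n - l + 1) + real D + real j))
    * (\<Prod>j<k. (real (n - l + 1) + real j) / (real (n - l + 1) + real D + real j)))"
proof -
  define x where "x = real (n - l + 1)"
  have "real (n + D - l + 1) = x + real D" using assms by (simp add: x_def)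
  then have "beta k l n = sqrt (pochhammer x l * pochhammer x k)"
    "beta k l (n + D) = sqrt (pochhammer (x + real D) l * pochhammer (x + real D) k)"
    using assms by (simp_all only: beta_eq trans_le_add1 x_def)
  then show ?thesis
    unfolding x_def[symmetric]
    by (simp add: real_sqrt_divide[symmetric] pochhammer_prod prod_dividef atLeast0LessThan del: real_sqrt_mult)
qed

text \<open>Every factor (x + j) / (x + D + j) in \<open>beta_ratio\<close> increases to 1 as x
  grows. Hence the ratio is monotone and its variation telescopes.\<close>

lemma beta_ratio_limit:
  assumes "l \<le> n0" "D > 0"
  shows "(\<lambda>r. beta k l (n0 + r * D) / beta k l (n0 + Suc r * D)) \<longlonglongrightarrow> 1"
    "summable (\<lambda>r. \<bar>beta k l (n0 + Suc r * D) / beta k l (n0 + Suc (Suc r) * D)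
      - beta k l (n0 + r * D) / beta k l (n0 + Suc r * D)\<bar>)"
proof -
  define \<sigma> where "\<sigma> r = beta k l (n0 + r * D) / beta k l (n0 + Suc r * D)" for r
  define x where "x r = real (n0 + r * D - l + 1)" for r
  define F where "F s r = (\<Prod>j<s. (x r + real j) / (x r + real D + real j))" for s :: nat and r
  have \<sigma>: "\<sigma> r = sqrt (F l r * F k r)" for r
    using beta_ratio[of l "n0 + r * D" k D] assms(1) by (simp add: \<sigma>_def F_def x_def add_ac)
  have x_pos: "x r > 0" for r by (simp add: x_def)
  have x_Suc: "x r \<le> x (Suc r)" for r unfolding x_def of_nat_le_iff by simp
  have frac_mono: "(x r + real j) / (x r + real D + real j) \<le> (x (Suc r) + real j) / (x (Suc r) + real D + real j)" for r j
  proof -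
    have "(a + j) / (a + d + j) \<le> (b + j) / (b + d + j)" if "0 < a" "a \<le> b" "0 \<le> d" "0 \<le> j" for a b d j :: real
    proof -
      have "d * a \<le> d * b" using that by (intro mult_left_mono) auto
      then have "(a + j) * (b + d + j) \<le> (b + j) * (a + d + j)" by (simp add: algebra_simps)
      moreover have "a + d + j > 0" "b + d + j > 0" using that by auto
      ultimately show ?thesis
        by (simp only: pos_divide_le_eq times_divide_eq_left pos_le_divide_eq)
    qed
    then show ?thesis using x_pos x_Suc by simp
  qed
  have F_mono: "F s r \<le> F s (Suc r)" for s r
    unfolding F_def using x_pos[of r] by (intro prod_mono conjI frac_mono) (auto intro!: divide_nonneg_pos add_nonneg_nonneg less_imp_le)
  have F0: "F s r \<ge> 0" for s r
    unfolding F_def using x_pos[of r] by (intro prod_nonneg) (auto intro!: divide_nonneg_pos)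
  have mono: "\<sigma> r \<le> \<sigma> (Suc r)" for r
    unfolding \<sigma> by (intro real_sqrt_le_mono mult_mono F_mono F0)
  have x_lim: "filterlim x at_top sequentially"
  proof (rule filterlim_at_top_mono[OF filterlim_real_sequentially])
    have "real r \<le> x r" for r
    proof -
      have "r \<le> r * D" using assms(2) by (cases D) auto
      then have "r \<le> n0 + r * D - l + 1" using assms(1) by linarith
      then show ?thesis unfolding x_def of_nat_le_iff .
    qed
    then show "\<forall>\<^sub>F r in sequentially. real r \<le> x r" by simp
  qed
  have "(\<lambda>r. (x r + real j) / (x r + real D + real j)) \<longlonglongrightarrow> 1" for j
  proof -
    have "filterlim (\<lambda>r. x r + (real D + real j)) at_top sequentially"
      using filterlim_tendsto_add_at_top[OF tendsto_const x_lim, of "real D + real j"] by (simp add: add.commute)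
    then have "(\<lambda>r. 1 - real D / (x r + (real D + real j))) \<longlonglongrightarrow> 1 - 0"
      by (intro tendsto_diff tendsto_const real_tendsto_divide_at_top[OF tendsto_const])
    moreover have "1 - real D / (x r + (real D + real j)) = (x r + real j) / (x r + real D + real j)" for r
    proof -
      have "x r + real D + real j > 0" using x_pos[of r] by simp
      then show ?thesis by (simp add: field_simps)
    qed
    ultimately show ?thesis by simp
  qed
  then have "(\<lambda>r. F s r) \<longlonglongrightarrow> (\<Prod>j<s. 1)" for s
    unfolding F_def by (intro tendsto_prod)
  then have "(\<lambda>r. sqrt (F l r * F k r)) \<longlonglongrightarrow> sqrt ((\<Prod>j<l. 1) * (\<Prod>j<k. 1))"
    by (intro tendsto_intros)
  then have lim: "\<sigma> \<longlonglongrightarrow> 1" unfolding \<sigma>[abs_def] by simp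
  then show "(\<lambda>r. beta k l (n0 + r * D) / beta k l (n0 + Suc r * D)) \<longlonglongrightarrow> 1"
    unfolding \<sigma>_def .
  have "summable (\<lambda>r. \<bar>\<sigma> (Suc r) - \<sigma> r\<bar>)"
    using telescope_summable[OF lim] mono by simp
  then show "summable (\<lambda>r. \<bar>beta k l (n0 + Suc r * D) / beta k l (n0 + Suc (Suc r) * D)
      - beta k l (n0 + r * D) / beta k l (n0 + Suc r * D)\<bar>)"
    unfolding \<sigma>_def .
qed

lemma solves_rec_square_summable:
  assumes kl: "k > l" "k + l \<ge> 3" and f: "\<And>n. f n \<ge> 0"
    and asym: "asymp_exp (\<lambda>n. complex_of_real (f n / beta k l n)) lam" "lam 0 = complex_of_real \<kappa>" "\<kappa> < 2"
    and n0: "l \<le> n0" and d: "solves_rec k l f n0 d"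
  shows "summable (\<lambda>r. (cmod (d r))\<^sup>2)"
proof -
  define D where "D = k - l"
  have D: "D > 0" using kl by (simp add: D_def)
  define b where "b r = beta k l (n0 + r * D)" for r
  define q where "q r = f (n0 + r * D) / b r" for r
  define \<sigma> where "\<sigma> r = b r / b (Suc r)" for r
  \<comment> \<open>The powers of \<open>\<i>\<close> turn the coefficient 1 + i f into
    \<open>\<i> / b - q\<close> after division by the weight, and reverse the sign of the lower
    term; what remains is a real recurrence with a small imaginary perturbation.\<close>
  define u where "u r = \<i> ^ r * d r" for r
  have b_pos: "b r > 0" for r using n0 by (simp add: b_def beta_pos)
  have "(\<lambda>r. complex_of_real (q r)) \<longlonglongrightarrow> complex_of_real \<kappa>"
    "summable (\<lambda>r. cmod (complex_of_real (q (Suc r)) - complex_of_real (q r)))"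
    using asymptotic_bounded_variation[OF asym(1) D, of n0] asym(2) by (simp_all add: q_def b_def)
  then have q: "q \<longlonglongrightarrow> \<kappa>" "summable (\<lambda>r. \<bar>q (Suc r) - q r\<bar>)"
    by (simp_all only: tendsto_of_real_iff norm_of_real flip: of_real_diff)
  \<comment> \<open>The energy needs a two-sided bound on \<kappa>; nonnegativity of
    \<open>f\<close> supplies the lower one.\<close>
  have "\<kappa> \<ge> 0"
    by (rule LIMSEQ_le_const[OF q(1)]) (use f b_pos in \<open>auto simp: q_def less_imp_le\<close>)
  then have \<kappa>: "\<bar>\<kappa>\<bar> < 2" using asym(3) by simp
  have rec: "u (Suc (Suc r)) = (\<i> / complex_of_real (b (Suc r)) - complex_of_real (q (Suc r))) * u (Suc r)
      - complex_of_real (\<sigma> r) * u r" for r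
  proof -
    have bs: "beta l k (n0 + Suc r * D) = b r"
      using beta_swap[of l k "n0 + r * D"] kl by (simp add: b_def D_def add_ac)
    have nz: "complex_of_real (b (Suc r)) \<noteq> 0" using b_pos[of "Suc r"] by simp
    have "complex_of_real (b (Suc r)) * d (Suc (Suc r)) =
        (1 + \<i> * complex_of_real (f (n0 + Suc r * D))) * d (Suc r) + complex_of_real (b r) * d r"
      using d[unfolded solves_rec_def, rule_format, of "Suc r"] bs
      unfolding D_def[symmetric] by (simp add: b_def algebra_simps)
    then have d2: "d (Suc (Suc r)) =
        ((1 + \<i> * complex_of_real (f (n0 + Suc r * D))) * d (Suc r) + complex_of_real (b r) * d r) / complex_of_real (b (Suc r))"
      using nz by (simp add: field_simps)
    show ?thesis
      unfolding u_def d2 q_def \<sigma>_def using nz by (simp add: field_simps)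
  qed
  have "summable (\<lambda>r. (cmod (u (Suc r)))\<^sup>2)"
  \<comment> \<open>Shifted by one site, so that \<rho> at 0 is the genuine ratio of the first two
    weights; the unshifted sequence would need a weight before the first.\<close>
  proof (rule recurrence_square_summable[where b = "\<lambda>r. b (Suc r)" and \<rho> = \<sigma> and q = "\<lambda>r. q (Suc r)" and \<kappa> = \<kappa>])
    show "summable (\<lambda>r. 1 / b (Suc r))"
      using summable_inverse_beta[OF kl n0] unfolding D_def[symmetric] b_def[symmetric]
      by (subst summable_Suc_iff)
    show "b (Suc r) = \<sigma> (Suc r) * b (Suc (Suc r))" for r
      using b_pos[of "Suc (Suc r)"] by (simp add: \<sigma>_def)
    show "\<sigma> \<longlonglongrightarrow> 1" "summable (\<lambda>r. \<bar>\<sigma> (Suc r) - \<sigma> r\<bar>)"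
      using beta_ratio_limit[OF n0 D, of k] by (simp_all add: \<sigma>_def[abs_def] b_def)
    show "(\<lambda>r. q (Suc r)) \<longlonglongrightarrow> \<kappa>" using q(1) by (rule LIMSEQ_Suc)
    show "summable (\<lambda>r. \<bar>q (Suc (Suc r)) - q (Suc r)\<bar>)"
      using q(2) by (subst summable_Suc_iff)
    show "u (Suc (Suc (Suc r))) = (\<i> / complex_of_real (b (Suc (Suc r))) - complex_of_real (q (Suc (Suc r)))) * u (Suc (Suc r))
        - complex_of_real (\<sigma> (Suc r)) * u (Suc r)" for r by (rule rec)
  qed (use b_pos \<kappa> in auto)
  then have "summable (\<lambda>r. (cmod (d (Suc r)))\<^sup>2)" by (simp add: u_def norm_mult norm_power)
  then show ?thesis by (subst (asm) summable_Suc_iff)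
qed

section \<open>The operator and its deficiency spaces\<close>

lemma ann_apply: "ann x n = complex_of_real (sqrt (real (n + 1))) * x (n + 1)"
  by (simp add: ann_def)

lemma cre_apply: "cre x n = (if n = 0 then 0 else complex_of_real (sqrt (real n)) * x (n - 1))"
  by (simp add: cre_def)

lemma ann_pow: "(ann ^^ l) x n = complex_of_real (sqrt (pochhammer (real n + 1) l)) * x (n + l)"
proof (induction l arbitrary: n)
  case (Suc l)
  have "pochhammer (real n + 1) (Suc l) = (real n + 1) * pochhammer (real (n + 1) + 1) l"
    unfolding pochhammer_rec by (simp add: add_ac)
  moreover have "(ann ^^ Suc l) x n = complex_of_real (sqrt (real (n + 1))) * (ann ^^ l) x (n + 1)"
    unfolding funpow.simps comp_apply by (rule ann_apply)
  ultimately show ?case unfolding Suc by (simp add: real_sqrt_mult add_ac)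
qed simp

lemma cre_pow: "(cre ^^ k) x n = (if n < k then 0 else
    complex_of_real (sqrt (pochhammer (real (n - k) + 1) k)) * x (n - k))"
proof (induction k arbitrary: n)
  case (Suc k)
  have *: "(cre ^^ Suc k) x n = (if n = 0 then 0 else complex_of_real (sqrt (real n)) * (cre ^^ k) x (n - 1))"
    unfolding funpow.simps comp_apply by (rule cre_apply)
  show ?case
  proof (cases "n < Suc k")
    case False
    then obtain j where n: "n = Suc (j + k)" by (metis add.commute add_Suc less_iff_Suc_add not_less_eq)
    have "pochhammer (real j + 1) (Suc k) = pochhammer (real j + 1) k * real n"
      unfolding pochhammer_Suc n by (simp add: add_ac)
    then show ?thesis unfolding * Suc by (simp add: n real_sqrt_mult mult_ac)
  qed (unfold * Suc, auto)
qed simp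

lemma beta_add:
  "beta k l (j + l) = sqrt (pochhammer (real j + 1) l) * sqrt (pochhammer (real j + 1) k)"
proof -
  have "real (j + l - l + 1) = real j + 1" by simp
  then show ?thesis using beta_eq[of l "j + l" k] by (simp only: real_sqrt_mult le_add2)
qed

text \<open>Valid for every sequence x, not only in \<open>D0\<close>, since the ladder operators
  act coordinatewise. This lets \<open>Aop\<close> itself also describe the adjoint.\<close>

lemma Aop_apply:
  assumes kl: "l < k"
  shows "Aop k l \<theta> f x n = exp (\<i> * complex_of_real \<theta>) *
      (if n < k then 0 else complex_of_real (beta k l (n - (k - l))) * x (n - (k - l)))
    + cnj (exp (\<i> * complex_of_real \<theta>)) * complex_of_real (beta k l n) * x (n + (k - l))
    + complex_of_real (f n) * x n"
proof -
  have "(cre ^^ k) ((ann ^^ l) x) n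
      = (if n < k then 0 else complex_of_real (beta k l (n - (k - l))) * x (n - (k - l)))"
  proof (cases "n < k")
    case False
    define j where "j = n - k"
    have j: "n - k = j" "n - (k - l) = j + l" using False kl by (auto simp: j_def)
    show ?thesis using False
      by (simp add: cre_pow ann_pow j beta_add)
  qed (simp add: cre_pow)
  moreover have "(cre ^^ l) ((ann ^^ k) x) n = complex_of_real (beta k l n) * x (n + (k - l))"
  proof (cases "n < l")
    case False
    then obtain j where n: "n = j + l" by (metis add.commute le_Suc_ex not_less)
    have "n + (k - l) = j + k" using kl n by simp
    then show ?thesis
      by (simp add: cre_pow ann_pow n beta_add)
  qed (simp add: cre_pow beta_eq_0)
  ultimately show ?thesis by (simp add: Aop_def mult.assoc)
qed

section \<open>Fock vectors, finite sequences and density\<close>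

lemma fock_l2 [simp, intro]: "fock i \<in> l2"
  unfolding l2_def by (auto simp: fock_def intro!: summable_finite[of "{i}"] split: if_splits)

lemma linner_fock: "linner y (fock i) = cnj (y i)"
proof -
  have "linner y (fock i) = (\<Sum>n\<in>{i}. cnj (y n) * fock i n)"
    unfolding linner_def by (rule suminf_finite) (auto simp: fock_def)
  then show ?thesis by (simp add: fock_def)
qed

lemma D0_eq_lincomb:
  assumes "x \<in> D0" obtains M where "x = lincomb M x fock"
proof -
  obtain M where M: "\<And>n. x n \<noteq> 0 \<Longrightarrow> n < M"
    using assms unfolding D0_def finite_nat_set_iff_bounded by auto
  have "x n = lincomb M x fock n" for n
  proof (cases "n < M")
    case True
    then show ?thesis by (simp add: lincomb_def fock_def if_distrib cong: if_cong)
  next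
    case False
    then have "x n = 0" using M by blast
    moreover have "lincomb M x fock n = 0"
      unfolding lincomb_def using False by (intro sum.neutral) (auto simp: fock_def)
    ultimately show ?thesis by simp
  qed
  then show ?thesis using that by blast
qed

lemma D0_subset_l2: "D0 \<subseteq> l2"
proof
  fix x assume "x \<in> D0"
  then obtain M where "x = lincomb M x fock" by (rule D0_eq_lincomb)
  moreover have "lincomb M x fock \<in> l2" by (rule lincomb_l2) simp
  ultimately show "x \<in> l2" by (simp only:)
qed

lemma D0_add: "x \<in> D0 \<Longrightarrow> y \<in> D0 \<Longrightarrow> x + y \<in> D0"
  unfolding D0_def by (auto intro: finite_subset[of _ "{n. x n \<noteq> 0} \<union> {n. y n \<noteq> 0}"])

lemma D0_cscale: "x \<in> D0 \<Longrightarrow> cscale c x \<in> D0"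
  unfolding D0_def cscale_def by (auto intro: finite_subset[of _ "{n. x n \<noteq> 0}"])

lemma fock_D0: "fock i \<in> D0"
  by (simp add: D0_def fock_def)

lemma dense_D0: "dense_l2 D0"
  unfolding dense_l2_def
proof (intro conjI ballI allI impI D0_subset_l2)
  fix x :: "nat \<Rightarrow> complex" and e :: real assume x: "x \<in> l2" and e: "e > 0"
  have sum: "summable (\<lambda>n. (cmod (x n))\<^sup>2)" using x by (simp add: l2_def)
  obtain N where N: "norm (\<Sum>i. (cmod (x (i + N)))\<^sup>2) < e\<^sup>2"
    using suminf_exist_split[OF _ sum, of "e\<^sup>2"] e by auto
  define y where "y n = (if n < N then x n else 0)" for n
  have "y \<in> D0" unfolding D0_def y_def by (auto intro: finite_subset[of _ "{..<N}"])
  moreover have "lnorm (x - y) < e"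
  proof -
    have "x - y \<in> l2" using x \<open>y \<in> D0\<close> D0_subset_l2 by blast
    then have "(\<Sum>n. (cmod ((x - y) n))\<^sup>2) = (\<Sum>n. (cmod ((x - y) (n + N)))\<^sup>2) + (\<Sum>n<N. (cmod ((x - y) n))\<^sup>2)"
      by (intro suminf_split_initial_segment) (simp add: l2_def)
    also have "\<dots> = (\<Sum>n. (cmod (x (n + N)))\<^sup>2)" by (simp add: y_def)
    also have "\<dots> < e\<^sup>2" using N by simp
    finally show ?thesis
      unfolding lnorm_def using e by (simp add: real_sqrt_less_iff real_less_lsqrt suminf_nonneg)
  qed
  ultimately show "\<exists>y\<in>D0. lnorm (x - y) < e" by blast
qed

lemma lincomb_eq_sum: "lincomb m a e = (\<Sum>i<m. cscale (a i) (e i))"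
proof (induction m)
  case (Suc m)
  have "lincomb (Suc m) a e = lincomb m a e + cscale (a m) (e m)"
    by (auto simp: lincomb_def cscale_def)
  then show ?case by (simp only: Suc sum.lessThan_Suc)
qed (auto simp: lincomb_def)

interpretation vs: vector_space cscale
  by unfold_locales (auto simp: cscale_def fun_eq_iff algebra_simps)

context
  fixes k l :: nat and \<theta> :: real and f :: "nat \<Rightarrow> real"
  assumes kl: "l < k"
begin

lemma Aop_add: "Aop k l \<theta> f (x + y) = Aop k l \<theta> f x + Aop k l \<theta> f y"
  by (auto simp: fun_eq_iff Aop_apply[OF kl] algebra_simps)

lemma Aop_cscale: "Aop k l \<theta> f (cscale c x) = cscale c (Aop k l \<theta> f x)"
  by (auto simp: fun_eq_iff Aop_apply[OF kl] cscale_def algebra_simps)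

lemma Aop_lincomb: "Aop k l \<theta> f (lincomb m a e) = lincomb m a (\<lambda>i. Aop k l \<theta> f (e i))"
proof (induction m)
  case 0
  show ?case by (auto simp: fun_eq_iff Aop_apply[OF kl] lincomb_def)
next
  case (Suc m)
  have *: "lincomb (Suc m) a e = lincomb m a e + cscale (a m) (e m)" for e
    by (auto simp: lincomb_def cscale_def)
  show ?case unfolding * Aop_add Aop_cscale Suc ..
qed

lemma Aop_fock:
  "Aop k l \<theta> f (fock i) = cscale (exp (\<i> * complex_of_real \<theta>) * complex_of_real (beta k l i)) (fock (i + (k - l)))
    + cscale (if i < k then 0 else cnj (exp (\<i> * complex_of_real \<theta>)) * complex_of_real (beta k l (i - (k - l)))) (fock (i - (k - l)))
    + cscale (complex_of_real (f i)) (fock i)"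
proof
  fix n
  have 1: "(if n < k then 0 else complex_of_real (beta k l (n - (k - l))) * fock i (n - (k - l)))
      = complex_of_real (beta k l i) * fock (i + (k - l)) n"
  proof (cases "i < l")
    case True
    then show ?thesis using kl by (auto simp: fock_def beta_eq_0)
  next
    case False
    then show ?thesis using kl by (auto simp: fock_def)
  qed
  have 2: "complex_of_real (beta k l n) * fock i (n + (k - l))
      = (if i < k then 0 else complex_of_real (beta k l (i - (k - l)))) * fock (i - (k - l)) n"
  proof (cases "n < l")
    case True
    then show ?thesis using kl by (auto simp: fock_def beta_eq_0)
  next
    case False
    then show ?thesis using kl by (auto simp: fock_def)
  qed
  show "Aop k l \<theta> f (fock i) n = (cscale (exp (\<i> * complex_of_real \<theta>) * complex_of_real (beta k l i)) (fock (i + (k - l)))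
    + cscale (if i < k then 0 else cnj (exp (\<i> * complex_of_real \<theta>)) * complex_of_real (beta k l (i - (k - l)))) (fock (i - (k - l)))
    + cscale (complex_of_real (f i)) (fock i)) n"
    unfolding Aop_apply[OF kl] mult.assoc 1 2 by (simp add: cscale_def mult.assoc fock_def)
qed

lemma Aop_fock_l2: "Aop k l \<theta> f (fock i) \<in> l2"
  unfolding Aop_fock by (intro l2_add l2_cscale fock_l2)

lemma linner_Aop_fock:
  assumes "y \<in> l2" shows "linner y (Aop k l \<theta> f (fock i)) = cnj (Aop k l \<theta> f y i)"
  unfolding Aop_fock using assms by (simp add: linner_simps linner_fock Aop_apply[OF kl])

lemma linner_Aop:
  assumes "y \<in> l2" "x \<in> D0" "\<And>i. z i = Aop k l \<theta> f y i" "z \<in> l2"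
  shows "linner y (Aop k l \<theta> f x) = linner z x"
proof -
  obtain M where x: "x = lincomb M x fock" using assms(2) by (rule D0_eq_lincomb)
  have "linner y (Aop k l \<theta> f (lincomb M x fock)) = linner z (lincomb M x fock)"
    unfolding Aop_lincomb using assms(1,3,4)
    by (simp add: linner_lincomb_right Aop_fock_l2 linner_Aop_fock linner_fock)
  then show ?thesis using x by simp
qed

lemma Aop_l2: "x \<in> D0 \<Longrightarrow> Aop k l \<theta> f x \<in> l2"
proof -
  assume "x \<in> D0"
  then obtain M where x: "x = lincomb M x fock" by (rule D0_eq_lincomb)
  have "Aop k l \<theta> f (lincomb M x fock) \<in> l2"
    unfolding Aop_lincomb by (intro lincomb_l2 Aop_fock_l2)
  then show ?thesis using x by simp
qed

text \<open>Testing against \<open>fock i\<close> reads off the i-th coordinate of z, and finite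
  combinations of such tests are all of \<open>D0\<close>. Deficiency vectors thereby become
  square-summable solutions of a difference equation.\<close>

lemma mem_gadjoint_graph_A:
  "(y, z) \<in> gadjoint (graph_A k l \<theta> f) \<longleftrightarrow> y \<in> l2 \<and> z \<in> l2 \<and> z = Aop k l \<theta> f y"
proof
  assume *: "(y, z) \<in> gadjoint (graph_A k l \<theta> f)"
  then have yz: "y \<in> l2" "z \<in> l2" and eq: "\<And>x. x \<in> D0 \<Longrightarrow> linner y (Aop k l \<theta> f x) = linner z x"
    by (auto simp: gadjoint_def graph_A_def)
  have "z i = Aop k l \<theta> f y i" for i
    using eq[OF fock_D0, of i] yz by (simp add: linner_Aop_fock linner_fock)
  then show "y \<in> l2 \<and> z \<in> l2 \<and> z = Aop k l \<theta> f y" using yz by blast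
next
  assume "y \<in> l2 \<and> z \<in> l2 \<and> z = Aop k l \<theta> f y"
  then show "(y, z) \<in> gadjoint (graph_A k l \<theta> f)"
    using linner_Aop[of y _ z] by (auto simp: gadjoint_def graph_A_def)
qed

lemma Domain_graph_A: "Domain (graph_A k l \<theta> f) = D0"
  by (auto simp: graph_A_def)

lemma symmetric_operator_graph_A: "symmetric_operator (graph_A k l \<theta> f)"
proof
  show "graph_A k l \<theta> f \<subseteq> l2 \<times> l2"
    using D0_subset_l2 Aop_l2 by (auto simp: graph_A_def)
  show "p + q \<in> graph_A k l \<theta> f" if "p \<in> graph_A k l \<theta> f" "q \<in> graph_A k l \<theta> f" for p q
    using that by (auto simp: graph_A_def Aop_add intro: D0_add)
  show "sc2 c p \<in> graph_A k l \<theta> f" if "p \<in> graph_A k l \<theta> f" for c p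
    using that by (auto simp: graph_A_def Aop_cscale sc2_def intro: D0_cscale)
  show "graph_A k l \<theta> f \<subseteq> gadjoint (graph_A k l \<theta> f)"
  proof
    fix p assume "p \<in> graph_A k l \<theta> f"
    then obtain x where x: "x \<in> D0" "p = (x, Aop k l \<theta> f x)" by (auto simp: graph_A_def)
    then show "p \<in> gadjoint (graph_A k l \<theta> f)"
      unfolding x(2) mem_gadjoint_graph_A using D0_subset_l2 Aop_l2 by auto
  qed
  show "dense_l2 (Domain (graph_A k l \<theta> f))" unfolding Domain_graph_A by (rule dense_D0)
qed

interpretation so: symmetric_operator "graph_A k l \<theta> f"
  by (rule symmetric_operator_graph_A)

lemma eigenspace_eq: "so.eigenspace c = {u \<in> l2. Aop k l \<theta> f u = cscale c u}"
  by (auto simp: so.eigenspace_def mem_gadjoint_graph_A)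

text \<open>The complement of Ran(A + c) is the kernel of A* + cnj c. For imaginary c this is the
  eigenspace for c itself, so \<open>Kplus\<close> belongs to \<open>\<i>\<close> and
  \<open>Kminus\<close> to \<open>- \<i>\<close>.\<close>

lemma orthogonal_range_eq:
  assumes y: "y \<in> l2" and c: "cnj c = - c"
  shows "(\<forall>x\<in>D0. linner (Aop k l \<theta> f x + cscale c x) y = 0) \<longleftrightarrow> y \<in> so.eigenspace c"
proof -
  have "linner (Aop k l \<theta> f x + cscale c x) y = 0 \<longleftrightarrow> linner y (Aop k l \<theta> f x) = linner (cscale c y) x"
    if x: "x \<in> D0" for x
  proof -
    have xl: "x \<in> l2" "Aop k l \<theta> f x \<in> l2" using x D0_subset_l2 Aop_l2 by auto
    have "linner (Aop k l \<theta> f x + cscale c x) y = cnj (linner y (Aop k l \<theta> f x + cscale c x))"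
      using y xl by (intro linner_commute) auto
    also have "linner y (Aop k l \<theta> f x + cscale c x) = linner y (Aop k l \<theta> f x) - linner (cscale c y) x"
      using y xl c by (simp add: linner_simps)
    finally show ?thesis by (simp only: complex_cnj_zero_iff right_minus_eq)
  qed
  moreover have "y \<in> so.eigenspace c \<longleftrightarrow> (\<forall>x\<in>D0. linner y (Aop k l \<theta> f x) = linner (cscale c y) x)"
    unfolding so.eigenspace_def unfolding gadjoint_def graph_A_def using y by auto
  ultimately show ?thesis by blast
qed

lemma Kplus_eq: "Kplus k l \<theta> f = so.eigenspace \<i>"
  using orthogonal_range_eq[of _ \<i>] eigenspace_eq unfolding Kplus_def by auto

lemma Kminus_eq: "Kminus k l \<theta> f = so.eigenspace (- \<i>)"
proof -
  have "x - cscale \<i> y = x + cscale (- \<i>) y" for x y by (auto simp: cscale_def)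
  then show ?thesis
    using orthogonal_range_eq[of _ "- \<i>"] eigenspace_eq unfolding Kminus_def by auto
qed

text \<open>For j \<ge> l the weight at j is positive, so the equation at site j determines the
  value at j + \<Delta>; every site from k on is reached in this way.\<close>

lemma eigenvector_zero:
  assumes w: "Aop k l \<theta> f w = cscale c w" and init: "\<And>n. n < k \<Longrightarrow> w n = 0"
  shows "w = 0"
proof -
  have "w n = 0" for n
  proof (induction n rule: less_induct)
    case (less n)
    show ?case
    proof (cases "n < k")
      case False
      define j where "j = n - (k - l)"
      have j: "j < n" "j + (k - l) = n" "l \<le> j" using False kl by (auto simp: j_def)
      have wj: "w j = 0" "w (j - (k - l)) = 0" using less j by auto
      have "Aop k l \<theta> f w j = cscale c w j" using w by simp
      moreover have "(if j < k then 0 else complex_of_real (beta k l (j - (k - l))) * w (j - (k - l))) = 0"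
        using wj by simp
      ultimately have "cnj (exp (\<i> * complex_of_real \<theta>)) * complex_of_real (beta k l j) * w n = 0"
        using wj(1) j(2) unfolding Aop_apply[OF kl] by (simp only: cscale_def mult_zero_right add_0_left add_0_right)
      then show ?thesis using beta_pos[OF j(3), of k] by simp
    qed (use init in auto)
  qed
  then show ?thesis by auto
qed

text \<open>Below l both off-diagonal terms vanish, which leaves the real number f n against a
  nonreal eigenvalue.\<close>

lemma eigenvector_low:
  assumes w: "Aop k l \<theta> f w = cscale c w" and c: "Im c \<noteq> 0" and n: "n < l"
  shows "w n = 0"
proof -
  have "Aop k l \<theta> f w n = cscale c w n" using w by simp
  then have "(complex_of_real (f n) - c) * w n = 0"
    using n kl unfolding Aop_apply[OF kl] by (simp add: cscale_def beta_eq_0 algebra_simps)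
  moreover have "complex_of_real (f n) - c \<noteq> 0" using c by (auto simp: complex_eq_iff)
  ultimately show ?thesis by simp
qed

section \<open>Vectors supported on one lattice\<close>

lemma lattice_vec_apply: "lattice_vec (k - l) n0 c (n0 + r * (k - l)) = c r"
  using kl by (simp add: lattice_vec_def)

lemma lattice_vec_outside: "(\<And>r. n \<noteq> n0 + r * (k - l)) \<Longrightarrow> lattice_vec (k - l) n0 c n = 0"
  using kl by (auto simp: lattice_vec_def dvd_def) (metis add_diff_inverse_nat mult.commute not_less)

lemma lattice_vec_first:
  assumes "i < k - l" "j < k - l"
  shows "lattice_vec (k - l) (l + i) c (l + j) = (if i = j then c 0 else 0)"
proof (cases "i = j")
  case True
  then show ?thesis using lattice_vec_apply[of "l + i" c 0] by simp
next
  case False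
  have "l + j \<noteq> l + i + r * (k - l)" for r
    using False assms by (cases r) auto
  then show ?thesis using False lattice_vec_outside by simp
qed

lemma lattice_vec_disjoint:
  assumes "i < k - l" "j < k - l" "i \<noteq> j"
  shows "lattice_vec (k - l) (l + i) c n = 0 \<or> lattice_vec (k - l) (l + j) c' n = 0"
proof (rule ccontr)
  assume "\<not> ?thesis"
  then obtain r s where "n = l + i + r * (k - l)" "n = l + j + s * (k - l)"
    using lattice_vec_outside by metis
  then have "(i + r * (k - l)) mod (k - l) = (j + s * (k - l)) mod (k - l)" by simp
  then show False using assms by simp
qed

lemma lattice_vec_square_sums:
  shows "summable (\<lambda>n. (cmod (lattice_vec (k - l) n0 c n))\<^sup>2) \<longleftrightarrow> summable (\<lambda>r. (cmod (c r))\<^sup>2)"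
    and "(\<Sum>n. (cmod (lattice_vec (k - l) n0 c n))\<^sup>2) = (\<Sum>r. (cmod (c r))\<^sup>2)"
proof -
  let ?g = "\<lambda>r. n0 + r * (k - l)"
  have g: "strict_mono ?g" using kl by (auto intro!: strict_monoI)
  have 0: "(cmod (lattice_vec (k - l) n0 c n))\<^sup>2 = 0" if "n \<notin> range ?g" for n
    using lattice_vec_outside[of n n0 c] that by auto
  show "summable (\<lambda>n. (cmod (lattice_vec (k - l) n0 c n))\<^sup>2) \<longleftrightarrow> summable (\<lambda>r. (cmod (c r))\<^sup>2)"
    using summable_mono_reindex[OF g, of "\<lambda>n. (cmod (lattice_vec (k - l) n0 c n))\<^sup>2", OF 0] by (simp add: lattice_vec_apply)
  show "(\<Sum>n. (cmod (lattice_vec (k - l) n0 c n))\<^sup>2) = (\<Sum>r. (cmod (c r))\<^sup>2)"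
    using suminf_mono_reindex[OF g, of "\<lambda>n. (cmod (lattice_vec (k - l) n0 c n))\<^sup>2", OF 0] by (simp add: lattice_vec_apply)
qed

text \<open>On the lattice \<open>n0 + \<nat> \<Delta>\<close> the eigenvalue equation is a three-term recurrence; off it,
  both sides vanish.\<close>

lemma Aop_lattice_vec:
  assumes n0: "l \<le> n0" "n0 < k"
    and rec: "\<And>r. exp (\<i> * complex_of_real \<theta>) * (if r = 0 then 0 else
          complex_of_real (beta k l (n0 + (r - 1) * (k - l))) * c (r - 1))
        + cnj (exp (\<i> * complex_of_real \<theta>)) * complex_of_real (beta k l (n0 + r * (k - l))) * c (r + 1)
        + complex_of_real (f (n0 + r * (k - l))) * c r = e * c r"
  shows "Aop k l \<theta> f (lattice_vec (k - l) n0 c) = cscale e (lattice_vec (k - l) n0 c)"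
proof
  fix n
  let ?y = "lattice_vec (k - l) n0 c"
  show "Aop k l \<theta> f ?y n = cscale e ?y n"
  proof (cases "\<exists>r. n = n0 + r * (k - l)")
    case True
    then obtain r where n: "n = n0 + r * (k - l)" by blast
    have up: "?y (n + (k - l)) = c (r + 1)"
      using lattice_vec_apply[of n0 c "r + 1"] by (simp add: n add_ac)
    have down: "(if n < k then 0 else complex_of_real (beta k l (n - (k - l))) * ?y (n - (k - l)))
        = (if r = 0 then 0 else complex_of_real (beta k l (n0 + (r - 1) * (k - l))) * c (r - 1))"
    proof (cases r)
      case 0
      then show ?thesis using n0 n by simp
    next
      case (Suc s)
      have "\<not> n < k" using Suc n n0 kl by simp
      moreover have "n - (k - l) = n0 + s * (k - l)" using Suc n by simp
      ultimately show ?thesis using Suc lattice_vec_apply[of n0 c s] by simp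
    qed
    show ?thesis
      unfolding Aop_apply[OF kl] up down using rec[of r] lattice_vec_apply[of n0 c r]
      by (simp add: cscale_def n)
  next
    case False
    have "?y n = 0" using False lattice_vec_outside by blast
    moreover have "complex_of_real (beta k l n) * ?y (n + (k - l)) = 0"
    proof (cases "n < l")
      case True
      then show ?thesis by (simp add: beta_eq_0)
    next
      case nl: False
      have "n + (k - l) \<noteq> n0 + r * (k - l)" for r
      proof
        assume eq: "n + (k - l) = n0 + r * (k - l)"
        show False
        proof (cases r)
          \<comment> \<open>Here n + \<Delta> = n0 < k, which would give n < l.\<close>
          case 0
          then show False using eq nl n0 by simp
        next
          case (Suc s)
          then have "n + (k - l) = (n0 + s * (k - l)) + (k - l)" using eq by simp
          then have "n = n0 + s * (k - l)" by (rule add_right_imp_eq)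
          then show False using False by blast
        qed
      qed
      then show ?thesis using lattice_vec_outside by simp
    qed
    moreover have "?y (n - (k - l)) = 0" if "\<not> n < k"
    proof (rule lattice_vec_outside)
      fix r show "n - (k - l) \<noteq> n0 + r * (k - l)"
        using False that spec[of "\<lambda>r. n \<noteq> n0 + r * (k - l)" "Suc r"] by auto
    qed
    ultimately show ?thesis unfolding Aop_apply[OF kl] by (simp add: cscale_def mult.assoc)
  qed
qed

lemma phi_eigen:
  assumes n0: "l \<le> n0" "n0 < k" and d: "solves_rec k l f n0 d"
  shows "Aop k l \<theta> f (phi_plus (k - l) \<theta> n0 d) = cscale \<i> (phi_plus (k - l) \<theta> n0 d)"
    "Aop k l \<theta> f (phi_minus (k - l) \<theta> n0 d) = cscale (- \<i>) (phi_minus (k - l) \<theta> n0 d)"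
proof -
  define \<xi> where "\<xi> = exp (\<i> * complex_of_real \<theta>)"
  have \<xi>r: "exp (\<i> * of_nat r * complex_of_real \<theta>) = \<xi> ^ r" for r
    unfolding \<xi>_def exp_of_nat_mult[symmetric] by (simp add: mult_ac)
  have \<xi>1: "cnj \<xi> * \<xi> = 1"
    unfolding \<xi>_def cis_conv_exp[symmetric] by (simp add: cis_cnj cis_mult)
  define b where "b r = complex_of_real (beta k l (n0 + r * (k - l)))" for r
  define a where "a r = complex_of_real (f (n0 + r * (k - l)))" for r
  have rec: "b r * d (r + 1) = (1 + \<i> * a r) * d r + (if r = 0 then 0 else b (r - 1) * d (r - 1))" for r
  proof -
    have "beta l k (n0 + r * (k - l)) = beta k l (n0 + (r - 1) * (k - l))" if "r \<noteq> 0"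
      using beta_swap[of l k "n0 + (r - 1) * (k - l)"] kl that
      by (cases r) (simp_all add: add_ac)
    then show ?thesis
      using d[unfolded solves_rec_def, rule_format, of r] by (auto simp: a_def b_def algebra_simps)
  qed
  have recc: "b r * cnj (d (r + 1)) = (1 - \<i> * a r) * cnj (d r) + (if r = 0 then 0 else b (r - 1) * cnj (d (r - 1)))" for r
    using arg_cong[OF rec[of r], of cnj] by (auto simp: a_def b_def)
  \<comment> \<open>One computation for both signs, with j = \<open>\<i>\<close> or j =
    \<open>- \<i>\<close>. The phases cancel through \<open>cnj \<xi> * \<xi> = 1\<close>, and
    \<open>j * j = -1\<close> supplies the signs; for \<open>- \<i>\<close> it is fed the conjugated
    recurrence, whose weights and \<open>f\<close> are real.\<close>
  have key: "\<xi> * (if r = 0 then 0 else b (r - 1) * (j ^ (r - 1) * \<xi> ^ (r - 1) * D (r - 1)))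
      + cnj \<xi> * b r * (j ^ (r + 1) * \<xi> ^ (r + 1) * D (r + 1)) + a r * (j ^ r * \<xi> ^ r * D r)
      = j * (j ^ r * \<xi> ^ r * D r)"
    if j: "j * j = -1" and D: "\<And>r. b r * D (r + 1) = (1 + j * a r) * D r + (if r = 0 then 0 else b (r - 1) * D (r - 1))"
    for j D r
  proof -
    have "cnj \<xi> * b r * (j ^ (r + 1) * \<xi> ^ (r + 1) * D (r + 1)) = (cnj \<xi> * \<xi>) * (j * (j ^ r * \<xi> ^ r)) * (b r * D (r + 1))"
      by (simp add: mult_ac)
    also have "\<dots> = j * (j ^ r * \<xi> ^ r) * D r + (j * j) * (j ^ r * \<xi> ^ r) * a r * D r
        + j * (j ^ r * \<xi> ^ r) * (if r = 0 then 0 else b (r - 1) * D (r - 1))"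
      unfolding \<xi>1 D by (simp add: algebra_simps)
    also have "j * (j ^ r * \<xi> ^ r) * (if r = 0 then 0 else b (r - 1) * D (r - 1))
        = (j * j) * (\<xi> * (if r = 0 then 0 else b (r - 1) * (j ^ (r - 1) * \<xi> ^ (r - 1) * D (r - 1))))"
      by (cases r) (simp_all add: mult_ac)
    finally show ?thesis unfolding j by (simp add: algebra_simps)
  qed
  show "Aop k l \<theta> f (phi_plus (k - l) \<theta> n0 d) = cscale \<i> (phi_plus (k - l) \<theta> n0 d)"
    unfolding phi_plus_def \<xi>r
    by (intro Aop_lattice_vec n0, unfold \<xi>_def[symmetric] b_def[symmetric] a_def[symmetric], rule key[OF _ rec]) simp
  show "Aop k l \<theta> f (phi_minus (k - l) \<theta> n0 d) = cscale (- \<i>) (phi_minus (k - l) \<theta> n0 d)"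
    unfolding phi_minus_def \<xi>r
    by (intro Aop_lattice_vec n0, unfold \<xi>_def[symmetric] b_def[symmetric] a_def[symmetric], rule key) (use recc in simp_all)
qed

text \<open>The equation at r = 0 has no preceding term, so \<open>d 0\<close> alone determines the
  solution.\<close>

lemma solves_rec_nonzero:
  assumes n0: "l \<le> n0" and d: "solves_rec k l f n0 d" "d \<noteq> (\<lambda>_. 0)"
  shows "d 0 \<noteq> 0"
proof
  assume d0: "d 0 = 0"
  have "d r = 0" for r
  proof (induction r rule: less_induct)
    case (less r)
    show ?case
    proof (cases r)
      case (Suc s)
      have "d s = 0" "s > 0 \<Longrightarrow> d (s - 1) = 0" using less Suc by auto
      then have "complex_of_real (beta k l (n0 + s * (k - l))) * d r = 0"
        using d(1)[unfolded solves_rec_def, rule_format, of s] Suc by (auto split: if_splits)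
      then show ?thesis using beta_pos[of l "n0 + s * (k - l)" k] n0 by simp
    qed (use d0 in simp)
  qed
  then show False using d(2) by auto
qed

lemma solves_rec_exists:
  assumes n0: "l \<le> n0"
  obtains d where "solves_rec k l f n0 d" "d \<noteq> (\<lambda>_. 0)"
proof -
  \<comment> \<open>The state is the pair (d (r - 1), d r). It starts at (0, 1), where 0 stands in
    for the absent term and is guarded by the case r = 0.\<close>
  define F where "F r p = (snd p, ((1 + \<i> * complex_of_real (f (n0 + r * (k - l)))) * snd p
     + (if r = 0 then 0 else complex_of_real (beta l k (n0 + r * (k - l))) * fst p))
     / complex_of_real (beta k l (n0 + r * (k - l))))" for r and p :: "complex \<times> complex"
  define P where "P = rec_nat (0, 1) F"
  have P: "P 0 = (0, 1)" "P (Suc r) = F r (P r)" for r by (simp_all add: P_def)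
  define d where "d r = snd (P r)" for r
  have fst: "fst (P (Suc r)) = d r" for r by (simp add: P d_def F_def)
  have "solves_rec k l f n0 d"
    unfolding solves_rec_def
  proof
    fix r
    have "fst (P r) = d (r - 1)" if "r \<noteq> 0" using fst[of "r - 1"] that by simp
    moreover have "complex_of_real (beta k l (n0 + r * (k - l))) \<noteq> 0"
      using beta_pos[of l "n0 + r * (k - l)" k] n0 by simp
    moreover have "d (r + 1) = snd (F r (P r))" by (simp add: d_def P)
    ultimately show "complex_of_real (beta k l (n0 + r * (k - l))) * d (r + 1)
     - (1 + \<i> * complex_of_real (f (n0 + r * (k - l)))) * d r
     - (if r = 0 then 0 else complex_of_real (beta l k (n0 + r * (k - l))) * d (r - 1)) = 0"
      by (auto simp: F_def d_def)
  qed
  moreover have "d 0 = 1" by (simp add: d_def P)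
  then have "d \<noteq> (\<lambda>_. 0)" by (metis zero_neq_one)
  ultimately show ?thesis by (rule that)
qed

text \<open>On the window l, ..., k - 1 the family \<open>e\<close> is diagonal, so the coefficients
  \<open>u (l + i) / x i\<close> make the combination agree with u there. The difference vanishes
  below l by \<open>eigenvector_low\<close> and everywhere by
  \<open>eigenvector_zero\<close>.\<close>

lemma eigenspace_eq_lincomb:
  assumes c: "Im c \<noteq> 0"
    and e: "\<And>i. i < k - l \<Longrightarrow> e i \<in> so.eigenspace c"
    and init: "\<And>i j. i < k - l \<Longrightarrow> j < k - l \<Longrightarrow> e i (l + j) = (if i = j then x i else 0)"
    and x: "\<And>i. i < k - l \<Longrightarrow> x i \<noteq> 0"
  shows "so.eigenspace c = range (\<lambda>a. lincomb (k - l) a e)"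
proof (intro set_eqI iffI)
  fix u assume "u \<in> range (\<lambda>a. lincomb (k - l) a e)"
  then obtain a where u: "u = lincomb (k - l) a e" by blast
  have "lincomb (k - l) a e \<in> l2" using e unfolding eigenspace_eq by (intro lincomb_l2) auto
  moreover have "Aop k l \<theta> f (lincomb (k - l) a e) = cscale c (lincomb (k - l) a e)"
    unfolding Aop_lincomb using e unfolding eigenspace_eq
    by (auto simp: lincomb_def cscale_def fun_eq_iff sum_distrib_left mult_ac intro!: sum.cong)
  ultimately show "u \<in> so.eigenspace c" unfolding u eigenspace_eq by simp
next
  fix u assume "u \<in> so.eigenspace c"
  then have u: "u \<in> l2" "Aop k l \<theta> f u = cscale c u" by (auto simp: eigenspace_eq)
  define a where "a i = u (l + i) / x i" for i
  define w where "w = u + cscale (-1) (lincomb (k - l) a e)"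
  have "Aop k l \<theta> f (lincomb (k - l) a e) = cscale c (lincomb (k - l) a e)"
    unfolding Aop_lincomb using e unfolding eigenspace_eq
    by (auto simp: lincomb_def cscale_def fun_eq_iff sum_distrib_left mult_ac intro!: sum.cong)
  then have w: "Aop k l \<theta> f w = cscale c w"
    unfolding w_def Aop_add Aop_cscale u(2) by (auto simp: cscale_def algebra_simps)
  have "w n = 0" if n: "n < k" for n
  proof (cases "n < l")
    case True
    then show ?thesis by (rule eigenvector_low[OF w c])
  next
    case False
    then obtain j where j: "n = l + j" "j < k - l" using n by (metis add_diff_inverse_nat diff_less_mono not_less)
    have "lincomb (k - l) a e (l + j) = (\<Sum>i<k - l. a i * (if i = j then x i else 0))"
      unfolding lincomb_def using j init by (intro sum.cong) auto
    also have "\<dots> = u (l + j)" using j x by (simp add: a_def if_distrib cong: if_cong)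
    finally show ?thesis by (simp add: w_def j cscale_def)
  qed
  then have "w = 0" by (rule eigenvector_zero[OF w])
  then have "u = lincomb (k - l) a e" by (auto simp: w_def fun_eq_iff cscale_def)
  then show "u \<in> range (\<lambda>a. lincomb (k - l) a e)" by blast
qed

end

section \<open>Spans and dimensions\<close>

lemma cspan_lincomb: "cspan (e ` {..<m}) = range (\<lambda>a. lincomb m a e)"
proof
  show "range (\<lambda>a. lincomb m a e) \<subseteq> cspan (e ` {..<m})"
  proof (rule image_subsetI)
    show "lincomb m a e \<in> cspan (e ` {..<m})" for a
      unfolding lincomb_eq_sum by (rule vs.span_sum, rule vs.span_scale, rule vs.span_base) simp
  qed
  show "cspan (e ` {..<m}) \<subseteq> range (\<lambda>a. lincomb m a e)"
  proof (rule vs.span_minimal)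
    show "e ` {..<m} \<subseteq> range (\<lambda>a. lincomb m a e)"
    proof
      fix v assume "v \<in> e ` {..<m}"
      then obtain i where "i < m" "v = e i" by auto
      then have "v = lincomb m (\<lambda>j. if j = i then 1 else 0) e"
        by (auto simp: lincomb_def fun_eq_iff if_distrib[of "\<lambda>x. x * _"] cong: if_cong)
      then show "v \<in> range (\<lambda>a. lincomb m a e)" by blast
    qed
    show "vs.subspace (range (\<lambda>a. lincomb m a e))"
    proof (rule vs.subspaceI)
      have "0 = lincomb m (\<lambda>_. 0) e" by (auto simp: lincomb_def)
      then show "0 \<in> range (\<lambda>a. lincomb m a e)" by blast
    qed (auto simp: lincomb_add cscale_lincomb)
  qed
qed

text \<open>Evaluation at the points \<open>g j\<close> is diagonal on the family, which gives its
  independence.\<close>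

lemma cdim_lincomb:
  assumes init: "\<And>i j. i < m \<Longrightarrow> j < m \<Longrightarrow> e i (g j) = (if i = j then x i else 0)"
    and x: "\<And>i. i < m \<Longrightarrow> x i \<noteq> (0::complex)"
  shows "cdim (range (\<lambda>a. lincomb m a e)) = m"
proof -
  have inj: "inj_on e {..<m}"
  proof (rule inj_onI)
    fix i j assume ij: "i \<in> {..<m}" "j \<in> {..<m}" "e i = e j"
    then have "e i (g i) = e j (g i)" by simp
    then show "i = j" using init[of i i] init[of j i] ij x[of i] by (auto split: if_splits)
  qed
  have "vs.independent (e ` {..<m})"
  proof (rule vs.independent_if_scalars_zero)
    fix h v assume h: "(\<Sum>v\<in>e ` {..<m}. cscale (h v) v) = 0" and v: "v \<in> e ` {..<m}"
    obtain i where i: "i < m" "v = e i" using v by auto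
    have "lincomb m (\<lambda>i. h (e i)) e = 0"
      using h unfolding lincomb_eq_sum by (simp add: sum.reindex[OF inj])
    then have "0 = lincomb m (\<lambda>i. h (e i)) e (g i)" by simp
    also have "\<dots> = (\<Sum>j<m. h (e j) * (if j = i then x j else 0))"
      unfolding lincomb_def using i init by (intro sum.cong) auto
    also have "\<dots> = h v * x i" using i by (simp add: if_distrib cong: if_cong)
    finally show "h v = 0" using x[OF i(1)] by simp
  qed simp
  then have "cdim (cspan (e ` {..<m})) = card (e ` {..<m})"
    by (rule vs.dim_span_eq_card_independent)
  then show ?thesis
    unfolding cspan_lincomb by (simp only: card_image[OF inj] card_lessThan)
qed

section \<open>The extensions of the Hamiltonian\<close>

locale fock_hamiltonian =
  fixes k l :: nat and \<theta> :: real and f :: "nat \<Rightarrow> real" and lam :: "nat \<Rightarrow> complex" and \<kappa> :: real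
    and d :: "nat \<Rightarrow> nat \<Rightarrow> complex"
  assumes kl: "l < k" and kl3: "3 \<le> k + l" and f_nonneg: "0 \<le> f n"
    and asym: "asymp_exp (\<lambda>n. complex_of_real (f n / beta k l n)) lam" "lam 0 = complex_of_real \<kappa>" "\<kappa> < 2"
    and sol: "l \<le> n0 \<Longrightarrow> n0 < k \<Longrightarrow> solves_rec k l f n0 (d n0) \<and> d n0 \<noteq> (\<lambda>_. 0)"
begin

definition php :: "nat \<Rightarrow> nat \<Rightarrow> complex" where "php n0 = phi_plus (k - l) \<theta> n0 (d n0)"
definition phm :: "nat \<Rightarrow> nat \<Rightarrow> complex" where "phm n0 = phi_minus (k - l) \<theta> n0 (d n0)"
definition ep :: "nat \<Rightarrow> nat \<Rightarrow> complex" where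
  "ep i = cscale (1 / complex_of_real (lnorm (php (l + i)))) (php (l + i))"
text \<open>Normalised by the norm of the plus vector, which equals that of the minus vector by
  \<open>lnorm_phm\<close>. This matches \<open>DU\<close>, where only plus norms occur.\<close>

definition em :: "nat \<Rightarrow> nat \<Rightarrow> complex" where
  "em i = cscale (1 / complex_of_real (lnorm (php (l + i)))) (phm (l + i))"

lemma in_range: "i < k - l \<Longrightarrow> l \<le> l + i \<and> l + i < k"
  by auto

lemma d_first: "i < k - l \<Longrightarrow> d (l + i) 0 \<noteq> 0"
  using solves_rec_nonzero[OF kl, where ?n0.0 = "l + i" and d = "d (l + i)" and f = f]
    sol[of "l + i"] in_range[of i] by simp

lemma d_square_summable: "i < k - l \<Longrightarrow> summable (\<lambda>r. (cmod (d (l + i) r))\<^sup>2)"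
  using sol[of "l + i"] in_range[of i]
  by (intro solves_rec_square_summable[OF kl kl3 f_nonneg asym, where ?n0.0 = "l + i"]) auto

lemma cmod_phase: "cmod (exp (\<i> * of_nat r * complex_of_real \<theta>)) = 1"
  by (simp add: norm_exp_eq_Re)

lemma php_l2: "i < k - l \<Longrightarrow> php (l + i) \<in> l2" and phm_l2: "i < k - l \<Longrightarrow> phm (l + i) \<in> l2"
  using d_square_summable[of i] unfolding php_def phm_def phi_plus_def phi_minus_def l2_def mem_Collect_eq
  by (simp_all add: lattice_vec_square_sums[OF kl] norm_mult norm_power cmod_phase)

lemma lnorm_phm: "lnorm (phm n0) = lnorm (php n0)"
  unfolding lnorm_def php_def phm_def phi_plus_def phi_minus_def
  by (simp add: lattice_vec_square_sums[OF kl] norm_mult norm_power cmod_phase)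

lemma php_first: "i < k - l \<Longrightarrow> j < k - l \<Longrightarrow> php (l + i) (l + j) = (if i = j then d (l + i) 0 else 0)"
  unfolding php_def phi_plus_def by (simp add: lattice_vec_first[OF kl])

lemma phm_first: "i < k - l \<Longrightarrow> j < k - l \<Longrightarrow> phm (l + i) (l + j) = (if i = j then cnj (d (l + i) 0) else 0)"
  unfolding phm_def phi_minus_def by (simp add: lattice_vec_first[OF kl])

lemma lnorm_php: "i < k - l \<Longrightarrow> lnorm (php (l + i)) > 0"
  using norm_le_lnorm[OF php_l2, of i "l + i"] d_first[of i] php_first[of i i]
  by (auto intro: less_le_trans[of _ "cmod (d (l + i) 0)"])

lemma linner_orth:
  assumes "i < k - l" "j < k - l" "i \<noteq> j"
  shows "linner (php (l + i)) (php (l + j)) = 0" "linner (phm (l + i)) (phm (l + j)) = 0"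
proof -
  have "php (l + i) n = 0 \<or> php (l + j) n = 0" "phm (l + i) n = 0 \<or> phm (l + j) n = 0" for n
    unfolding php_def phm_def phi_plus_def phi_minus_def by (rule lattice_vec_disjoint[OF kl assms])+
  then have *: "cnj (php (l + i) n) * php (l + j) n = 0" "cnj (phm (l + i) n) * phm (l + j) n = 0" for n
    by simp_all
  show "linner (php (l + i)) (php (l + j)) = 0" "linner (phm (l + i)) (phm (l + j)) = 0"
    unfolding linner_def * by (rule suminf_zero)+
qed

lemma linner_scaled:
  assumes "x \<in> l2" "y \<in> l2"
  shows "linner (cscale (1 / complex_of_real s) x) (cscale (1 / complex_of_real t) y) = linner x y / complex_of_real (s * t)"
  using assms by (simp add: linner_simps)

lemma eigen_php: "i < k - l \<Longrightarrow> php (l + i) \<in> symmetric_operator.eigenspace (graph_A k l \<theta> f) \<i>"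
  and eigen_phm: "i < k - l \<Longrightarrow> phm (l + i) \<in> symmetric_operator.eigenspace (graph_A k l \<theta> f) (- \<i>)"
  using sol[of "l + i"] in_range[of i] php_l2[of i] phm_l2[of i] phi_eigen[OF kl, where ?n0.0 = "l + i" and d = "d (l + i)" and f = f and \<theta> = \<theta>]
  by (auto simp: eigenspace_eq[OF kl] php_def phm_def)

lemma eigenspace_php: "symmetric_operator.eigenspace (graph_A k l \<theta> f) \<i> = range (\<lambda>a. lincomb (k - l) a (\<lambda>i. php (l + i)))"
  by (rule eigenspace_eq_lincomb[OF kl, where x = "\<lambda>i. d (l + i) 0"]) (auto simp: eigen_php php_first d_first)

lemma eigenspace_phm: "symmetric_operator.eigenspace (graph_A k l \<theta> f) (- \<i>) = range (\<lambda>a. lincomb (k - l) a (\<lambda>i. phm (l + i)))"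
  by (rule eigenspace_eq_lincomb[OF kl, where x = "\<lambda>i. cnj (d (l + i) 0)"]) (auto simp: eigen_phm phm_first d_first)

lemma range_lincomb_scaled:
  assumes "\<And>i. i < m \<Longrightarrow> c i \<noteq> 0"
  shows "range (\<lambda>a. lincomb m a (\<lambda>i. cscale (c i) (e i))) = range (\<lambda>a. lincomb m a e)"
proof -
  have 1: "lincomb m a (\<lambda>i. cscale (c i) (e i)) = lincomb m (\<lambda>i. a i * c i) e" for a
    by (simp add: lincomb_def cscale_def mult.assoc)
  have "lincomb m a e = lincomb m (\<lambda>i. (a i / c i) * c i) e" for a
    using assms by (intro lincomb_cong) simp
  then have "lincomb m a e = lincomb m (\<lambda>i. a i / c i) (\<lambda>i. cscale (c i) (e i))" for a
    unfolding 1 .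
  then show ?thesis using 1 by blast
qed

sublocale deficiency_basis "graph_A k l \<theta> f" "k - l" ep em
proof (intro deficiency_basis.intro symmetric_operator_graph_A[OF kl] deficiency_basis_axioms.intro)
  show "symmetric_operator.eigenspace (graph_A k l \<theta> f) \<i> = range (\<lambda>a. lincomb (k - l) a ep)"
    unfolding eigenspace_php ep_def using lnorm_php by (intro range_lincomb_scaled[symmetric]) fastforce
  show "symmetric_operator.eigenspace (graph_A k l \<theta> f) (- \<i>) = range (\<lambda>a. lincomb (k - l) a em)"
    unfolding eigenspace_phm em_def using lnorm_php by (intro range_lincomb_scaled[symmetric]) fastforce
  fix i assume i: "i < k - l"
  show "ep i \<in> l2" "em i \<in> l2" using i php_l2 phm_l2 by (auto simp: ep_def em_def)
  fix j assume j: "j < k - l"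
  have N: "complex_of_real (lnorm (php (l + i))) \<noteq> 0" using lnorm_php[OF i] by simp
  show "linner (ep i) (ep j) = (if i = j then 1 else 0)"
    unfolding ep_def linner_scaled[OF php_l2[OF i] php_l2[OF j]]
    using linner_orth(1)[OF i j] N php_l2[OF i] by (auto simp: linner_self power2_eq_square)
  show "linner (em i) (em j) = (if i = j then 1 else 0)"
    unfolding em_def linner_scaled[OF phm_l2[OF i] phm_l2[OF j]]
    using linner_orth(2)[OF i j] N phm_l2[OF i] by (auto simp: linner_self lnorm_phm power2_eq_square)
qed

lemma image_shift: "h ` {l..<k} = (\<lambda>i. h (l + i)) ` {..<k - l}"
proof -
  have "{l..<k} = (\<lambda>i. l + i) ` {..<k - l}"
    using image_add_atLeastLessThan[of l 0 "k - l"] kl by (simp add: atLeast0LessThan)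
  then show ?thesis by (simp only: image_image)
qed

lemma Kplus_span: "Kplus k l \<theta> f = cspan (php ` {l..<k})"
  unfolding Kplus_eq[OF kl] eigenspace_php image_shift cspan_lincomb ..

lemma Kminus_span: "Kminus k l \<theta> f = cspan (phm ` {l..<k})"
  unfolding Kminus_eq[OF kl] eigenspace_phm image_shift cspan_lincomb ..

lemma cdim_Kplus: "cdim (Kplus k l \<theta> f) = k - l"
  unfolding Kplus_eq[OF kl] eigenspace_php
  by (rule cdim_lincomb[where g = "\<lambda>j. l + j" and x = "\<lambda>i. d (l + i) 0"]) (auto simp: php_first d_first)

lemma cdim_Kminus: "cdim (Kminus k l \<theta> f) = k - l"
  unfolding Kminus_eq[OF kl] eigenspace_phm
  by (rule cdim_lincomb[where g = "\<lambda>j. l + j" and x = "\<lambda>i. cnj (d (l + i) 0)"]) (auto simp: phm_first d_first)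

text \<open>Passing from \<open>a i\<close> to \<open>a i * N i\<close> is a bijection of the
  coefficients; it absorbs the numerators of the norm quotients, while the denominators normalise
  the minus vectors.\<close>

lemma DU_eq_defect_domain: "DU (k - l) l php phm U = defect_domain U"
proof -
  define N where "N i = complex_of_real (lnorm (php (l + i)))" for i
  have N: "N i \<noteq> 0" if "i < k - l" for i using lnorm_php[OF that] by (simp add: N_def)
  define V where "V a = (\<lambda>n. (\<Sum>i<k - l. a i * php (l + i) n)
        - (\<Sum>i<k - l. \<Sum>j<k - l. a i * U i j
             * complex_of_real (lnorm (php (l + i)) / lnorm (php (l + j))) * phm (l + j) n))" for a
  define W where "W a = lincomb (k - l) a ep + lincomb (k - l) (act U a) em" for a
  have VW: "V a = W (\<lambda>i. a i * N i)" for a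
  proof
    fix n
    have "lincomb (k - l) (\<lambda>i. a i * N i) ep n = (\<Sum>i<k - l. a i * php (l + i) n)"
      unfolding lincomb_def ep_def cscale_def N_def[symmetric] using N by (intro sum.cong) auto
    moreover have "lincomb (k - l) (act U (\<lambda>i. a i * N i)) em n
        = - (\<Sum>j<k - l. \<Sum>i<k - l. a i * U i j * (N i / N j) * phm (l + j) n)"
      unfolding lincomb_def em_def cscale_def N_def[symmetric] act_def sum_negf[symmetric]
      by (intro sum.cong refl) (simp add: sum_distrib_left sum_distrib_right sum_divide_distrib sum_negf mult_ac)
    moreover have "(\<Sum>j<k - l. \<Sum>i<k - l. a i * U i j * (N i / N j) * phm (l + j) n)
        = (\<Sum>i<k - l. \<Sum>j<k - l. a i * U i j * (N i / N j) * phm (l + j) n)"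
      by (rule sum.swap)
    ultimately show "V a n = W (\<lambda>i. a i * N i) n"
      unfolding V_def W_def of_real_divide N_def[symmetric] by simp
  qed
  have WV: "W a = V (\<lambda>i. a i / N i)" for a
  proof -
    have "act U (\<lambda>i. a i / N i * N i) = act U a"
      using N unfolding act_def by (intro ext arg_cong[of _ _ uminus] sum.cong) auto
    moreover have "lincomb (k - l) (\<lambda>i. a i / N i * N i) ep = lincomb (k - l) a ep"
      using N by (intro lincomb_cong) auto
    ultimately show ?thesis unfolding VW W_def by simp
  qed
  have "DU (k - l) l php phm U = range V" unfolding DU_def V_def by auto
  also have "\<dots> = range W" using VW WV by blast
  also have "\<dots> = defect_domain U" unfolding defect_domain_def W_def by auto
  finally show ?thesis .
qed

end

theorem theorem4p16:
  fixes k l :: nat and \<theta> :: real and f :: "nat \<Rightarrow> real"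
  assumes kl: "k > l" and kl3: "k + l \<ge> 3"
    and fnn: "\<forall>n. f n \<ge> 0"
    and asym: "\<exists>lam \<kappa>. asymp_exp (\<lambda>n. complex_of_real (f n / beta k l n)) lam
                        \<and> lam 0 = complex_of_real \<kappa> \<and> \<kappa> < 2"
  shows "\<not> ess_self_adjoint (graph_A k l \<theta> f)
       \<and> cdim (Kplus k l \<theta> f) = k - l \<and> cdim (Kminus k l \<theta> f) = k - l
       \<and> (\<forall>d :: nat \<Rightarrow> nat \<Rightarrow> complex.
            (\<forall>n0. l \<le> n0 \<and> n0 < k \<longrightarrow> solves_rec k l f n0 (d n0) \<and> d n0 \<noteq> (\<lambda>_. 0)) \<longrightarrow>
            (let phip = (\<lambda>n0. phi_plus (k - l) \<theta> n0 (d n0));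
                 phim = (\<lambda>n0. phi_minus (k - l) \<theta> n0 (d n0));
                 G = graph_A k l \<theta> f
             in Kplus k l \<theta> f = cspan (phip ` {l..<k})
              \<and> Kminus k l \<theta> f = cspan (phim ` {l..<k})
              \<and> bij_betw (\<lambda>U. AU G (DU (k - l) l phip phim U))
                   (unitary_mats (k - l)) {T. G \<subseteq> T \<and> self_adjoint T}
              \<and> (\<forall>U \<in> unitary_mats (k - l).
                   is_core {\<psi>0 + \<phi> | \<psi>0 \<phi>. \<psi>0 \<in> D0 \<and> \<phi> \<in> DU (k - l) l phip phim U}
                           (AU G (DU (k - l) l phip phim U)))))"
proof -
  obtain lam \<kappa> where lam: "asymp_exp (\<lambda>n. complex_of_real (f n / beta k l n)) lam"
    "lam 0 = complex_of_real \<kappa>" "\<kappa> < 2"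
    using asym by blast
  have ham: "fock_hamiltonian k l f lam \<kappa> d"
    if "\<And>n0. l \<le> n0 \<Longrightarrow> n0 < k \<Longrightarrow> solves_rec k l f n0 (d n0) \<and> d n0 \<noteq> (\<lambda>_. 0)" for d
    using kl kl3 fnn lam that by unfold_locales auto
  have "\<exists>d. solves_rec k l f n0 d \<and> d \<noteq> (\<lambda>_. 0)" if "l \<le> n0" for n0
    using solves_rec_exists[OF kl that, of f] by blast
  then obtain d where "\<And>n0. l \<le> n0 \<Longrightarrow> solves_rec k l f n0 (d n0) \<and> d n0 \<noteq> (\<lambda>_. 0)"
    by metis
  \<comment> \<open>A constructed family of solutions serves the claims that mention none; the other
    claims are proved afterwards for an arbitrary family.\<close>
  then interpret h: fock_hamiltonian k l \<theta> f lam \<kappa> d by (intro ham)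
  have "\<not> ess_self_adjoint (graph_A k l \<theta> f)"
    using h.not_ess_self_adjoint kl by simp
  moreover have "Kplus k l \<theta> f = cspan ((\<lambda>n0. phi_plus (k - l) \<theta> n0 (d n0)) ` {l..<k})
      \<and> Kminus k l \<theta> f = cspan ((\<lambda>n0. phi_minus (k - l) \<theta> n0 (d n0)) ` {l..<k})
      \<and> bij_betw (\<lambda>U. AU (graph_A k l \<theta> f) (DU (k - l) l (\<lambda>n0. phi_plus (k - l) \<theta> n0 (d n0))
            (\<lambda>n0. phi_minus (k - l) \<theta> n0 (d n0)) U))
           (unitary_mats (k - l)) {T. graph_A k l \<theta> f \<subseteq> T \<and> self_adjoint T}
      \<and> (\<forall>U \<in> unitary_mats (k - l).
           is_core {\<psi>0 + \<phi> | \<psi>0 \<phi>. \<psi>0 \<in> D0 \<and> \<phi> \<in> DU (k - l) l (\<lambda>n0. phi_plus (k - l) \<theta> n0 (d n0))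
              (\<lambda>n0. phi_minus (k - l) \<theta> n0 (d n0)) U}
             (AU (graph_A k l \<theta> f) (DU (k - l) l (\<lambda>n0. phi_plus (k - l) \<theta> n0 (d n0))
              (\<lambda>n0. phi_minus (k - l) \<theta> n0 (d n0)) U)))"
    if "\<forall>n0. l \<le> n0 \<and> n0 < k \<longrightarrow> solves_rec k l f n0 (d n0) \<and> d n0 \<noteq> (\<lambda>_. 0)" for d
  proof -
    interpret g: fock_hamiltonian k l \<theta> f lam \<kappa> d using that by (intro ham) blast
    have ph: "(\<lambda>n0. phi_plus (k - l) \<theta> n0 (d n0)) = g.php" "(\<lambda>n0. phi_minus (k - l) \<theta> n0 (d n0)) = g.phm"
      by (simp_all add: fun_eq_iff g.php_def g.phm_def)
    show ?thesis
      unfolding ph g.DU_eq_defect_domain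
      using g.Kplus_span g.Kminus_span g.bij_betw_self_adjoint_extensions
        g.core_extension[unfolded Domain_graph_A[OF kl]] by (intro conjI ballI)
  qed
  ultimately show ?thesis
    using h.cdim_Kplus h.cdim_Kminus unfolding Let_def by blast
qed

end
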